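(* For real numbers $x, y$ with $2 \le y \le x$ and a real number $N \ge x$, put $u = \frac{\log x}{\log y}$ and $$S(x,y,N) := (\log x)^{3/2} (\log y)^{1/2} \left( y^{1/2-\alpha(x,y)} + \exp\left\{ -\frac{u}{4}\left( \frac{\log \min\{N, x^{3/2}\}}{\log x} - 1 \right)^2 \right\} \right),$$ where $\alpha(x,y)$ is the saddle point. Suppose that $2 \le y \le x$ and $(\log x)^6 \le y \le x^{\frac{1}{32\log\log x}}$. Then the following hold, with absolute implied constants. (i) For every real $T \ge x$, $$\frac{1}{T} \int_T^{2T} \Bigl| \sum_{\substack{n \le x \\ P(n) \le y}} n^{it} \Bigr| \, dt \ll \sqrt{\Psi(x,y)\, S(x,y,T)}.$$ (ii) For every real $Q \geq 1$ with $x \le Q^2$, $$\frac{1}{Q^2} \sum_{q \le Q} \ \sum^{*}_{\chi \bmod q} \Bigl| \sum_{\substack{n \le x \\ P(n) \le y}} \chi(n) \Bigr| \ll \sqrt{\Psi(x,y)\, S(x,y,Q^2)}.$$ (iii) The same results hold with completely multiplicative twists: for every completely multiplicative function $h:\mathbb{N}\to\mathbb{C}$ with $|h(p)| \le 1$ for every prime $p$, the bound in (i) holds with $n^{it}$ replaced by $h(n) n^{it}$, and the bound in (ii) holds with $\chi(n)$ replaced by $h(n)\chi(n)$.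
   Context: $P(n)$ denotes the largest prime factor of the positive integer $n$, with $n=1$ counted as satisfying $P(n)\le y$; thus $P(n) \le y$ means that all prime factors of $n$ are at most $y$. $\Psi(x,y) = \#\{ n \le x : P(n) \le y\}$. The sum $\sum^*_{\chi \bmod q}$ runs over the primitive Dirichlet characters modulo $q$, and $\sum_{q\le Q}$ runs over positive integers $q \le Q$. For $2 \le y \le x$, the saddle point $\alpha(x,y)$ is the unique real (positive) solution $\alpha$ of $$\sum_{p \le y} \frac{\log p}{p^{\alpha} - 1} = \log x,$$ the sum being over primes $p \le y$. Completely multiplicative means $h(1)=1$ and $h(mn)=h(m)h(n)$ for all positive integers $m,n$. $A \ll B$ means $|A| \le C B$ for some constant $C>0$. *)

theory Defs
  imports "HOL-Analysis.Analysis" "HOL-Real_Asymp.Real_Asymp" "HOL-Number_Theory.Number_Theory"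
begin

definition largest_prime_factor :: "nat \<Rightarrow> nat" where
  "largest_prime_factor n = Max (prime_factors n)"

text \<open>The disjunct \<open>n = 1\<close> is needed because \<open>Max {}\<close> is unspecified.\<close>

definition smooth_numbers :: "real \<Rightarrow> real \<Rightarrow> nat set" where
  "smooth_numbers x y =
     {n. 0 < n \<and> real n \<le> x \<and> (n = 1 \<or> real (largest_prime_factor n) \<le> y)}"

lemma finite_smooth_numbers: "finite (smooth_numbers x y)"
proof (rule finite_subset)
  show "smooth_numbers x y \<subseteq> {..nat \<lfloor>x\<rfloor>}"
    by (auto simp: smooth_numbers_def le_nat_floor)
qed simp

lemma smooth_numbers_altdef:
  "smooth_numbers x y =
     {n. 0 < n \<and> real n \<le> x \<and> (\<forall>p. prime p \<longrightarrow> p dvd n \<longrightarrow> real p \<le> y)}"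
proof -
  have "(n = 1 \<or> real (largest_prime_factor n) \<le> y) \<longleftrightarrow>
        (\<forall>p. prime p \<longrightarrow> p dvd n \<longrightarrow> real p \<le> y)" if n: "0 < n" for n :: nat
  proof (cases "n = 1")
    case True
    then show ?thesis by auto
  next
    case False
    then have ne: "prime_factors n \<noteq> {}"
      using n by (simp add: prime_factorization_empty_iff)
    have "real (Max (prime_factors n)) \<le> y \<longleftrightarrow> (\<forall>p\<in>prime_factors n. real p \<le> y)"
    proof
      assume *: "real (Max (prime_factors n)) \<le> y"
      show "\<forall>p\<in>prime_factors n. real p \<le> y"
      proof
        fix p assume "p \<in> prime_factors n"
        then have "p \<le> Max (prime_factors n)" by simp
        with * show "real p \<le> y" by linarith
      qed
    next
      assume "\<forall>p\<in>prime_factors n. real p \<le> y"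
      then show "real (Max (prime_factors n)) \<le> y"
        using Max_in[OF _ ne] by simp
    qed
    then show ?thesis
      using False n by (auto simp: largest_prime_factor_def in_prime_factors_iff)
  qed
  then show ?thesis unfolding smooth_numbers_def by (intro Collect_cong conj_cong refl)
qed

definition Psi :: "real \<Rightarrow> real \<Rightarrow> nat" where
  "Psi x y = card (smooth_numbers x y)"

definition saddle_point :: "real \<Rightarrow> real \<Rightarrow> real" where
  "saddle_point x y = (THE a. a > 0 \<and>
     (\<Sum>p | prime p \<and> real p \<le> y. ln (real p) / (real p powr a - 1)) = ln x)"

lemma finite_primes_le: "finite {p::nat. prime p \<and> real p \<le> y}"
proof (rule finite_subset)
  show "{p::nat. prime p \<and> real p \<le> y} \<subseteq> {..nat \<lfloor>y\<rfloor>}"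
    by (auto simp: le_nat_floor)
qed simp

lemma saddle_point_ex1:
  fixes x y :: real
  assumes "2 \<le> y" "y \<le> x"
  shows "\<exists>!a. a > 0 \<and> (\<Sum>p | prime p \<and> real p \<le> y. ln (real p) / (real p powr a - 1)) = ln x"
proof -
  define A where "A = {p::nat. prime p \<and> real p \<le> y}"
  define f where "f = (\<lambda>a. \<Sum>p\<in>A. ln (real p) / (real p powr a - 1))"
  have fin: "finite A" unfolding A_def by (rule finite_primes_le)
  have A2: "2 \<in> A" using assms by (simp add: A_def)
  have p2: "real p \<ge> 2" if "p \<in> A" for p
    using that prime_ge_2_nat[of p] by (simp add: A_def)
  have pow: "real p powr a > 1" if "p \<in> A" "a > 0" for p a
    using p2[OF that(1)] that(2) by (simp add: gr_one_powr)
  have lnx: "ln x > 0" using assms by simp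
  have mono: "f b < f a" if "0 < a" "a < b" for a b
    unfolding f_def
  proof (rule sum_strict_mono[OF fin])
    show "A \<noteq> {}" using A2 by blast
    fix p assume p: "p \<in> A"
    have "real p powr a < real p powr b" using p2[OF p] that by simp
    then show "ln (real p) / (real p powr b - 1) < ln (real p) / (real p powr a - 1)"
      using pow[OF p, of a] pow[OF p, of b] p2[OF p] that
      by (intro divide_strict_left_mono) auto
  qed
  have cont: "isCont f a" if "a > 0" for a
    unfolding f_def using pow[OF _ that] p2
    by (intro continuous_intros) (force simp: less_imp_neq)+
  have "(f \<longlongrightarrow> 0) at_top"
  proof -
    have "(f \<longlongrightarrow> (\<Sum>p\<in>A. 0)) at_top" unfolding f_def
    proof (rule tendsto_sum)
      fix p assume "p \<in> A"
      then have "real p > 1" using p2[of p] by simp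
      then have "filterlim (\<lambda>a. real p powr a) at_top at_top" by real_asymp
      then have "filterlim (\<lambda>a. real p powr a - 1) at_top at_top"
        using filterlim_tendsto_add_at_top[OF tendsto_const[of "-1::real"]] by simp
      then show "((\<lambda>a. ln (real p) / (real p powr a - 1)) \<longlongrightarrow> 0) at_top"
        by (intro tendsto_divide_0[OF tendsto_const] filterlim_at_top_imp_at_infinity)
    qed
    then show ?thesis by simp
  qed
  then have "eventually (\<lambda>b. f b < ln x) at_top"
    using lnx by (rule order_tendstoD(2))
  then obtain b0 where b0: "\<And>b. b \<ge> b0 \<Longrightarrow> f b < ln x"
    by (auto simp: eventually_at_top_linorder)
  define a where "a = ln (1 + ln 2 / ln x) / ln 2"
  have l2: "ln (2::real) > 0" by simp
  have r: "ln 2 / ln x > 0" using l2 lnx by (rule divide_pos_pos)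
  then have "ln (1 + ln 2 / ln x) > 0" by (intro ln_gt_zero) linarith
  then have apos: "a > 0" unfolding a_def using l2 by (rule divide_pos_pos)
  have "2 powr a = exp (a * ln 2)" by (simp add: powr_def)
  also have "a * ln 2 = ln (1 + ln 2 / ln x)" unfolding a_def using l2 by simp
  also have "exp \<dots> = 1 + ln 2 / ln x" using r by (intro exp_ln) linarith
  finally have "2 powr a - 1 = ln 2 / ln x" by linarith
  then have "ln x = ln 2 / (2 powr a - 1)" using lnx l2 by (simp only:) (simp add: field_simps)
  also have "\<dots> \<le> f a" unfolding f_def
  proof -
    have "ln (real 2) / (real 2 powr a - 1) \<le> (\<Sum>p\<in>A. ln (real p) / (real p powr a - 1))"
    proof (rule member_le_sum[OF A2 _ fin])
      fix p assume "p \<in> A - {2}"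
      then show "0 \<le> ln (real p) / (real p powr a - 1)"
        using pow[of p a] p2[of p] apos by (intro divide_nonneg_nonneg) force+
    qed
    then show "ln 2 / (2 powr a - 1) \<le> (\<Sum>p\<in>A. ln (real p) / (real p powr a - 1))" by simp
  qed
  finally have fa: "ln x \<le> f a" .
  define b where "b = max a b0"
  have "\<exists>c\<ge>a. c \<le> b \<and> f c = ln x"
  proof (rule IVT2)
    show "f b \<le> ln x" using b0[of b] by (simp add: b_def)
    show "\<forall>c. a \<le> c \<and> c \<le> b \<longrightarrow> isCont f c" using cont apos by simp
  qed (use fa in \<open>auto simp: b_def\<close>)
  then obtain c where "a \<le> c" "f c = ln x" by blast
  then have c: "c > 0" "f c = ln x" using apos by linarith+
  have "\<exists>!a. a > 0 \<and> f a = ln x"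
  proof (rule ex1I[of _ c])
    fix d assume d: "d > 0 \<and> f d = ln x"
    show "d = c" using mono[of c d] mono[of d c] c d by (metis less_irrefl linorder_less_linear)
  qed (use c in simp)
  then show ?thesis by (simp add: f_def A_def)
qed

definition S_bound :: "real \<Rightarrow> real \<Rightarrow> real \<Rightarrow> real" where
  "S_bound x y N =
     (let u = ln x / ln y in
      ln x powr (3/2) * ln y powr (1/2) *
      (y powr (1/2 - saddle_point x y) +
       exp (- (u / 4) * (ln (min N (x powr (3/2))) / ln x - 1)\<^sup>2)))"

definition dirichlet_character :: "nat \<Rightarrow> (nat \<Rightarrow> complex) \<Rightarrow> bool" where
  "dirichlet_character q chi \<longleftrightarrow>
     q > 0 \<and> chi 1 = 1 \<and>
     (\<forall>m n. chi (m * n) = chi m * chi n) \<and>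
     (\<forall>n. chi (n + q) = chi n) \<and>
     (\<forall>n. chi n = 0 \<longleftrightarrow> \<not> coprime n q)"

text \<open>A character is primitive if it is not induced by a character modulo a proper divisor
  of its modulus. In particular the trivial character modulo 1 is primitive.\<close>

definition primitive_character :: "nat \<Rightarrow> (nat \<Rightarrow> complex) \<Rightarrow> bool" where
  "primitive_character q chi \<longleftrightarrow>
     dirichlet_character q chi \<and>
     \<not> (\<exists>d \<psi>. d dvd q \<and> d < q \<and> dirichlet_character d \<psi> \<and>
            (\<forall>n. coprime n q \<longrightarrow> chi n = \<psi> n))"

lemma dirichlet_character_mod:
  assumes "dirichlet_character q chi"
  shows "chi (n mod q) = chi n"
proof -
  have "chi (m + k * q) = chi m" for m k
  proof (induction k)
    case (Suc k)
    have "chi (m + Suc k * q) = chi ((m + k * q) + q)" by (simp add: algebra_simps)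
    then show ?case using Suc assms unfolding dirichlet_character_def by metis
  qed simp
  from this[of "n mod q" "n div q"] show ?thesis by simp
qed

lemma finite_dirichlet_characters: "finite {chi. dirichlet_character q chi}"
proof (cases "q = 0")
  case True
  then show ?thesis by (simp add: dirichlet_character_def)
next
  case False
  define V where "V = insert 0 {z::complex. z ^ totient q = 1}"
  have tq: "totient q > 0" using False by simp
  have "finite {z::complex. z ^ totient q = 1}" using tq by (intro finite_roots_unity) linarith
  then have "finite V" by (simp add: V_def)
  then have fin: "finite (PiE {..<q} (\<lambda>_. V))" by (intro finite_PiE) auto
  let ?R = "\<lambda>chi. restrict chi {..<q}"
  show ?thesis
  proof (rule finite_imageD[of ?R])
    show "finite (?R ` {chi. dirichlet_character q chi})"
    proof (rule finite_subset[OF _ fin], rule image_subsetI)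
      fix chi assume "chi \<in> {chi. dirichlet_character q chi}"
      then have chi: "dirichlet_character q chi" by simp
      have pow: "chi (n ^ k) = chi n ^ k" for n k
        by (induction k) (use chi in \<open>auto simp: dirichlet_character_def\<close>)
      have "chi n \<in> V" for n
      proof (cases "coprime n q")
        case True
        then have "[n ^ totient q = 1] (mod q)" by (rule euler_theorem)
        then have "chi (n ^ totient q) = chi 1"
          using dirichlet_character_mod[OF chi] unfolding cong_def by metis
        then show ?thesis using pow chi by (simp add: V_def dirichlet_character_def)
      next
        case False
        then show ?thesis using chi by (simp add: V_def dirichlet_character_def)
      qed
      then show "?R chi \<in> PiE {..<q} (\<lambda>_. V)" by auto
    qed
    show "inj_on ?R {chi. dirichlet_character q chi}"
    proof (rule inj_onI)
      fix chi \<psi>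
      assume "chi \<in> {chi. dirichlet_character q chi}" "\<psi> \<in> {chi. dirichlet_character q chi}"
        and eq: "?R chi = ?R \<psi>"
      then have *: "dirichlet_character q chi" "dirichlet_character q \<psi>" by simp_all
      show "chi = \<psi>"
      proof
        fix n
        have "n mod q < q" using False by simp
        then have "chi (n mod q) = \<psi> (n mod q)"
          using fun_cong[OF eq, of "n mod q"] by simp
        then show "chi n = \<psi> n" using dirichlet_character_mod[OF *(1)] dirichlet_character_mod[OF *(2)] by metis
      qed
    qed
  qed
qed

text \<open>The value at 0 is left unconstrained: such functions live on the positive integers.\<close>

definition completely_multiplicative :: "(nat \<Rightarrow> complex) \<Rightarrow> bool" where
  "completely_multiplicative h \<longleftrightarrow>
     h 1 = 1 \<and> (\<forall>m n. 0 < m \<longrightarrow> 0 < n \<longrightarrow> h (m * n) = h m * h n)"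

text \<open>At \<open>x = exp 1\<close> the exponent \<open>1 / (32 * ln (ln x))\<close> is \<open>1 / 0 = 0\<close>, and for
  \<open>x < exp 1\<close> it is negative; in both cases the upper bound contradicts \<open>2 \<le> y\<close>.\<close>

definition admissible_range :: "real \<Rightarrow> real \<Rightarrow> bool" where
  "admissible_range x y \<longleftrightarrow>
     2 \<le> y \<and> y \<le> x \<and> ln x ^ 6 \<le> y \<and> y \<le> x powr (1 / (32 * ln (ln x)))"

end

theory Submission
  imports Defs "HOL-Computational_Algebra.Squarefree"
begin

text \<open>
Write \<open>E\<close> for either mean (over \<open>t\<close> in \<open>[T, 2T]\<close>, or over the primitive characters of modulus at
most \<open>Q\<close>, divided by \<open>Q\<^sup>2\<close>), write \<open>X(n)\<close> for \<open>h(n) n\<^sup>i\<^sup>t\<close> or \<open>h(n) \<chi>(n)\<close>, and let \<open>u = log x / log y\<close>.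
All that the argument uses about \<open>X\<close> is that it is completely multiplicative, bounded by 1, and
satisfies the mean value inequality
\<open>E |\<Sum>\<^sub>n\<^sub>\<le>\<^sub>x a\<^sub>n X(n)|\<^sup>2 \<lless> \<Sum>\<^sub>n\<^sub>\<le>\<^sub>x |a\<^sub>n|\<^sup>2\<close>; this is the locale \<open>mean_value_system\<close>.
By Cauchy-Schwarz it gives the trivial bound \<open>sqrt \<Psi>(x, y)\<close> for the mean of the smooth sum.

To save on it, let \<open>g\<close> be the multiplicative function with Dirichlet series \<open>\<zeta>(s)\<close> to the power \<open>1/2\<close>.
Since \<open>g * g = 1\<close>, the smooth sum is the bilinear form
\<open>\<Sum> g(m) X(m) g(n) X(n)\<close> over \<open>m n \<le> x\<close>. Both variables have length at most \<open>x\<close>, so the mean value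
inequality applies to each of them, and Cauchy-Schwarz bounds \<open>E |P R|\<close> for a product of two polynomials
by the product of the \<open>\<ell>\<^sup>2\<close> norms of their coefficients. A dyadic block of pairs \<open>(m, n)\<close> therefore costs the square root of
\<open>\<Sum> g(m)\<^sup>2 g(n)\<^sup>2\<close>, whereas \<open>\<Sum> g(m) g(n)\<close> over the same pairs is at most \<open>\<Psi>(2x, y)\<close>, again because
\<open>g * g = 1\<close>. So the gain is the size of \<open>g(m) g(n)\<close>. As \<open>g(n) \<le> 2\<close> to the power \<open>-\<omega>(n)\<close>, and a
\<open>y\<close>-smooth number without a large square divisor has at least about \<open>log n / log y\<close> distinct primes,
\<open>g(m) g(n)\<close> is at most about \<open>2\<close> to the power \<open>-u\<close> when \<open>m n\<close> is near \<open>x\<close>.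

The hyperbola condition \<open>m n \<le> x\<close> is removed combinatorially at the cost of a factor \<open>log x\<close>
(\<open>bilinear_comparison\<close>), and the numbers with a large square divisor, like those
below \<open>x\<close> to the power \<open>3/4\<close>, are rare because
\<open>\<Psi>(x/d, y) \<le> (d/y)\<close> to the power \<open>-2/3\<close> times \<open>\<Psi>(x, y)\<close> (\<open>Psi_divide_le\<close>); the comparison of \<open>\<Psi>(2x, y)\<close> with
\<open>\<Psi>(x, y)\<close> is \<open>Psi_double\<close>. Both follow from double counting pairs of a smooth number and a prime
factor of it, with Chebyshev's lower bound for the number of primes. The powers of \<open>log x\<close> lost
on the way are absorbed by \<open>u \<ge> 32 log log x\<close>, so that \<open>E |\<Sum> X(n)| \<lless> exp(-u/32) sqrt \<Psi>(x, y)\<close>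
(\<open>mean_smooth_large\<close>). This suffices since \<open>S(x, y, N)\<close> is at least \<open>(log x)\<close> to the power \<open>3/2\<close> times \<open>(log y)\<close>
to the power \<open>1/2\<close> times \<open>exp(-u/16)\<close> (\<open>S_bound_ge\<close>).

The mean value inequality for \<open>n\<^sup>i\<^sup>t\<close> is proved with a smooth weight in \<open>t\<close>
(\<open>mean_value_powr_i\<close>); for characters it is the large sieve (\<open>multiplicative_large_sieve\<close>),
deduced from the additive large sieve by Gauss sums. A twist by \<open>h\<close> only shrinks
the coefficients, hence preserves both.
\<close>

section \<open>The Dirichlet square root of the constant function 1\<close>

text \<open>This is the divisor function \<open>d\<^sub>z\<close> at \<open>z = 1/2\<close>: on \<open>p\<^sup>k\<close> it is the coefficient of \<open>t\<^sup>k\<close> in \<open>(1 - t)\<close> to the power \<open>-1/2\<close>.\<close>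

definition half_divisor :: "nat \<Rightarrow> real" where
  "half_divisor n = (\<Prod>p\<in>prime_factors n. pochhammer (1/2) (multiplicity p n) / fact (multiplicity p n))"

lemma central_weight_bounds:
  shows "0 < pochhammer (1/2 :: real) k / fact k"
    and "0 < k \<Longrightarrow> pochhammer (1/2 :: real) k / fact k \<le> 1/2"
proof -
  show pos: "0 < pochhammer (1/2 :: real) k / fact k" for k
    by (intro divide_pos_pos pochhammer_pos) auto
  have step: "pochhammer (1/2 :: real) (Suc k) / fact (Suc k) = 
      (pochhammer (1/2) k / fact k) * ((1/2 + real k) / (1 + real k))" for k
    by (simp add: pochhammer_Suc)
  show "0 < k \<Longrightarrow> pochhammer (1/2 :: real) k / fact k \<le> 1/2"
  proof (induction k)
    case (Suc k)
    show ?case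
    proof (cases "k = 0")
      case False
      have "(1/2 + real k) / (1 + real k) \<le> 1" by simp
      then have "pochhammer (1/2 :: real) (Suc k) / fact (Suc k) \<le> (pochhammer (1/2) k / fact k) * 1"
        unfolding step using pos[of k] by (intro mult_left_mono) auto
      then show ?thesis using Suc.IH False by linarith
    qed simp
  qed simp
qed

text \<open>This is the Vandermonde identity, reflecting that the power series \<open>(1 - t)\<close> to the power \<open>-1/2\<close> squares to the geometric series.\<close>

lemma central_weight_convolution:
  "(\<Sum>i\<le>k. (pochhammer (1/2 :: real) i / fact i) * (pochhammer (1/2) (k - i) / fact (k - i))) = 1"
proof -
  have "fact k = pochhammer (1/2 + 1/2 :: real) k"
    by (simp add: pochhammer_fact)
  also have "\<dots> = (\<Sum>i\<le>k. real (k choose i) * pochhammer (1/2) i * pochhammer (1/2) (k - i))"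
    by (rule pochhammer_binomial_sum)
  also have "\<dots> = (\<Sum>i\<le>k. fact k * ((pochhammer (1/2 :: real) i / fact i) * (pochhammer (1/2) (k - i) / fact (k - i))))"
    by (intro sum.cong refl) (simp add: binomial_fact)
  also have "\<dots> = fact k * (\<Sum>i\<le>k. (pochhammer (1/2 :: real) i / fact i) * (pochhammer (1/2) (k - i) / fact (k - i)))"
    by (simp add: sum_distrib_left)
  finally show ?thesis by simp
qed

lemma half_divisor_pos: "0 < half_divisor n"
  unfolding half_divisor_def by (intro prod_pos central_weight_bounds(1))

lemma half_divisor_le: "half_divisor n \<le> (1/2) ^ card (prime_factors n)"
proof -
  have "half_divisor n \<le> (\<Prod>p\<in>prime_factors n. 1/2)"
    unfolding half_divisor_def
  proof (intro prod_mono conjI)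
    fix p assume p: "p \<in> prime_factors n"
    then have "0 < multiplicity p n"
      using prime_factors_multiplicity[of n] by auto
    then show "pochhammer (1/2 :: real) (multiplicity p n) / fact (multiplicity p n) \<le> 1/2"
      by (rule central_weight_bounds(2))
  qed (use central_weight_bounds(1) less_imp_le in blast)
  then show ?thesis by simp
qed

lemma half_divisor_prime_power:
  assumes "prime p"
  shows "half_divisor (p ^ k) = pochhammer (1/2) k / fact k"
proof (cases "k = 0")
  case False
  then have "prime_factors (p ^ k) = {p}"
    using assms by (simp add: prime_factorization_prime_power)
  then show ?thesis using assms by (simp add: half_divisor_def)
qed (simp add: half_divisor_def)

lemma half_divisor_mult_coprime:
  assumes "coprime m n" "0 < m" "0 < n"
  shows "half_divisor (m * n) = half_divisor m * half_divisor n"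
proof -
  let ?w = "\<lambda>k. pochhammer (1/2) k / fact k :: real"
  have disj: "prime_factors m \<inter> prime_factors n = {}"
    using assms(1) by (auto simp: in_prime_factors_iff dest: coprime_common_divisor_nat)
  have "prime_factors (m * n) = prime_factors m \<union> prime_factors n"
    using assms by (intro prime_factors_product) auto
  then have "half_divisor (m * n) =
      (\<Prod>p\<in>prime_factors m. ?w (multiplicity p (m * n))) * (\<Prod>p\<in>prime_factors n. ?w (multiplicity p (m * n)))"
    using disj by (simp add: half_divisor_def prod.union_disjoint)
  also have "(\<Prod>p\<in>prime_factors m. ?w (multiplicity p (m * n))) = half_divisor m"
    unfolding half_divisor_def
  proof (intro prod.cong refl)
    fix p assume p: "p \<in> prime_factors m"
    then have "multiplicity p n = 0"
      using disj assms by (auto simp: in_prime_factors_iff intro!: not_dvd_imp_multiplicity_0)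
    then show "?w (multiplicity p (m * n)) = ?w (multiplicity p m)"
      using p assms by (simp add: in_prime_factors_iff prime_elem_multiplicity_mult_distrib)
  qed
  also have "(\<Prod>p\<in>prime_factors n. ?w (multiplicity p (m * n))) = half_divisor n"
    unfolding half_divisor_def
  proof (intro prod.cong refl)
    fix p assume p: "p \<in> prime_factors n"
    then have "multiplicity p m = 0"
      using disj assms by (auto simp: in_prime_factors_iff intro!: not_dvd_imp_multiplicity_0)
    then show "?w (multiplicity p (m * n)) = ?w (multiplicity p n)"
      using p assms by (simp add: in_prime_factors_iff prime_elem_multiplicity_mult_distrib)
  qed
  finally show ?thesis .
qed

lemma sum_divisors_coprime_mult:
  fixes m n :: nat and F :: "nat \<Rightarrow> real"
  assumes "coprime m n" "0 < m" "0 < n"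
  shows "(\<Sum>d | d dvd m * n. F d) = (\<Sum>a | a dvd m. \<Sum>b | b dvd n. F (a * b))"
proof -
  have gcds: "gcd (a * b) m = a" "gcd (a * b) n = b" if "a dvd m" "b dvd n" for a b
  proof -
    have "coprime b m" "coprime a n"
      using that assms(1) by (metis coprime_commute coprime_divisors dvd_refl)+
    then show "gcd (a * b) m = a" "gcd (a * b) n = b"
      using that by (simp_all add: gcd_mult_left_left_cancel gcd_mult_left_right_cancel
        coprime_commute gcd_nat.absorb1)
  qed
  have "(\<Sum>a | a dvd m. \<Sum>b | b dvd n. F (a * b)) = (\<Sum>(a, b)\<in>{a. a dvd m} \<times> {b. b dvd n}. F (a * b))"
    by (simp add: sum.cartesian_product)
  also have "\<dots> = (\<Sum>d | d dvd m * n. F d)"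
  proof (rule sum.reindex_bij_witness[of _ "\<lambda>d. (gcd d m, gcd d n)" "\<lambda>(a, b). a * b"])
    fix d assume "d \<in> {d. d dvd m * n}"
    then obtain a b where "d = a * b" "a dvd m" "b dvd n"
      using division_decomp[of d m n] by auto
    then show "(case (gcd d m, gcd d n) of (a, b) \<Rightarrow> a * b) = d"
      using gcds[of a b] by simp
  qed (use gcds in \<open>auto intro: mult_dvd_mono\<close>)
  finally show ?thesis by simp
qed

text \<open>Multiplicativity of \<open>half_divisor\<close> reduces \<open>g * g = 1\<close> to prime powers: a full prime
power is split off \<open>n\<close> and the sum over divisors factorizes.\<close>

lemma half_divisor_convolution:
  assumes "0 < n"
  shows "(\<Sum>d | d dvd n. half_divisor d * half_divisor (n div d)) = 1"
  using assms
proof (induction n rule: less_induct)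
  case (less n)
  show ?case
  proof (cases "n = 1")
    case True
    then show ?thesis by (simp add: half_divisor_def)
  next
    case False
    then obtain p where p: "prime p" "p dvd n" using prime_factor_nat[of n] by auto
    define k where "k = multiplicity p n"
    define m where "m = n div p ^ k"
    have n: "n = p ^ k * m" unfolding m_def k_def by (simp add: multiplicity_dvd)
    have nd: "\<not> p dvd m"
      unfolding m_def k_def using less.prems p by (intro multiplicity_decompose) auto
    have k: "k > 0" using p less.prems unfolding k_def
      by (metis bot_nat_0.not_eq_extremum multiplicity_eq_zero_iff not_prime_unit)
    have m0: "m > 0" using n less.prems by (cases "m = 0") auto
    have pk: "p ^ k > 1" using p k prime_gt_1_nat one_less_power by blast
    have "m < n" using pk m0 unfolding n by simp
    have cop: "coprime (p ^ k) m" using p nd by (simp add: prime_imp_coprime)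
    have "(\<Sum>d | d dvd n. half_divisor d * half_divisor (n div d)) =
      (\<Sum>a | a dvd p ^ k. \<Sum>b | b dvd m. half_divisor (a * b) * half_divisor (p ^ k * m div (a * b)))"
      unfolding n using pk m0 prime_gt_0_nat[OF p(1)] by (intro sum_divisors_coprime_mult[OF cop]) auto
    also have "\<dots> = (\<Sum>a | a dvd p ^ k. \<Sum>b | b dvd m. (half_divisor a * half_divisor (p ^ k div a)) *
          (half_divisor b * half_divisor (m div b)))"
    proof (intro sum.cong refl)
      fix a b assume "a \<in> {a. a dvd p ^ k}" "b \<in> {b. b dvd m}"
      then obtain a' b' where a': "p ^ k = a * a'" and b': "m = b * b'" by (auto elim!: dvdE)
      have pos: "a > 0" "a' > 0" "b > 0" "b' > 0" using a' b' pk m0 by (auto intro!: Nat.gr0I)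
      have "coprime a b" "coprime a' b'"
        using cop unfolding a' b' by auto
      moreover have "p ^ k * m div (a * b) = a' * b'"
        unfolding a' b' using pos by (metis div_mult_mult1_if mult.assoc mult.commute mult.left_commute mult_pos_pos nonzero_mult_div_cancel_left not_gr0)
      moreover have "p ^ k div a = a'" "m div b = b'" using a' b' pos by simp_all
      ultimately show "half_divisor (a * b) * half_divisor (p ^ k * m div (a * b)) =
        (half_divisor a * half_divisor (p ^ k div a)) * (half_divisor b * half_divisor (m div b))"
        using pos by (simp add: half_divisor_mult_coprime)
    qed
    also have "\<dots> = (\<Sum>a | a dvd p ^ k. half_divisor a * half_divisor (p ^ k div a)) *
        (\<Sum>b | b dvd m. half_divisor b * half_divisor (m div b))"
      by (simp add: sum_product)
    also have "(\<Sum>b | b dvd m. half_divisor b * half_divisor (m div b)) = 1"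
      using less.IH \<open>m < n\<close> m0 by blast
    also have "(\<Sum>a | a dvd p ^ k. half_divisor a * half_divisor (p ^ k div a)) =
        (\<Sum>i\<le>k. half_divisor (p ^ i) * half_divisor (p ^ k div p ^ i))"
    proof -
      have eq: "{a. a dvd p ^ k} = (\<lambda>i. p ^ i) ` {..k}"
        using divides_primepow_nat[OF p(1), of _ k] by auto
      have "inj_on (\<lambda>i. p ^ i) {..k}"
        using prime_gt_1_nat[OF p(1)] by (auto intro!: inj_onI)
      then show ?thesis unfolding eq by (simp add: sum.reindex)
    qed
    also have "\<dots> = (\<Sum>i\<le>k. (pochhammer (1/2 :: real) i / fact i) * (pochhammer (1/2) (k - i) / fact (k - i)))"
    proof (intro sum.cong refl)
      fix i assume "i \<in> {..k}"
      then have "p ^ k div p ^ i = p ^ (k - i)"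
        using prime_gt_0_nat[OF p(1)] by (simp add: power_diff)
      then show "half_divisor (p ^ i) * half_divisor (p ^ k div p ^ i) =
        (pochhammer (1/2 :: real) i / fact i) * (pochhammer (1/2) (k - i) / fact (k - i))"
        using p by (simp add: half_divisor_prime_power)
    qed
    also have "\<dots> = 1" by (rule central_weight_convolution)
    finally show ?thesis by simp
  qed
qed

section \<open>Chebyshev's lower bound for the number of primes\<close>

lemma multiplicity_eq_sum_dvd:
  fixes p m K :: nat
  assumes "prime p" "0 < m" "m < p ^ Suc K"
  shows "multiplicity p m = (\<Sum>k\<in>{1..K}. if p ^ k dvd m then 1 else 0 :: nat)"
proof -
  have nu: "\<not> is_unit p" using assms(1) not_prime_unit by blast
  have "p ^ multiplicity p m \<le> m" by (rule dvd_imp_le[OF multiplicity_dvd assms(2)])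
  then have "p ^ multiplicity p m < p ^ Suc K" using assms(3) by linarith
  then have le: "multiplicity p m < Suc K"
    using power_less_imp_less_exp[OF prime_gt_1_nat[OF assms(1)]] by blast
  have "(\<Sum>k\<in>{1..K}. if p ^ k dvd m then 1 else 0 :: nat) = card {k\<in>{1..K}. p ^ k dvd m}"
    by (simp add: sum.If_cases Int_def)
  also have "{k\<in>{1..K}. p ^ k dvd m} = {1..multiplicity p m}"
    using le assms(2) nu by (auto simp: power_dvd_iff_le_multiplicity)
  finally show ?thesis by simp
qed

lemma legendre_formula:
  fixes p n K :: nat
  assumes "prime p" "n < p ^ Suc K"
  shows "multiplicity p (fact n :: nat) = (\<Sum>k\<in>{1..K}. n div p ^ k)"
  using assms(2)
proof (induction n)
  case (Suc n)
  have "multiplicity p (fact (Suc n) :: nat) = multiplicity p (Suc n) + multiplicity p (fact n)"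
    unfolding fact_Suc using assms(1) by (simp add: prime_elem_multiplicity_mult_distrib del: mult_Suc)
  also have "multiplicity p (Suc n) = (\<Sum>k\<in>{1..K}. if p ^ k dvd Suc n then 1 else 0 :: nat)"
    using Suc.prems by (intro multiplicity_eq_sum_dvd[OF assms(1)]) auto
  also have "multiplicity p (fact n) = (\<Sum>k\<in>{1..K}. n div p ^ k)"
    using Suc by simp
  also have "(\<Sum>k\<in>{1..K}. if p ^ k dvd Suc n then 1 else 0) + (\<Sum>k\<in>{1..K}. n div p ^ k) =
      (\<Sum>k\<in>{1..K}. Suc n div p ^ k)"
    unfolding sum.distrib[symmetric] by (intro sum.cong refl) (simp add: div_Suc dvd_eq_mod_eq_0)
  finally show ?case .
qed simp

text \<open>In Legendre's formula for \<open>(2n)! / (n!)\<^sup>2\<close> each power of \<open>p\<close> up to \<open>2n\<close> contributes at most 1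
and the larger ones nothing.\<close>

lemma prime_power_central_binomial_le:
  fixes p n :: nat
  assumes "prime p" "0 < n"
  shows "p ^ multiplicity p ((2 * n) choose n) \<le> 2 * n"
proof -
  obtain K where K: "p ^ K \<le> 2 * n" "2 * n < p ^ (K + 1)"
    using ex_power_ivl1[of p "2 * n"] prime_ge_2_nat[OF assms(1)] assms(2) by auto
  have "fact n * fact n * ((2 * n) choose n) = (fact (2 * n) :: nat)"
    using binomial_fact_lemma[of n "2 * n"] by (simp add: mult_2)
  then have "multiplicity p (fact (2 * n) :: nat) =
      multiplicity p (fact n * fact n * ((2 * n) choose n))" by simp
  also have "\<dots> = multiplicity p (fact n :: nat) + multiplicity p (fact n :: nat) + multiplicity p ((2 * n) choose n)"
    using assms(1) by (simp add: prime_elem_multiplicity_mult_distrib zero_less_binomial_iff)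
  finally have eq: "(\<Sum>k\<in>{1..K}. 2 * n div p ^ k) =
      2 * (\<Sum>k\<in>{1..K}. n div p ^ k) + multiplicity p ((2 * n) choose n)"
    using legendre_formula[OF assms(1), of n K] legendre_formula[OF assms(1), of "2 * n" K] K by simp
  have "(\<Sum>k\<in>{1..K}. 2 * n div p ^ k) \<le> (\<Sum>k\<in>{1..K}. 2 * (n div p ^ k) + 1)"
  proof (intro sum_mono)
    fix k
    have q: "p ^ k > 0" using prime_gt_0_nat[OF assms(1)] by simp
    have "n < (n div p ^ k + 1) * p ^ k"
      using q by (metis Suc_eq_plus1 dividend_less_div_times mult.commute add_mult_distrib nat_mult_1 add.commute)
    then have "2 * n < (2 * (n div p ^ k) + 2) * p ^ k" by (simp add: algebra_simps)
    then have "2 * n div p ^ k < 2 * (n div p ^ k) + 2" 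
      using q by (simp add: less_mult_imp_div_less)
    then show "2 * n div p ^ k \<le> 2 * (n div p ^ k) + 1" by simp
  qed
  also have "\<dots> = 2 * (\<Sum>k\<in>{1..K}. n div p ^ k) + K"
    unfolding sum.distrib by (simp add: sum_distrib_left)
  finally have "multiplicity p ((2 * n) choose n) \<le> K" using eq by linarith
  then have "p ^ multiplicity p ((2 * n) choose n) \<le> p ^ K"
    using prime_gt_0_nat[OF assms(1)] by (intro power_increasing) auto
  with K show ?thesis by linarith
qed

lemma two_power_le_central_binomial: "2 ^ n \<le> real ((2 * n) choose n)"
proof (cases "n = 0")
  case False
  have "2 * real n \<le> 2 ^ n"
    using False
  proof (induction n)
    case (Suc n)
    show ?case
    proof (cases "n = 0")
      case False
      have "1 \<le> real n" using False by simp
      then show ?thesis using Suc.IH False by simp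
    qed simp
  qed simp
  then have "2 ^ n * (2 * real n) \<le> 2 ^ n * 2 ^ n" by (intro mult_left_mono) auto
  also have "\<dots> = 4 ^ n" by (simp add: power_mult_distrib[symmetric])
  finally have "2 ^ n \<le> 4 ^ n / (2 * real n)" using False by (simp add: field_simps)
  also have "\<dots> \<le> real ((2 * n) choose n)" using central_binomial_lower_bound[of n] False by simp
  finally show ?thesis .
qed simp

text \<open>The central binomial coefficient is at least \<open>2\<^sup>n\<close>, and each of its prime factors contributes at
most \<open>2n\<close>, so there must be many primes up to \<open>2n\<close>.\<close>

lemma chebyshev_lower:
  fixes w :: real
  assumes "2 \<le> w"
  shows "w / (6 * ln w) \<le> real (card {p::nat. prime p \<and> real p \<le> w})"
proof -
  define n where "n = nat \<lfloor>w / 2\<rfloor>"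
  define P where "P = {p::nat. prime p \<and> real p \<le> w}"
  have finP: "finite P" unfolding P_def by (rule finite_primes_le)
  have fl: "1 \<le> \<lfloor>w / 2\<rfloor>" using assms by (simp add: le_floor_iff)
  have "real n = of_int \<lfloor>w / 2\<rfloor>" unfolding n_def using fl by simp
  then have n: "0 < n" "2 * real n \<le> w" "w / 4 \<le> real n"
    using fl by linarith+
  let ?N = "(2 * n) choose n"
  have N0: "?N > 0" by (simp add: zero_less_binomial_iff)
  have sub: "prime_factors ?N \<subseteq> P"
  proof
    fix p assume "p \<in> prime_factors ?N"
    then have p: "prime p" "p dvd ?N" by (auto simp: in_prime_factors_iff)
    have "?N dvd fact (2 * n)"
      using binomial_fact_lemma[of n "2 * n"] by (metis dvd_triv_right le_add2 mult_2)
    then have "p dvd fact (2 * n)" using p dvd_trans by blast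
    then have "p \<le> 2 * n" using p prime_dvd_fact_iff by blast
    then have "real p \<le> 2 * real n" by linarith
    then show "p \<in> P" using p n unfolding P_def by simp
  qed
  have "2 ^ n \<le> real ?N" by (rule two_power_le_central_binomial)
  also have "?N = (\<Prod>p\<in>prime_factors ?N. p ^ multiplicity p ?N)"
    using N0 by (rule prime_factorization_nat)
  also have "real \<dots> \<le> (\<Prod>p\<in>prime_factors ?N. w)"
    unfolding of_nat_prod
  proof (intro prod_mono conjI)
    fix p assume "p \<in> prime_factors ?N"
    then have "p ^ multiplicity p ?N \<le> 2 * n"
      using n by (intro prime_power_central_binomial_le) auto
    then have "real (p ^ multiplicity p ?N) \<le> 2 * real n" by linarith
    then show "real (p ^ multiplicity p ?N) \<le> w" using n by linarith
  qed simp
  also have "\<dots> = w ^ card (prime_factors ?N)" by simp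
  also have "\<dots> \<le> w ^ card P"
    using assms card_mono[OF finP sub] by (intro power_increasing) auto
  finally have "ln (2 ^ n) \<le> ln (w ^ card P)"
    using assms by simp
  then have "real n * ln 2 \<le> real (card P) * ln w"
    using assms by (simp add: ln_realpow)
  moreover have "w / 4 * (2 / 3) \<le> real n * ln 2"
    using n ln2_ge_two_thirds assms by (intro mult_mono) auto
  ultimately have "w / 6 \<le> real (card P) * ln w" by linarith
  then show ?thesis using assms unfolding P_def by (simp add: field_simps)
qed

section \<open>Growth of the counting function of smooth numbers\<close>

lemma smooth_numbers_mono: "x \<le> x' \<Longrightarrow> smooth_numbers x y \<subseteq> smooth_numbers x' y"
  by (auto simp: smooth_numbers_def)

lemma Psi_mono: "x \<le> x' \<Longrightarrow> Psi x y \<le> Psi x' y"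
  unfolding Psi_def by (intro card_mono finite_smooth_numbers smooth_numbers_mono)

lemma smooth_numbers_multD:
  assumes "a * b \<in> smooth_numbers x y"
  shows "a \<in> smooth_numbers x y" "a \<in> smooth_numbers (x / real b) y"
proof -
  have pos: "0 < a" "0 < b" using assms by (auto simp: smooth_numbers_altdef)
  have "real a * 1 \<le> real a * real b" using pos by (intro mult_left_mono) auto
  moreover have "real a * real b \<le> x" using assms by (simp add: smooth_numbers_def)
  ultimately have "real a \<le> x" by linarith
  then show "a \<in> smooth_numbers x y" "a \<in> smooth_numbers (x / real b) y"
    using assms pos by (auto simp: smooth_numbers_altdef field_simps)
qed

lemma smooth_numbers_multI:
  assumes "a \<in> smooth_numbers u y" "b \<in> smooth_numbers v y" "real (a * b) \<le> x"
  shows "a * b \<in> smooth_numbers x y"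
  using assms by (auto simp: smooth_numbers_altdef prime_dvd_mult_iff)

lemma card_prime_factors_le:
  assumes "0 < n"
  shows "real (card (prime_factors n)) \<le> ln (real n) / ln 2"
proof -
  have "(\<Prod>p\<in>prime_factors n. 2) \<le> (\<Prod>p\<in>prime_factors n. real (p ^ multiplicity p n))"
  proof (intro prod_mono conjI)
    fix p assume p: "p \<in> prime_factors n"
    then have "0 < multiplicity p n" using prime_factors_multiplicity[of n] by auto
    then have "p ^ 1 \<le> p ^ multiplicity p n"
      using p by (intro power_increasing) (auto simp: in_prime_factors_iff prime_ge_1_nat)
    then have "2 \<le> p ^ multiplicity p n"
      using p prime_ge_2_nat[of p] by (auto simp: in_prime_factors_iff)
    then show "2 \<le> real (p ^ multiplicity p n)"
      by (metis of_nat_le_iff of_nat_numeral)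
  qed simp
  also have "\<dots> = real n"
    using prime_factorization_nat[OF assms] by (metis of_nat_prod)
  finally have "2 ^ card (prime_factors n) \<le> real n" by simp
  then have "ln (2 ^ card (prime_factors n)) \<le> ln (real n)" using assms by simp
  then show ?thesis by (simp add: ln_realpow field_simps)
qed

lemma finite_smooth_prime_pairs:
  "finite {(m, p). m \<in> smooth_numbers z y \<and> prime p \<and> real p \<le> y \<and> real (m * p) \<le> x}"
  by (rule finite_subset[of _ "smooth_numbers z y \<times> {p. prime p \<and> real p \<le> y}"])
     (auto simp: finite_smooth_numbers finite_primes_le)

text \<open>The pairs map injectively to pairs of a smooth number \<open>n = m p \<le> x\<close> and a prime factor of it, and
\<open>n\<close> has at most \<open>log n / log 2\<close> of these. This double counting controls how the count of
smooth numbers changes with \<open>x\<close>.\<close>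

lemma card_smooth_prime_pairs:
  assumes "1 \<le> x"
  shows "real (card {(m, p). m \<in> smooth_numbers x y \<and> prime p \<and> real p \<le> y \<and> real (m * p) \<le> x})
           \<le> (ln x / ln 2) * real (Psi x y)"
    (is "real (card ?U) \<le> _")
proof -
  let ?V = "Sigma (smooth_numbers x y) prime_factors"
  have "card ?U \<le> card ?V"
  proof (rule card_inj_on_le[of "\<lambda>(m, p). (m * p, p)"])
    show "inj_on (\<lambda>(m, p). (m * p, p)) ?U"
      by (auto intro!: inj_onI simp: prime_gt_0_nat)
    show "(\<lambda>(m, p). (m * p, p)) ` ?U \<subseteq> ?V"
      by (auto simp: smooth_numbers_altdef in_prime_factors_iff prime_gt_0_nat
        prime_dvd_mult_iff dest: primes_dvd_imp_eq)
    show "finite ?V" by (intro finite_SigmaI finite_smooth_numbers) auto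
  qed
  also have "card ?V = (\<Sum>n\<in>smooth_numbers x y. card (prime_factors n))"
    by (intro card_SigmaI finite_smooth_numbers) auto
  also have "real \<dots> \<le> (\<Sum>n\<in>smooth_numbers x y. ln x / ln 2)"
    unfolding of_nat_sum
  proof (intro sum_mono)
    fix n assume "n \<in> smooth_numbers x y"
    then have n: "0 < n" "real n \<le> x" by (auto simp: smooth_numbers_def)
    have "real (card (prime_factors n)) \<le> ln (real n) / ln 2"
      by (rule card_prime_factors_le[OF n(1)])
    also have "\<dots> \<le> ln x / ln 2" using n assms by (intro divide_right_mono) auto
    finally show "real (card (prime_factors n)) \<le> ln x / ln 2" .
  qed
  also have "\<dots> = (ln x / ln 2) * real (Psi x y)" by (simp add: Psi_def)
  finally show ?thesis by simp
qed

text \<open>Every prime \<open>p \<le> y\<close> can multiply every smooth number up to \<open>z/y\<close>.\<close>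

lemma Psi_divide_step:
  assumes "2 \<le> y" "z \<le> x" "1 \<le> x"
  shows "real (card {p::nat. prime p \<and> real p \<le> y}) * real (Psi (z / y) y) \<le> (ln x / ln 2) * real (Psi z y)"
proof (cases "1 \<le> z")
  case True
  let ?P = "{p::nat. prime p \<and> real p \<le> y}"
  let ?U = "{(m, p). m \<in> smooth_numbers z y \<and> prime p \<and> real p \<le> y \<and> real (m * p) \<le> z}"
  have "smooth_numbers (z / y) y \<times> ?P \<subseteq> ?U"
  proof clarify
    fix m p assume m: "m \<in> smooth_numbers (z / y) y" and p: "prime (p::nat)" "real p \<le> y"
    have "z / y \<le> z / 1" using assms True by (intro divide_left_mono) auto
    then have 1: "m \<in> smooth_numbers z y" using m smooth_numbers_mono[of "z / y" z y] by auto
    have "real m * real p \<le> (z / y) * y"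
      using m p assms by (intro mult_mono) (auto simp: smooth_numbers_def)
    then have "real (m * p) \<le> z" using assms by simp
    with 1 p show "m \<in> smooth_numbers z y \<and> prime p \<and> real p \<le> y \<and> real (m * p) \<le> z" by simp
  qed
  then have "card (smooth_numbers (z / y) y \<times> ?P) \<le> card ?U"
    by (intro card_mono finite_smooth_prime_pairs)
  then have "real (Psi (z / y) y * card ?P) \<le> real (card ?U)"
    by (simp only: card_cartesian_product Psi_def of_nat_le_iff)
  also have "\<dots> \<le> (ln z / ln 2) * real (Psi z y)" by (rule card_smooth_prime_pairs[OF True])
  also have "\<dots> \<le> (ln x / ln 2) * real (Psi z y)"
    using assms True by (intro mult_right_mono divide_right_mono) auto
  finally show ?thesis by (simp add: mult.commute)
next
  case False
  then have "z / y < 1" using assms by (simp add: field_simps)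
  then have "smooth_numbers (z / y) y = {}" by (auto simp: smooth_numbers_def)
  then show ?thesis using assms by (simp add: Psi_def)
qed

lemma Psi_divide_power:
  assumes "2 \<le> y" "1 \<le> x"
    and H: "ln x / ln 2 \<le> y powr (-2/3) * real (card {p::nat. prime p \<and> real p \<le> y})"
  shows "real (Psi (x / y ^ k) y) \<le> (y powr (-2/3)) ^ k * real (Psi x y)"
proof (induction k)
  case (Suc k)
  define c where "c = real (card {p::nat. prime p \<and> real p \<le> y})"
  have "{p::nat. prime p \<and> real p \<le> y} \<noteq> {}" using assms(1) two_is_prime_nat by fastforce
  then have c: "c > 0" unfolding c_def using finite_primes_le[of y] by (simp add: card_gt_0_iff)
  have yk: "1 \<le> y ^ k" using assms by simp
  have "x / y ^ k \<le> x / 1" using assms yk by (intro divide_left_mono) auto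
  then have "c * real (Psi (x / y ^ k / y) y) \<le> (ln x / ln 2) * real (Psi (x / y ^ k) y)"
    unfolding c_def using assms by (intro Psi_divide_step) auto
  also have "\<dots> \<le> (y powr (-2/3) * c) * real (Psi (x / y ^ k) y)"
    using H unfolding c_def by (intro mult_right_mono) auto
  finally have "c * real (Psi (x / y ^ k / y) y) \<le> c * (y powr (-2/3) * real (Psi (x / y ^ k) y))"
    by (simp add: mult_ac)
  then have "real (Psi (x / y ^ k / y) y) \<le> y powr (-2/3) * real (Psi (x / y ^ k) y)"
    using c by (simp only: mult_le_cancel_left_pos)
  also have "\<dots> \<le> y powr (-2/3) * ((y powr (-2/3)) ^ k * real (Psi x y))"
    using Suc by (intro mult_left_mono) auto
  finally show ?case by (simp add: divide_divide_eq_left mult_ac)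
qed simp

text \<open>Iterated division by \<open>y\<close>. The exponent \<open>2/3\<close> stands in for the saddle point; it has to exceed
\<open>1/2\<close> for the sum of \<open>\<Psi>(x/s\<^sup>2, y)\<close> over large \<open>s\<close> to be small.\<close>

lemma Psi_divide_le:
  assumes "2 \<le> y" "1 \<le> x" "1 \<le> d"
    and H: "ln x / ln 2 \<le> y powr (-2/3) * real (card {p::nat. prime p \<and> real p \<le> y})"
  shows "real (Psi (x / d) y) \<le> (d / y) powr (-2/3) * real (Psi x y)"
proof -
  define k where "k = nat \<lfloor>log y d\<rfloor>"
  have ld: "0 \<le> log y d" using assms by simp
  then have rk: "real k \<le> log y d" "log y d - 1 \<le> real k" unfolding k_def by linarith+
  have "y ^ k = y powr real k" using assms by (simp add: powr_realpow)
  also have "\<dots> \<le> y powr log y d" using rk assms by (intro powr_mono) auto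
  also have "\<dots> = d" using assms by simp
  finally have le: "y ^ k \<le> d" .
  have "d / y = y powr (log y d - 1)" using assms by (simp add: powr_diff)
  also have "\<dots> \<le> y powr real k" using rk assms by (intro powr_mono) auto
  finally have ge: "d / y \<le> y ^ k" using assms by (simp add: powr_realpow)
  have "real (Psi (x / d) y) \<le> real (Psi (x / y ^ k) y)"
    using le assms by (intro of_nat_mono Psi_mono divide_left_mono) auto
  also have "\<dots> \<le> (y powr (-2/3)) ^ k * real (Psi x y)"
    using assms by (intro Psi_divide_power) auto
  also have "(y powr (-2/3)) ^ k = (y ^ k) powr (-2/3)"
    using assms by (simp add: powr_realpow[symmetric] powr_powr mult.commute)
  also have "\<dots> \<le> (d / y) powr (-2/3)"
    using ge assms by (intro powr_mono2') auto
  finally show ?thesis by (simp add: mult_right_mono)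
qed

text \<open>A smooth number \<open>n\<close> in \<open>(x, 2x]\<close> is \<open>m p\<close> with \<open>m \<le> x\<close> and \<open>p \<le> min (2x/m) y\<close>. By Chebyshev's bound
there are, up to a factor \<open>log x\<close>, as many primes up to \<open>min (x/m) y\<close>, and the pairs with
\<open>m p \<le> x\<close> have already been counted.\<close>

lemma Psi_double:
  assumes "2 \<le> y" "1 \<le> x"
  shows "real (Psi (2 * x) y) \<le> (3 + 18 * (ln x)\<^sup>2) * real (Psi x y)"
proof -
  define Q where "Q m = {p::nat. prime p \<and> real p \<le> y \<and> real (m * p) \<le> x}" for m
  define R where "R m = {p::nat. prime p \<and> real p \<le> y \<and> real (m * p) \<le> 2 * x}" for m
  have finR: "finite (R m)" and finQ: "finite (Q m)" for m
    unfolding R_def Q_def by (rule finite_subset[OF _ finite_primes_le[of y]]; blast)+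
  \<comment> \<open>Any prime factor of \<open>n\<close> will do.\<close>
  define lp where "lp n = (SOME p. prime p \<and> p dvd n)" for n :: nat
  let ?D = "smooth_numbers (2 * x) y - smooth_numbers x y"
  have lp: "prime (lp n)" "lp n dvd n" if "n \<in> ?D" for n
  proof -
    have "n \<noteq> 1" using that assms by (auto simp: smooth_numbers_def)
    then have "\<exists>p. prime p \<and> p dvd n" using prime_factor_nat by blast
    then have "prime (lp n) \<and> lp n dvd n" unfolding lp_def by (rule someI_ex)
    then show "prime (lp n)" "lp n dvd n" by auto
  qed
  have "card ?D \<le> card (Sigma (smooth_numbers x y) R)"
  proof (rule card_inj_on_le[of "\<lambda>n. (n div lp n, lp n)"])
    show "inj_on (\<lambda>n. (n div lp n, lp n)) ?D"
      by (rule inj_onI) (metis Pair_inject dvd_div_mult_self lp(2))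
    show "(\<lambda>n. (n div lp n, lp n)) ` ?D \<subseteq> Sigma (smooth_numbers x y) R"
    proof clarify
      fix n assume n: "n \<in> smooth_numbers (2 * x) y" "n \<notin> smooth_numbers x y"
      then have n': "n \<in> ?D" by blast
      define m where "m = n div lp n"
      have nm: "n = m * lp n" unfolding m_def using lp(2)[OF n'] by simp
      have "m \<in> smooth_numbers (2 * x / real (lp n)) y"
        using smooth_numbers_multD(2)[of m "lp n" "2 * x" y] n nm by simp
      moreover have "2 * x / real (lp n) \<le> 2 * x / 2"
        using prime_ge_2_nat[OF lp(1)[OF n']] assms by (intro divide_left_mono) auto
      ultimately have "m \<in> smooth_numbers x y"
        using smooth_numbers_mono[of "2 * x / real (lp n)" x y] by auto
      moreover have "real (m * lp n) = real n" using nm by simp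
      then have "lp n \<in> R m"
        using n lp[OF n'] by (auto simp: R_def smooth_numbers_altdef)
      ultimately show "n div lp n \<in> smooth_numbers x y \<and> lp n \<in> R (n div lp n)"
        unfolding m_def by blast
    qed
    show "finite (Sigma (smooth_numbers x y) R)"
      by (intro finite_SigmaI finite_smooth_numbers finR)
  qed
  also have "\<dots> = (\<Sum>m\<in>smooth_numbers x y. card (R m))"
    by (intro card_SigmaI finite_smooth_numbers) (auto simp: finR)
  finally have "real (card ?D) \<le> (\<Sum>m\<in>smooth_numbers x y. real (card (R m)))"
    by (metis of_nat_le_iff of_nat_sum)
  also have "\<dots> \<le> (\<Sum>m\<in>smooth_numbers x y. 2 + 12 * ln x * real (card (Q m)))"
  proof (intro sum_mono)
    fix m assume "m \<in> smooth_numbers x y"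
    then have m: "0 < m" "real m \<le> x" by (auto simp: smooth_numbers_def)
    show "real (card (R m)) \<le> 2 + 12 * ln x * real (card (Q m))"
    proof (cases "real m \<le> x / 2")
      case False
      \<comment> \<open>Here \<open>2x/m < 4\<close>.\<close>
      have "R m \<subseteq> {2, 3}"
      proof
        fix p assume "p \<in> R m"
        then have p: "prime p" "real m * real p \<le> 2 * x" by (auto simp: R_def)
        have "real p < 4"
        proof (rule ccontr)
          assume "\<not> real p < 4"
          then have "real m * 4 \<le> real m * real p" by (intro mult_left_mono) auto
          then show False using p False by linarith
        qed
        then have "p < 4" by simp
        then show "p \<in> {2, 3}" using prime_ge_2_nat[OF p(1)] by auto
      qed
      then have "card (R m) \<le> card {2, 3::nat}" by (intro card_mono) auto
      then have "real (card (R m)) \<le> 2" by simp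
      moreover have "0 \<le> 12 * ln x * real (card (Q m))" using assms by simp
      ultimately show ?thesis by linarith
    next
      case True
      define w where "w = min (x / real m) y"
      have w: "2 \<le> w" using True m assms by (simp add: w_def field_simps)
      have "x / real m \<le> x / 1" using m assms by (intro divide_left_mono) auto
      then have wx: "w \<le> x" unfolding w_def by simp
      have "R m \<subseteq> {1..nat \<lfloor>2 * w\<rfloor>}"
      proof
        fix p assume "p \<in> R m"
        then have p: "prime p" "real p \<le> y" "real m * real p \<le> 2 * x" by (auto simp: R_def)
        then have "real p \<le> 2 * w"
          using m assms by (auto simp: w_def min_def field_simps)
        then show "p \<in> {1..nat \<lfloor>2 * w\<rfloor>}"
          using prime_ge_1_nat[OF p(1)] by (simp add: le_nat_floor)
      qed
      then have "card (R m) \<le> card {1..nat \<lfloor>2 * w\<rfloor>}" by (intro card_mono) auto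
      then have 1: "real (card (R m)) \<le> 2 * w" using w by simp linarith
      have Q: "Q m = {p::nat. prime p \<and> real p \<le> w}"
        unfolding Q_def w_def using m by (auto simp: field_simps)
      have "w / (6 * ln w) \<le> real (card (Q m))"
        unfolding Q by (rule chebyshev_lower[OF w])
      then have "w \<le> 6 * ln w * real (card (Q m))" using w by (simp add: field_simps)
      also have "\<dots> \<le> 6 * ln x * real (card (Q m))"
        using wx w by (intro mult_right_mono) auto
      finally show ?thesis using 1 by linarith
    qed
  qed
  also have "\<dots> = 2 * real (Psi x y) + 12 * ln x * real (\<Sum>m\<in>smooth_numbers x y. card (Q m))"
    by (simp add: sum.distrib sum_distrib_left Psi_def)
  also have "(\<Sum>m\<in>smooth_numbers x y. card (Q m)) = card (Sigma (smooth_numbers x y) Q)"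
    by (intro card_SigmaI[symmetric] finite_smooth_numbers) (auto simp: finQ)
  also have "Sigma (smooth_numbers x y) Q = {(m, p). m \<in> smooth_numbers x y \<and> prime p \<and> real p \<le> y \<and> real (m * p) \<le> x}"
    by (auto simp: Q_def)
  also have "2 * real (Psi x y) + 12 * ln x * real (card \<dots>) \<le>
      2 * real (Psi x y) + 12 * ln x * ((ln x / ln 2) * real (Psi x y))"
    using assms by (intro add_left_mono mult_left_mono card_smooth_prime_pairs) auto
  also have "\<dots> \<le> 2 * real (Psi x y) + 12 * ln x * ((3 / 2 * ln x) * real (Psi x y))"
  proof (intro add_left_mono mult_left_mono mult_right_mono)
    have "ln x * 2 \<le> ln x * (3 * ln 2)"
      using ln2_ge_two_thirds assms by (intro mult_left_mono) auto
    then show "ln x / ln 2 \<le> 3 / 2 * ln x" by (simp add: field_simps)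
  qed (use assms in auto)
  finally have "real (card ?D) \<le> (2 + 18 * (ln x)\<^sup>2) * real (Psi x y)"
    by (simp add: power2_eq_square algebra_simps)
  moreover have "card ?D = Psi (2 * x) y - Psi x y"
    unfolding Psi_def using assms by (intro card_Diff_subset finite_smooth_numbers smooth_numbers_mono) auto
  moreover have "Psi x y \<le> Psi (2 * x) y" using assms by (intro Psi_mono) auto
  ultimately show ?thesis by (simp add: of_nat_diff algebra_simps)
qed

section \<open>Mean values of bilinear sums\<close>

lemma integral_Cauchy_Schwarz:
  fixes f g :: "'w \<Rightarrow> real"
  assumes [measurable]: "f \<in> borel_measurable M" "g \<in> borel_measurable M"
    and int: "integrable M (\<lambda>w. (f w)\<^sup>2)" "integrable M (\<lambda>w. (g w)\<^sup>2)" "integrable M (\<lambda>w. f w * g w)"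
    and nonneg: "\<And>w. 0 \<le> f w" "\<And>w. 0 \<le> g w"
  shows "(\<integral>w. f w * g w \<partial>M) \<le> sqrt (\<integral>w. (f w)\<^sup>2 \<partial>M) * sqrt (\<integral>w. (g w)\<^sup>2 \<partial>M)"
proof -
  let ?I = "\<integral>w. f w * g w \<partial>M" and ?F = "\<integral>w. (f w)\<^sup>2 \<partial>M" and ?G = "\<integral>w. (g w)\<^sup>2 \<partial>M"
  have pos: "0 \<le> ?I" "0 \<le> ?F" "0 \<le> ?G"
    using nonneg by (auto intro!: Bochner_Integration.integral_nonneg)
  have I: "(\<integral>\<^sup>+w. ennreal (f w) * ennreal (g w) \<partial>M) = ennreal ?I"
    using nn_integral_eq_integral[OF int(3)] nonneg by (simp add: ennreal_mult)
  have FG: "(\<integral>\<^sup>+w. ennreal (f w) ^ 2 \<partial>M) = ennreal ?F" "(\<integral>\<^sup>+w. ennreal (g w) ^ 2 \<partial>M) = ennreal ?G"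
    using nn_integral_eq_integral[OF int(1)] nn_integral_eq_integral[OF int(2)] nonneg
    by (simp_all add: ennreal_power)
  \<comment> \<open>The inequality itself is known for the integral with values in the extended nonnegative reals.\<close>
  have "ennreal ?I ^ 2 \<le> ennreal ?F * ennreal ?G"
    using Cauchy_Schwarz_nn_integral[of "\<lambda>w. ennreal (f w)" M "\<lambda>w. ennreal (g w)"]
    unfolding I FG by simp
  then have "ennreal (?I ^ 2) \<le> ennreal (?F * ?G)"
    using pos by (simp add: ennreal_power ennreal_mult)
  then have "?I ^ 2 \<le> ?F * ?G" using pos by (simp add: ennreal_le_iff)
  then show ?thesis using pos by (simp add: real_le_rsqrt real_sqrt_mult[symmetric])
qed

text \<open>An abstract family of completely multiplicative functions \<open>X w\<close>, indexed by a finite measure space,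
with the mean value inequality for polynomials of length \<open>N\<close>. It covers \<open>n\<^sup>i\<^sup>t\<close> and the characters
alike, together with their twists. The index set of \<open>n\<close> is restricted to positive
integers, as the twist \<open>h\<close> is arbitrary at 0.\<close>

locale mean_value_system = finite_measure M for M :: "'w measure" +
  fixes X :: "'w \<Rightarrow> nat \<Rightarrow> complex" and N :: nat and C :: real
  assumes measurable_X [measurable]: "\<And>n. (\<lambda>w. X w n) \<in> borel_measurable M"
    and norm_X_le: "\<And>w n. w \<in> space M \<Longrightarrow> 0 < n \<Longrightarrow> cmod (X w n) \<le> 1"
    and X_1: "\<And>w. w \<in> space M \<Longrightarrow> X w 1 = 1"
    and X_mult: "\<And>w m n. w \<in> space M \<Longrightarrow> 0 < m \<Longrightarrow> 0 < n \<Longrightarrow> X w (m * n) = X w m * X w n"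
    and N_pos: "1 \<le> N"
    and mean_value: "\<And>a :: nat \<Rightarrow> real.
      (\<integral>w. (cmod (\<Sum>n\<in>{1..N}. a n * X w n))\<^sup>2 \<partial>M) \<le> C * (\<Sum>n\<in>{1..N}. (a n)\<^sup>2)"
begin

definition dpoly :: "nat set \<Rightarrow> (nat \<Rightarrow> real) \<Rightarrow> 'w \<Rightarrow> complex" where
  "dpoly A a w = (\<Sum>n\<in>A. a n * X w n)"

definition l2norm :: "nat set \<Rightarrow> (nat \<Rightarrow> real) \<Rightarrow> real" where
  "l2norm A a = sqrt (\<Sum>n\<in>A. (a n)\<^sup>2)"

lemma l2norm_nonneg [simp]: "0 \<le> l2norm A a"
  by (simp add: l2norm_def sum_nonneg)

lemma measurable_dpoly [measurable]: "dpoly A a \<in> borel_measurable M"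
  unfolding dpoly_def by measurable

lemma integrable_bounded:
  fixes f :: "'w \<Rightarrow> real"
  assumes "f \<in> borel_measurable M" "\<And>w. w \<in> space M \<Longrightarrow> \<bar>f w\<bar> \<le> B"
  shows "integrable M f"
  using assms by (intro integrable_const_bound[of _ B]) auto

lemma norm_dpoly_le:
  assumes "w \<in> space M" "A \<subseteq> {1..N}"
  shows "cmod (dpoly A a w) \<le> (\<Sum>n\<in>A. \<bar>a n\<bar>)"
proof -
  have "cmod (dpoly A a w) \<le> (\<Sum>n\<in>A. cmod (of_real (a n) * X w n))"
    unfolding dpoly_def by (rule norm_sum)
  also have "\<dots> \<le> (\<Sum>n\<in>A. \<bar>a n\<bar>)"
  proof (intro sum_mono)
    fix n assume "n \<in> A"
    then show "cmod (of_real (a n) * X w n) \<le> \<bar>a n\<bar>"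
      using assms norm_X_le[of w n] by (force simp: norm_mult mult_left_le)
  qed
  finally show ?thesis .
qed

lemma integrable_dpoly:
  assumes "A \<subseteq> {1..N}" "B \<subseteq> {1..N}"
  shows "integrable M (\<lambda>w. cmod (dpoly A a w))"
    and "integrable M (\<lambda>w. (cmod (dpoly A a w))\<^sup>2)"
    and "integrable M (\<lambda>w. cmod (dpoly A a w) * cmod (dpoly B b w))"
proof -
  note le = norm_dpoly_le[OF _ assms(1)] norm_dpoly_le[OF _ assms(2)]
  show "integrable M (\<lambda>w. cmod (dpoly A a w))"
    using le by (intro integrable_bounded[of _ "\<Sum>n\<in>A. \<bar>a n\<bar>"]) auto
  show "integrable M (\<lambda>w. (cmod (dpoly A a w))\<^sup>2)"
    using le by (intro integrable_bounded[of _ "(\<Sum>n\<in>A. \<bar>a n\<bar>)\<^sup>2"]) (auto intro!: power_mono)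
  show "integrable M (\<lambda>w. cmod (dpoly A a w) * cmod (dpoly B b w))"
    using le by (intro integrable_bounded[of _ "(\<Sum>n\<in>A. \<bar>a n\<bar>) * (\<Sum>n\<in>B. \<bar>b n\<bar>)"])
      (auto simp: abs_mult intro!: mult_mono sum_nonneg)
qed

lemma C_nonneg: "0 \<le> C"
proof -
  let ?a = "\<lambda>n. if n = 1 then 1 else 0 :: real"
  have "0 \<le> (\<integral>w. (cmod (\<Sum>n\<in>{1..N}. ?a n * X w n))\<^sup>2 \<partial>M)"
    by (intro Bochner_Integration.integral_nonneg) auto
  also have "\<dots> \<le> C * (\<Sum>n\<in>{1..N}. (?a n)\<^sup>2)" by (rule mean_value)
  also have "(\<Sum>n\<in>{1..N}. (?a n)\<^sup>2) = (\<Sum>n\<in>{1..N}. if n = 1 then 1 else 0 :: real)"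
    by (intro sum.cong) auto
  also have "\<dots> = 1" using N_pos by simp
  finally show ?thesis by simp
qed

lemma mean_square_dpoly:
  assumes "A \<subseteq> {1..N}"
  shows "(\<integral>w. (cmod (dpoly A a w))\<^sup>2 \<partial>M) \<le> C * (l2norm A a)\<^sup>2"
proof -
  let ?a = "\<lambda>n. if n \<in> A then a n else 0"
  have eq: "(\<Sum>n\<in>{1..N}. if n \<in> A then f n else 0) = (\<Sum>n\<in>A. f n)" for f :: "nat \<Rightarrow> 'b::comm_monoid_add"
    using assms by (simp add: sum.inter_restrict[symmetric] Int_absorb1)
  have "(\<Sum>n\<in>{1..N}. complex_of_real (?a n) * X w n) = dpoly A a w" for w
    unfolding dpoly_def eq[symmetric] by (intro sum.cong) auto
  moreover have "(\<Sum>n\<in>{1..N}. (?a n)\<^sup>2) = (l2norm A a)\<^sup>2"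
    unfolding l2norm_def by (simp add: sum_nonneg eq[symmetric] if_distrib[of power2] cong: if_cong)
  ultimately show ?thesis using mean_value[of ?a] by simp
qed

text \<open>The product has length up to \<open>N\<^sup>2\<close>, beyond the range of the mean value inequality; it is only its first
absolute moment that is accessible, through Cauchy-Schwarz.\<close>

lemma mean_dpoly_mult:
  assumes "A \<subseteq> {1..N}" "B \<subseteq> {1..N}"
  shows "(\<integral>w. cmod (dpoly A a w) * cmod (dpoly B b w) \<partial>M) \<le> C * (l2norm A a * l2norm B b)"
proof -
  have "(\<integral>w. cmod (dpoly A a w) * cmod (dpoly B b w) \<partial>M) \<le>
      sqrt (\<integral>w. (cmod (dpoly A a w))\<^sup>2 \<partial>M) * sqrt (\<integral>w. (cmod (dpoly B b w))\<^sup>2 \<partial>M)"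
    using integrable_dpoly[OF assms] integrable_dpoly[OF assms(2) assms(1)]
    by (intro integral_Cauchy_Schwarz) auto
  also have "\<dots> \<le> sqrt (C * (l2norm A a)\<^sup>2) * sqrt (C * (l2norm B b)\<^sup>2)"
    using mean_square_dpoly assms C_nonneg by (intro mult_mono real_sqrt_le_mono) auto
  also have "\<dots> = C * (l2norm A a * l2norm B b)"
    using C_nonneg by (simp add: real_sqrt_mult)
  finally show ?thesis .
qed

lemma mean_dpoly:
  assumes "A \<subseteq> {1..N}"
  shows "(\<integral>w. cmod (dpoly A a w) \<partial>M) \<le> C * l2norm A a"
proof -
  \<comment> \<open>Take the second polynomial to be \<open>X w 1 = 1\<close>; this also bounds the total mass.\<close>
  have "(\<integral>w. cmod (dpoly A a w) \<partial>M) = (\<integral>w. cmod (dpoly A a w) * cmod (dpoly {1} (\<lambda>_. 1) w) \<partial>M)"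
    by (intro Bochner_Integration.integral_cong refl) (simp add: dpoly_def X_1[simplified])
  also have "\<dots> \<le> C * (l2norm A a * l2norm {1} (\<lambda>_. 1))"
    using N_pos by (intro mean_dpoly_mult assms) auto
  finally show ?thesis by (simp add: l2norm_def)
qed

definition bform :: "(nat \<times> nat) set \<Rightarrow> (nat \<Rightarrow> real) \<Rightarrow> (nat \<Rightarrow> real) \<Rightarrow> 'w \<Rightarrow> complex" where
  "bform R a b w = (\<Sum>(m, n)\<in>R. (a m * X w m) * (b n * X w n))"

lemma bform_Times: "bform (A \<times> B) a b w = dpoly A a w * dpoly B b w"
  by (simp add: bform_def dpoly_def sum_product sum.cartesian_product)

lemma measurable_bform [measurable]: "bform R a b \<in> borel_measurable M"
  unfolding bform_def case_prod_unfold by measurable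

lemma integrable_bform:
  assumes "R \<subseteq> {1..N} \<times> {1..N}"
  shows "integrable M (\<lambda>w. cmod (bform R a b w))"
proof (rule integrable_bounded)
  fix w assume w: "w \<in> space M"
  have "cmod (bform R a b w) \<le> (\<Sum>mn\<in>R. cmod (case mn of (m, n) \<Rightarrow> (a m * X w m) * (b n * X w n)))"
    unfolding bform_def by (rule norm_sum)
  also have "\<dots> \<le> (\<Sum>mn\<in>R. \<bar>a (fst mn)\<bar> * \<bar>b (snd mn)\<bar>)"
  proof (intro sum_mono)
    fix mn assume "mn \<in> R"
    then obtain m n where mn: "mn = (m, n)" "0 < m" "0 < n" using assms by force
    show "cmod (case mn of (m, n) \<Rightarrow> (a m * X w m) * (b n * X w n)) \<le> \<bar>a (fst mn)\<bar> * \<bar>b (snd mn)\<bar>"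
      unfolding mn(1) using norm_X_le[OF w] mn
      by (auto simp: norm_mult intro!: mult_mono mult_left_le)
  qed
  finally show "\<bar>cmod (bform R a b w)\<bar> \<le> (\<Sum>mn\<in>R. \<bar>a (fst mn)\<bar> * \<bar>b (snd mn)\<bar>)" by simp
qed measurable

text \<open>A condition \<open>r < s\<close> on \<open>l\<close>-bit numbers holds iff at the highest bit where they differ \<open>r\<close> has 0 and
\<open>s\<close> has 1. For each position of that bit, the common higher bits split the pairs into
products of sets that are disjoint in either variable, so the product
structure survives and Cauchy-Schwarz over the products loses nothing. The induction removes the
lowest bit: \<open>R1\<close> collects the pairs decided by the higher bits, \<open>R2\<close> those decided by the lowest one.\<close>

lemma bilinear_comparison:
  assumes "A \<subseteq> {1..N}" "B \<subseteq> {1..N}"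
    and "\<And>m. m \<in> A \<Longrightarrow> r m < (2 :: nat) ^ l" "\<And>n. n \<in> B \<Longrightarrow> s n < (2 :: nat) ^ l"
  shows "(\<integral>w. cmod (bform {(m, n) \<in> A \<times> B. r m < s n} a b w) \<partial>M) \<le> real l * (C * (l2norm A a * l2norm B b))"
  using assms(3,4)
proof (induction l arbitrary: r s)
  case 0
  have "{(m, n) \<in> A \<times> B. r m < s n} = {}" using 0 by fastforce
  then show ?case by (simp only: bform_def sum.empty) simp
next
  case (Suc l)
  have fin: "finite A" "finite B" using assms(1,2) finite_subset by blast+
  define R1 where "R1 = {(m, n) \<in> A \<times> B. r m div 2 < s n div 2}"
  define Ak where "Ak k = {m \<in> A. r m = 2 * k}" for k
  define Bk where "Bk k = {n \<in> B. s n = 2 * k + 1}" for k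
  have sub: "Ak k \<subseteq> {1..N}" "Bk k \<subseteq> {1..N}" for k
    using assms(1,2) by (auto simp: Ak_def Bk_def)
  define R2 where "R2 = (\<Union>k<2^l. Ak k \<times> Bk k)"
  have split: "{(m, n) \<in> A \<times> B. r m < s n} = R1 \<union> R2"
  proof (intro equalityI subsetI)
    fix z assume "z \<in> {(m, n) \<in> A \<times> B. r m < s n}"
    then obtain m n where z: "z = (m, n)" "m \<in> A" "n \<in> B" "r m < s n" by auto
    show "z \<in> R1 \<union> R2"
    proof (cases "r m div 2 < s n div 2")
      case False
      then have eq: "r m div 2 = s n div 2" using z(4) div_le_mono[of "r m" "s n" 2] by linarith
      have "r m = 2 * (r m div 2)" "s n = 2 * (r m div 2) + 1" using eq z(4) by presburger+
      moreover have "r m div 2 < 2 ^ l" using Suc.prems(1)[OF z(2)] by simp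
      ultimately show ?thesis using z unfolding R2_def Ak_def Bk_def by auto
    qed (use z in \<open>auto simp: R1_def\<close>)
  next
    fix z assume "z \<in> R1 \<union> R2"
    then show "z \<in> {(m, n) \<in> A \<times> B. r m < s n}"
      by (auto simp: R1_def R2_def Ak_def Bk_def dest: div_le_mono[where k = 2] intro: ccontr)
  qed
  have disj: "R1 \<inter> R2 = {}" by (auto simp: R1_def R2_def Ak_def Bk_def)
  have finR: "finite R1" "finite R2"
    unfolding R1_def R2_def using fin by (auto simp: Ak_def Bk_def intro: finite_subset[of _ "A \<times> B"])
  have eq: "bform {(m, n) \<in> A \<times> B. r m < s n} a b w = bform R1 a b w + (\<Sum>k<2^l. dpoly (Ak k) a w * dpoly (Bk k) b w)" for w
  proof -
    have "bform R2 a b w = (\<Sum>k<2^l. bform (Ak k \<times> Bk k) a b w)"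
      unfolding R2_def bform_def using fin
      by (intro sum.UNION_disjoint) (auto simp: Ak_def Bk_def)
    then show ?thesis
      unfolding split bform_Times[symmetric] using disj finR
      by (simp add: bform_def sum.union_disjoint)
  qed
  have R1N: "R1 \<subseteq> {1..N} \<times> {1..N}" using assms(1,2) by (auto simp: R1_def)
  have RN: "{(m, n) \<in> A \<times> B. r m < s n} \<subseteq> {1..N} \<times> {1..N}" using assms(1,2) by auto
  have "(\<integral>w. cmod (bform {(m, n) \<in> A \<times> B. r m < s n} a b w) \<partial>M) \<le>
      (\<integral>w. cmod (bform R1 a b w) + (\<Sum>k<2^l. cmod (dpoly (Ak k) a w) * cmod (dpoly (Bk k) b w)) \<partial>M)"
  proof (intro integral_mono integrable_bform RN Bochner_Integration.integrable_add
      Bochner_Integration.integrable_sum integrable_dpoly sub R1N)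
    fix w
    have "cmod (\<Sum>k<2^l. dpoly (Ak k) a w * dpoly (Bk k) b w) \<le> (\<Sum>k<2^l. cmod (dpoly (Ak k) a w) * cmod (dpoly (Bk k) b w))"
      by (rule order_trans[OF norm_sum]) (simp add: norm_mult)
    then show "cmod (bform {(m, n) \<in> A \<times> B. r m < s n} a b w) \<le>
        cmod (bform R1 a b w) + (\<Sum>k<2^l. cmod (dpoly (Ak k) a w) * cmod (dpoly (Bk k) b w))"
      unfolding eq by (intro order_trans[OF norm_triangle_ineq]) auto
  qed
  also have "\<dots> = (\<integral>w. cmod (bform R1 a b w) \<partial>M) +
      (\<Sum>k<2^l. (\<integral>w. cmod (dpoly (Ak k) a w) * cmod (dpoly (Bk k) b w) \<partial>M))"
    using integrable_bform[OF R1N] integrable_dpoly(3)[OF sub]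
    by (subst Bochner_Integration.integral_add) (auto simp: Bochner_Integration.integral_sum)
  also have "(\<integral>w. cmod (bform R1 a b w) \<partial>M) \<le> real l * (C * (l2norm A a * l2norm B b))"
    unfolding R1_def
  proof (rule Suc.IH)
    show "r m div 2 < 2 ^ l" if "m \<in> A" for m using Suc.prems(1)[OF that] by simp
    show "s n div 2 < 2 ^ l" if "n \<in> B" for n using Suc.prems(2)[OF that] by simp
  qed
  also have "(\<Sum>k<2^l. (\<integral>w. cmod (dpoly (Ak k) a w) * cmod (dpoly (Bk k) b w) \<partial>M)) \<le>
      (\<Sum>k<2^l. C * (l2norm (Ak k) a * l2norm (Bk k) b))"
    by (intro sum_mono mean_dpoly_mult sub)
  also have "\<dots> = C * (\<Sum>k<2^l. l2norm (Ak k) a * l2norm (Bk k) b)"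
    by (simp add: sum_distrib_left)
  also have "\<dots> \<le> C * (l2norm A a * l2norm B b)"
  proof (intro mult_left_mono C_nonneg)
    have "(\<Sum>k<2^l. (l2norm (Ak k) a)\<^sup>2) = (\<Sum>m\<in>(\<Union>k<2^l. Ak k). (a m)\<^sup>2)"
      using fin by (subst sum.UNION_disjoint) (auto simp: Ak_def l2norm_def sum_nonneg)
    also have "\<dots> \<le> (\<Sum>m\<in>A. (a m)\<^sup>2)" using fin by (intro sum_mono2) (auto simp: Ak_def)
    finally have A: "sqrt (\<Sum>k<2^l. (l2norm (Ak k) a)\<^sup>2) \<le> l2norm A a" by (simp add: l2norm_def)
    have "(\<Sum>k<2^l. (l2norm (Bk k) b)\<^sup>2) = (\<Sum>m\<in>(\<Union>k<2^l. Bk k). (b m)\<^sup>2)"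
      using fin by (subst sum.UNION_disjoint) (auto simp: Bk_def l2norm_def sum_nonneg)
    also have "\<dots> \<le> (\<Sum>m\<in>B. (b m)\<^sup>2)" using fin by (intro sum_mono2) (auto simp: Bk_def)
    finally have B: "sqrt (\<Sum>k<2^l. (l2norm (Bk k) b)\<^sup>2) \<le> l2norm B b" by (simp add: l2norm_def)
    have "(\<Sum>k<2^l. l2norm (Ak k) a * l2norm (Bk k) b) \<le>
        sqrt (\<Sum>k<2^l. (l2norm (Ak k) a)\<^sup>2) * sqrt (\<Sum>k<2^l. (l2norm (Bk k) b)\<^sup>2)"
      unfolding real_sqrt_mult[symmetric] by (intro real_le_rsqrt Cauchy_Schwarz_ineq_sum)
    also have "\<dots> \<le> l2norm A a * l2norm B b"
      using A B by (intro mult_mono) (auto intro: sum_nonneg)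
    finally show "(\<Sum>k<2^l. l2norm (Ak k) a * l2norm (Bk k) b) \<le> l2norm A a * l2norm B b" .
  qed
  finally show ?case by (simp add: algebra_simps)
qed

text \<open>The condition \<open>m n \<le> N\<close> compares \<open>m\<close> with a function of \<open>n\<close>, namely \<open>N div n + 1\<close>.\<close>

lemma mean_hyperbola_box:
  assumes "A \<subseteq> {1..N}" "B \<subseteq> {1..N}" "N + 1 < 2 ^ l"
  shows "(\<integral>w. cmod (bform {(m, n) \<in> A \<times> B. m * n \<le> N} a b w) \<partial>M) \<le> real l * (C * (l2norm A a * l2norm B b))"
proof -
  have "{(m, n) \<in> A \<times> B. m * n \<le> N} = {(m, n) \<in> A \<times> B. m < N div n + 1}"
    using assms(2) by (auto simp: less_Suc_eq_le less_eq_div_iff_mult_less_eq)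
  moreover have "N div n + 1 < 2 ^ l" for n
    using assms(3) div_le_dividend[of N n] by linarith
  moreover have "m < 2 ^ l" if "m \<in> A" for m
    using that assms(1,3) by (auto intro: le_less_trans[of _ N])
  ultimately show ?thesis
    using bilinear_comparison[of A B "\<lambda>m. m" l "\<lambda>n. N div n + 1" a b] assms(1,2) by simp
qed

text \<open>The set \<open>G\<close> is the support of \<open>g\<close>. The dyadic decomposition in \<open>m\<close> makes \<open>m n\<close> at most \<open>2N\<close> on the
whole box, so that dropping the hyperbola condition from the \<open>\<ell>\<^sup>2\<close> norms is harmless.\<close>

lemma mean_square_convolution:
  assumes G: "G \<subseteq> {1..N}" and l: "N + 1 < 2 ^ l"
    and V: "\<And>i. i < l \<Longrightarrow> (\<Sum>m\<in>{m\<in>G. 2 ^ i \<le> m \<and> m < 2 * 2 ^ i}. (g m)\<^sup>2) *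
                          (\<Sum>n\<in>{n\<in>G. 2 ^ i * n \<le> N}. (g n)\<^sup>2) \<le> V"
  shows "(\<integral>w. cmod (dpoly {1..N} (\<lambda>k. \<Sum>d | d dvd k \<and> d \<in> G \<and> k div d \<in> G. g d * g (k div d)) w) \<partial>M)
           \<le> (real l)\<^sup>2 * C * sqrt V"
proof -
  define A where "A i = {m\<in>G. 2 ^ i \<le> m \<and> m < 2 * 2 ^ i}" for i :: nat
  define B where "B i = {n\<in>G. 2 ^ i * n \<le> N}" for i :: nat
  define R where "R i = {(m, n) \<in> A i \<times> B i. m * n \<le> N}" for i
  let ?c = "\<lambda>k. \<Sum>d | d dvd k \<and> d \<in> G \<and> k div d \<in> G. g d * g (k div d)"
  have finG: "finite G" using G finite_subset by blast
  have finR: "finite (R i)" for i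
    unfolding R_def A_def B_def by (rule finite_subset[of _ "G \<times> G"]) (use finG in auto)
  have sub: "A i \<subseteq> {1..N}" "B i \<subseteq> {1..N}" for i using G by (auto simp: A_def B_def)
  have RN: "R i \<subseteq> {1..N} \<times> {1..N}" for i using sub by (auto simp: R_def)
  have UR: "(\<Union>i<l. R i) = {(m, n) \<in> G \<times> G. m * n \<le> N}"
  proof (intro equalityI subsetI)
    fix z assume "z \<in> {(m, n) \<in> G \<times> G. m * n \<le> N}"
    then obtain m n where z: "z = (m, n)" "m \<in> G" "n \<in> G" "m * n \<le> N" by auto
    have m: "1 \<le> m" "m \<le> N" using z G by auto
    obtain i where i: "2 ^ i \<le> m" "m < 2 ^ (i + 1)"
      using ex_power_ivl1[of 2 m] m by auto
    have "(2 :: nat) ^ i < 2 ^ l" using i m l by linarith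
    then have "i < l" using power_less_imp_less_exp[of 2 i l] by simp
    moreover have "2 ^ i * n \<le> N" using mult_right_mono[OF i(1), of n] z by linarith
    ultimately show "z \<in> (\<Union>i<l. R i)" using z i by (auto simp: R_def A_def B_def)
  qed (auto simp: R_def A_def B_def)
  have disj: "R i \<inter> R j = {}" if "i < j" for i j
  proof -
    have "(2 :: nat) * 2 ^ i \<le> 2 ^ j" using that power_increasing[of "Suc i" j "2 :: nat"] by simp
    then show ?thesis by (auto simp: R_def A_def)
  qed
  have disj: "R i \<inter> R j = {}" if "i \<noteq> j" for i j
    using disj[of i j] disj[of j i] that by (cases "i < j") auto
  have eq: "dpoly {1..N} ?c w = (\<Sum>i<l. bform (R i) g g w)" if w: "w \<in> space M" for w
  proof -
    have "dpoly {1..N} ?c w = (\<Sum>k\<in>{1..N}. \<Sum>d | d dvd k \<and> d \<in> G \<and> k div d \<in> G.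
        complex_of_real (g d * g (k div d)) * X w k)"
      by (simp add: dpoly_def sum_distrib_right)
    also have "\<dots> = (\<Sum>(k, d)\<in>Sigma {1..N} (\<lambda>k. {d. d dvd k \<and> d \<in> G \<and> k div d \<in> G}).
        complex_of_real (g d * g (k div d)) * X w k)"
      using finG by (intro sum.Sigma) auto
    also have "\<dots> = (\<Sum>(m, n)\<in>{(m, n) \<in> G \<times> G. m * n \<le> N}. (g m * X w m) * (g n * X w n))"
    proof (rule sum.reindex_bij_witness[of _ "\<lambda>(m, n). (m * n, m)" "\<lambda>(k, d). (d, k div d)"])
      fix z assume "z \<in> Sigma {1..N} (\<lambda>k. {d. d dvd k \<and> d \<in> G \<and> k div d \<in> G})"
      then obtain k d where z: "z = (k, d)" "1 \<le> k" "k \<le> N" "d dvd k" "d \<in> G" "k div d \<in> G" by auto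
      have k: "d * (k div d) = k" using z by simp
      have pos: "0 < d" "0 < k div d" using z G by auto
      have "X w k = X w d * X w (k div d)" using X_mult[OF w pos] k by simp
      then show "(case case z of (k, d) \<Rightarrow> (d, k div d) of (m, n) \<Rightarrow> (g m * X w m) * (g n * X w n)) =
          (case z of (k, d) \<Rightarrow> complex_of_real (g d * g (k div d)) * X w k)"
        by (simp add: z(1))
      show "(case z of (k, d) \<Rightarrow> (d, k div d)) \<in> {(m, n) \<in> G \<times> G. m * n \<le> N}"
        using z k by simp
      show "(case case z of (k, d) \<Rightarrow> (d, k div d) of (m, n) \<Rightarrow> (m * n, m)) = z"
        using z k by simp
    next
      fix z assume "z \<in> {(m, n) \<in> G \<times> G. m * n \<le> N}"
      then obtain m n where z: "z = (m, n)" "m \<in> G" "n \<in> G" "m * n \<le> N" by auto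
      have "0 < m" "0 < n" using z G by auto
      then show "(case case z of (m, n) \<Rightarrow> (m * n, m) of (k, d) \<Rightarrow> (d, k div d)) = z"
          "(case z of (m, n) \<Rightarrow> (m * n, m)) \<in> Sigma {1..N} (\<lambda>k. {d. d dvd k \<and> d \<in> G \<and> k div d \<in> G})"
        using z by auto
    qed
    also have "\<dots> = (\<Sum>i<l. bform (R i) g g w)"
      unfolding UR[symmetric] bform_def using finR disj by (intro sum.UNION_disjoint) auto
    finally show ?thesis .
  qed
  have "(\<integral>w. cmod (dpoly {1..N} ?c w) \<partial>M) \<le> (\<integral>w. (\<Sum>i<l. cmod (bform (R i) g g w)) \<partial>M)"
  proof (intro integral_mono integrable_dpoly(1) Bochner_Integration.integrable_sum integrable_bform RN)
    fix w assume "w \<in> space M"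
    then show "cmod (dpoly {1..N} ?c w) \<le> (\<Sum>i<l. cmod (bform (R i) g g w))"
      unfolding eq[OF \<open>w \<in> space M\<close>] by (intro norm_sum)
  qed auto
  also have "\<dots> = (\<Sum>i<l. (\<integral>w. cmod (bform (R i) g g w) \<partial>M))"
    by (intro Bochner_Integration.integral_sum integrable_bform RN)
  also have "\<dots> \<le> (\<Sum>i<l. real l * (C * sqrt V))"
  proof (intro sum_mono)
    fix i assume "i \<in> {..<l}"
    have "(\<integral>w. cmod (bform (R i) g g w) \<partial>M) \<le> real l * (C * (l2norm (A i) g * l2norm (B i) g))"
      unfolding R_def by (intro mean_hyperbola_box sub l)
    also have "l2norm (A i) g * l2norm (B i) g \<le> sqrt V"
      unfolding l2norm_def real_sqrt_mult[symmetric] A_def B_def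
      using V \<open>i \<in> {..<l}\<close> by (intro real_sqrt_le_mono) auto
    finally show "(\<integral>w. cmod (bform (R i) g g w) \<partial>M) \<le> real l * (C * sqrt V)"
      using C_nonneg by (simp add: mult_left_mono)
  qed
  also have "\<dots> = (real l)\<^sup>2 * C * sqrt V" by (simp add: power2_eq_square)
  finally show ?thesis by simp
qed

end

section \<open>Mean values of smooth sums\<close>

text \<open>Write \<open>a = m s\<^sup>2\<close> with \<open>m\<close> squarefree. As \<open>m\<close> is a product of distinct primes up to \<open>y\<close>, it has at
least \<open>log m / log y\<close> of them, and \<open>s \<le> z\<close> makes \<open>m\<close> almost as large as \<open>a\<close>. The exponent
\<open>ln 2 / ln y\<close> is chosen so that \<open>y\<close> to this power is 2.\<close>

lemma half_divisor_smooth_le: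
  assumes y: "2 \<le> y" and a: "a \<in> smooth_numbers x y" and sq: "\<And>s. s\<^sup>2 dvd a \<Longrightarrow> real s \<le> z"
  shows "half_divisor a \<le> z powr (2 * (ln 2 / ln y)) * real a powr (- (ln 2 / ln y))"
proof -
  define \<theta> where "\<theta> = ln 2 / ln y"
  have \<theta>: "0 \<le> \<theta>" "y powr \<theta> = 2" unfolding \<theta>_def using y by (simp_all add: powr_def)
  have a0: "0 < a" using a by (simp add: smooth_numbers_def)
  define m where "m = squarefree_part a"
  define s where "s = square_part a"
  have dec: "a = m * s\<^sup>2" unfolding m_def s_def by (rule squarefree_decompose)
  have pos: "0 < m" "0 < s" using a0 dec by (auto intro!: Nat.gr0I)
  have sz: "real s \<le> z" by (rule sq) (simp add: dec)
  have "real m = (\<Prod>p\<in>prime_factors m. real (p ^ multiplicity p m))"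
    using prime_factorization_nat[OF pos(1)] by (metis of_nat_prod)
  also have "\<dots> = (\<Prod>p\<in>prime_factors m. real p)"
  proof (intro prod.cong refl)
    fix p assume p: "p \<in> prime_factors m"
    then have "0 < multiplicity p m" using prime_factors_multiplicity[of m] by auto
    moreover have "multiplicity p m \<le> Suc 0"
      using p unfolding m_def by (intro prime_multiplicity_squarefree_part_le_Suc_0) auto
    ultimately have "multiplicity p m = 1" by simp
    then show "real (p ^ multiplicity p m) = real p" by simp
  qed
  also have "\<dots> \<le> (\<Prod>p\<in>prime_factors m. y)"
  proof (intro prod_mono conjI)
    fix p assume "p \<in> prime_factors m"
    then have "prime p" "p dvd a" using dec by (auto simp: in_prime_factors_iff)
    then show "real p \<le> y" using a by (auto simp: smooth_numbers_altdef)
  qed simp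
  also have "\<dots> = y powr real (card (prime_factors m))" using y by (simp add: powr_realpow)
  finally have "real m powr \<theta> \<le> (y powr real (card (prime_factors m))) powr \<theta>"
    using \<theta> pos by (intro powr_mono2) auto
  also have "\<dots> = 2 ^ card (prime_factors m)"
    using \<theta>(2) y by (metis mult.commute powr_powr powr_realpow zero_less_numeral)
  also have "\<dots> \<le> 2 ^ card (prime_factors a)"
    using dec a0 by (intro power_increasing card_mono dvd_prime_factors) auto
  finally have mle: "real m powr \<theta> \<le> 2 ^ card (prime_factors a)" .
  have "real a powr \<theta> = real m powr \<theta> * (real s)\<^sup>2 powr \<theta>"
    unfolding dec by (simp add: powr_mult)
  also have "(real s)\<^sup>2 powr \<theta> = real s powr (2 * \<theta>)"
    using pos by (simp add: powr_powr flip: powr_numeral)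
  also have "real m powr \<theta> * real s powr (2 * \<theta>) \<le> 2 ^ card (prime_factors a) * z powr (2 * \<theta>)"
    using mle sz \<theta> by (intro mult_mono powr_mono2) auto
  finally have *: "real a powr \<theta> \<le> 2 ^ card (prime_factors a) * z powr (2 * \<theta>)" .
  have "half_divisor a \<le> (1/2) ^ card (prime_factors a)" by (rule half_divisor_le)
  also have "\<dots> \<le> z powr (2 * \<theta>) * real a powr (- \<theta>)"
    using * a0 by (simp add: powr_minus field_simps)
  finally show ?thesis by (simp add: \<theta>_def)
qed

text \<open>One factor \<open>g(m) g(n)\<close> is estimated pointwise, the other is summed by \<open>g * g = 1\<close>. This compares
the \<open>\<ell>\<^sup>2\<close> norms with the number of elements of \<open>S\<close>.\<close>

lemma sum_half_divisor_pairs_le: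
  fixes \<theta> :: real
  assumes fin: "finite A" "finite B" "finite S" and S0: "\<And>k. k \<in> S \<Longrightarrow> 0 < k"
    and pos: "\<And>m. m \<in> A \<Longrightarrow> 0 < m" "\<And>n. n \<in> B \<Longrightarrow> 0 < n"
    and AB: "\<And>m n. m \<in> A \<Longrightarrow> n \<in> B \<Longrightarrow> m * n \<in> S"
    and le: "\<And>a. a \<in> A \<union> B \<Longrightarrow> half_divisor a \<le> K * real a powr (- \<theta>)"
  shows "(\<Sum>m\<in>A. (half_divisor m)\<^sup>2) * (\<Sum>n\<in>B. (half_divisor n)\<^sup>2) \<le> K\<^sup>2 * (\<Sum>k\<in>S. real k powr (- \<theta>))"
proof -
  let ?f = "\<lambda>k d. K\<^sup>2 * real k powr (- \<theta>) * (half_divisor d * half_divisor (k div d))"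
  have "(\<Sum>m\<in>A. (half_divisor m)\<^sup>2) * (\<Sum>n\<in>B. (half_divisor n)\<^sup>2) =
      (\<Sum>(m, n)\<in>A \<times> B. (half_divisor m)\<^sup>2 * (half_divisor n)\<^sup>2)"
    by (simp add: sum_product sum.cartesian_product)
  also have "\<dots> \<le> (\<Sum>(m, n)\<in>A \<times> B. ?f (m * n) m)"
  proof (intro sum_mono, clarify)
    fix m n assume mn: "m \<in> A" "n \<in> B"
    have "half_divisor m * half_divisor n \<le> (K * real m powr (- \<theta>)) * (K * real n powr (- \<theta>))"
      using le[of m] le[of n] mn half_divisor_pos[of m] half_divisor_pos[of n]
      by (intro mult_mono) (auto intro: order_trans less_imp_le)
    also have "\<dots> = K\<^sup>2 * real (m * n) powr (- \<theta>)" by (simp add: powr_mult power2_eq_square)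
    finally have "half_divisor m * half_divisor n * (half_divisor m * half_divisor n) \<le>
        K\<^sup>2 * real (m * n) powr (- \<theta>) * (half_divisor m * half_divisor n)"
      using half_divisor_pos[of m] half_divisor_pos[of n] by (intro mult_right_mono) auto
    then show "(half_divisor m)\<^sup>2 * (half_divisor n)\<^sup>2 \<le> ?f (m * n) m"
      using pos(1)[OF mn(1)] by (simp add: power2_eq_square mult_ac)
  qed
  also have "\<dots> \<le> (\<Sum>(k, d)\<in>Sigma S (\<lambda>k. {d. d dvd k}). ?f k d)"
  proof -
    have inj: "inj_on (\<lambda>(m, n). (m * n, m)) (A \<times> B)"
      by (rule inj_onI) (use pos in \<open>force\<close>)
    have "(\<Sum>(m, n)\<in>A \<times> B. ?f (m * n) m) = (\<Sum>(k, d)\<in>(\<lambda>(m, n). (m * n, m)) ` (A \<times> B). ?f k d)"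
      unfolding sum.reindex[OF inj] by (intro sum.cong) auto
    also have "\<dots> \<le> (\<Sum>(k, d)\<in>Sigma S (\<lambda>k. {d. d dvd k}). ?f k d)"
    proof (intro sum_mono2)
      show "finite (Sigma S (\<lambda>k. {d. d dvd k}))"
        using fin S0 by (intro finite_SigmaI) auto
      show "(\<lambda>(m, n). (m * n, m)) ` (A \<times> B) \<subseteq> Sigma S (\<lambda>k. {d. d dvd k})"
        using AB by auto
    qed (auto intro!: mult_nonneg_nonneg less_imp_le[OF half_divisor_pos])
    finally show ?thesis .
  qed
  also have "\<dots> = (\<Sum>k\<in>S. \<Sum>d | d dvd k. ?f k d)"
    using fin S0 by (intro sum.Sigma[symmetric]) auto
  also have "\<dots> = (\<Sum>k\<in>S. K\<^sup>2 * real k powr (- \<theta>))"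
    using half_divisor_convolution S0 by (intro sum.cong refl) (simp flip: sum_distrib_left)
  finally show ?thesis by (simp add: sum_distrib_left)
qed

context mean_value_system
begin

text \<open>On numbers without a square divisor \<open>s\<^sup>2\<close> with \<open>s > z\<close>, which form a set closed under divisors, the
convolution square of the restriction of \<open>g\<close> is 1; on the others its
coefficients lie in \<open>[0, 1]\<close> and the difference is estimated trivially.\<close>

lemma mean_smooth_le:
  fixes x y z :: real
  assumes N: "N = nat \<lfloor>x\<rfloor>" and x: "1 \<le> x" and y: "2 \<le> y" and z: "1 \<le> z" and l: "N + 1 < 2 ^ l"
  defines "\<theta> \<equiv> ln 2 / ln y"
  shows "(\<integral>w. cmod (dpoly (smooth_numbers x y) (\<lambda>_. 1) w) \<partial>M) \<le>
    (real l)\<^sup>2 * C * sqrt ((z powr (2 * \<theta>))\<^sup>2 * (\<Sum>n\<in>smooth_numbers (2 * x) y. real n powr (- \<theta>)))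
    + C * sqrt (real (card {n \<in> smooth_numbers x y. \<exists>s. s\<^sup>2 dvd n \<and> z < real s}))"
proof -
  let ?g = half_divisor
  define G where "G = {n \<in> smooth_numbers x y. \<forall>s. s\<^sup>2 dvd n \<longrightarrow> real s \<le> z}"
  define Bad where "Bad = {n \<in> smooth_numbers x y. \<exists>s. s\<^sup>2 dvd n \<and> z < real s}"
  define c where "c k = (\<Sum>d | d dvd k \<and> d \<in> G \<and> k div d \<in> G. ?g d * ?g (k div d))" for k
  have smN: "n \<in> smooth_numbers x y \<Longrightarrow> n \<in> {1..N}" for n
    using N by (auto simp: smooth_numbers_def le_nat_floor)
  have Nx: "real N \<le> x" using N x by linarith
  have GN: "G \<subseteq> {1..N}" and BN: "Bad \<subseteq> {1..N}" using smN by (auto simp: G_def Bad_def)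
  have finG: "finite G" using GN finite_subset by blast
  have V: "(\<Sum>m\<in>{m\<in>G. 2 ^ i \<le> m \<and> m < 2 * 2 ^ i}. (?g m)\<^sup>2) * (\<Sum>n\<in>{n\<in>G. 2 ^ i * n \<le> N}. (?g n)\<^sup>2)
      \<le> (z powr (2 * \<theta>))\<^sup>2 * (\<Sum>n\<in>smooth_numbers (2 * x) y. real n powr (- \<theta>))" for i :: nat
  proof (rule sum_half_divisor_pairs_le)
    fix m n assume m: "m \<in> {m\<in>G. 2 ^ i \<le> m \<and> m < 2 * 2 ^ i}" and n: "n \<in> {n\<in>G. 2 ^ i * n \<le> N}"
    have "m * n \<le> 2 * 2 ^ i * n" using m by (intro mult_right_mono) auto
    also have "\<dots> \<le> 2 * N" using n by simp
    finally have "real (m * n) \<le> 2 * x" using Nx by linarith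
    then show "m * n \<in> smooth_numbers (2 * x) y"
      using m n by (auto simp: G_def intro: smooth_numbers_multI)
  next
    fix a assume "a \<in> {m\<in>G. 2 ^ i \<le> m \<and> m < 2 * 2 ^ i} \<union> {n\<in>G. 2 ^ i * n \<le> N}"
    then have "a \<in> G" by auto
    then show "?g a \<le> z powr (2 * \<theta>) * real a powr (- \<theta>)"
      unfolding \<theta>_def using y by (intro half_divisor_smooth_le[where x = x]) (auto simp: G_def)
  qed (use finG GN finite_smooth_numbers in \<open>auto simp: smooth_numbers_def\<close>)
  have c1: "c n = 1" if "n \<in> G" for n
  proof -
    have n0: "0 < n" using that GN by auto
    have dG: "a \<in> G" if "a * b = n" for a b
      using that \<open>n \<in> G\<close> smooth_numbers_multD(1)[of a b x y] by (auto simp: G_def intro: dvd_mult2)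
    have "{d. d dvd n \<and> d \<in> G \<and> n div d \<in> G} = {d. d dvd n}"
      using dG by (auto elim!: dvdE) (metis dG mult.commute n0 nonzero_mult_div_cancel_left mult_is_0 not_gr0)
    then show ?thesis using half_divisor_convolution[OF n0] by (simp add: c_def)
  qed
  have c0: "0 \<le> c n" for n
    unfolding c_def by (intro sum_nonneg mult_nonneg_nonneg less_imp_le[OF half_divisor_pos])
  have cle: "c n \<le> 1" if "0 < n" for n
  proof -
    have "c n \<le> (\<Sum>d | d dvd n. ?g d * ?g (n div d))"
      unfolding c_def using that
      by (intro sum_mono2) (auto intro!: mult_nonneg_nonneg less_imp_le[OF half_divisor_pos])
    then show ?thesis using half_divisor_convolution[OF that] by simp
  qed
  have cns: "c n = 0" if "n \<in> {1..N} - smooth_numbers x y" for n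
  proof -
    have "{d. d dvd n \<and> d \<in> G \<and> n div d \<in> G} = {}"
    proof (rule ccontr)
      assume "{d. d dvd n \<and> d \<in> G \<and> n div d \<in> G} \<noteq> {}"
      then obtain d where d: "d dvd n" "d \<in> G" "n div d \<in> G" by blast
      have "real n \<le> x" using that Nx by auto
      then have "d * (n div d) \<in> smooth_numbers x y"
        using d by (intro smooth_numbers_multI[where u = x and v = x]) (auto simp: G_def)
      then show False using d that by simp
    qed
    then show ?thesis unfolding c_def by (simp only: sum.empty)
  qed
  have smGB: "smooth_numbers x y = G \<union> Bad" "G \<inter> Bad = {}"
    by (auto simp: G_def Bad_def not_le)
  have eq: "dpoly (smooth_numbers x y) (\<lambda>_. 1) w = dpoly {1..N} c w + dpoly Bad (\<lambda>n. 1 - c n) w" for w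
  proof -
    have "dpoly {1..N} c w = dpoly (smooth_numbers x y) c w"
      unfolding dpoly_def using smN cns by (intro sum.mono_neutral_right) auto
    moreover have "dpoly Bad (\<lambda>n. 1 - c n) w = dpoly (smooth_numbers x y) (\<lambda>n. 1 - c n) w"
      unfolding dpoly_def using c1 smGB by (intro sum.mono_neutral_left finite_smooth_numbers) auto
    ultimately show ?thesis
      by (simp add: dpoly_def algebra_simps flip: sum.distrib)
  qed
  have smN': "smooth_numbers x y \<subseteq> {1..N}" using smN by blast
  have "(\<integral>w. cmod (dpoly (smooth_numbers x y) (\<lambda>_. 1) w) \<partial>M) \<le>
      (\<integral>w. cmod (dpoly {1..N} c w) + cmod (dpoly Bad (\<lambda>n. 1 - c n) w) \<partial>M)"
  proof (rule integral_mono)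
    show "integrable M (\<lambda>w. cmod (dpoly (smooth_numbers x y) (\<lambda>_. 1) w))"
      by (rule integrable_dpoly(1)[OF smN' smN'])
    show "integrable M (\<lambda>w. cmod (dpoly {1..N} c w) + cmod (dpoly Bad (\<lambda>n. 1 - c n) w))"
      using BN by (intro Bochner_Integration.integrable_add integrable_dpoly(1)) auto
  qed (simp add: eq norm_triangle_ineq)
  also have "\<dots> = (\<integral>w. cmod (dpoly {1..N} c w) \<partial>M) + (\<integral>w. cmod (dpoly Bad (\<lambda>n. 1 - c n) w) \<partial>M)"
    using BN by (intro Bochner_Integration.integral_add integrable_dpoly(1)) auto
  also have "(\<integral>w. cmod (dpoly {1..N} c w) \<partial>M) \<le> (real l)\<^sup>2 * C *
      sqrt ((z powr (2 * \<theta>))\<^sup>2 * (\<Sum>n\<in>smooth_numbers (2 * x) y. real n powr (- \<theta>)))"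
    unfolding c_def by (intro mean_square_convolution GN l V)
  also have "(\<integral>w. cmod (dpoly Bad (\<lambda>n. 1 - c n) w) \<partial>M) \<le> C * l2norm Bad (\<lambda>n. 1 - c n)"
    by (intro mean_dpoly BN)
  also have "l2norm Bad (\<lambda>n. 1 - c n) \<le> sqrt (\<Sum>n\<in>Bad. 1)"
    unfolding l2norm_def
  proof (intro real_sqrt_le_mono sum_mono)
    fix n assume "n \<in> Bad"
    then have "0 < n" using BN by auto
    then show "(1 - c n)\<^sup>2 \<le> 1" using cle[of n] c0[of n] by (intro power_le_one) auto
  qed
  also have "(\<Sum>n\<in>Bad. 1) = real (card Bad)" by simp
  finally show ?thesis using C_nonneg by (simp add: Bad_def mult_left_mono)
qed

lemma mean_smooth_trivial:
  assumes N: "N = nat \<lfloor>x\<rfloor>"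
  shows "(\<integral>w. cmod (dpoly (smooth_numbers x y) (\<lambda>_. 1) w) \<partial>M) \<le> C * sqrt (real (Psi x y))"
proof -
  have "smooth_numbers x y \<subseteq> {1..N}" using N by (auto simp: smooth_numbers_def le_nat_floor)
  from mean_dpoly[OF this, of "\<lambda>_. 1"] show ?thesis by (simp add: l2norm_def Psi_def)
qed

end

text \<open>The range forces \<open>log x > 1\<close>, since otherwise the upper bound for \<open>y\<close> is at most 1; in terms of
\<open>u\<close> that bound says \<open>u \<ge> 32 log log x\<close>.\<close>

lemma admissible_rangeD:
  assumes "admissible_range x y"
  shows "2 \<le> y" "y \<le> x" "1 < ln x" "6 * ln (ln x) \<le> ln y" "32 * ln (ln x) \<le> ln x / ln y"
proof -
  have *: "2 \<le> y" "y \<le> x" "ln x ^ 6 \<le> y" "y \<le> x powr (1 / (32 * ln (ln x)))"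
    using assms by (auto simp: admissible_range_def)
  show "2 \<le> y" "y \<le> x" by fact+
  have lx: "0 < ln x" using * by simp
  show L: "1 < ln x"
  proof (rule ccontr)
    assume "\<not> 1 < ln x"
    then have "ln (ln x) \<le> 0" using lx by simp
    then have "1 / (32 * ln (ln x)) \<le> 0" by (simp add: divide_nonneg_nonpos)
    then have "x powr (1 / (32 * ln (ln x))) \<le> x powr 0" using * by (intro powr_mono) auto
    then show False using * by simp
  qed
  have "ln (ln x ^ 6) \<le> ln y" using * L by (subst ln_le_cancel_iff) auto
  then show "6 * ln (ln x) \<le> ln y" using L by (simp add: ln_realpow)
  have "ln y \<le> ln (x powr (1 / (32 * ln (ln x))))" using * by (subst ln_le_cancel_iff) auto
  then have "ln y \<le> ln x / (32 * ln (ln x))" using * by simp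
  moreover have "0 < ln (ln x)" "0 < ln y" using L * by auto
  ultimately show "32 * ln (ln x) \<le> ln x / ln y" by (simp add: field_simps)
qed

text \<open>The last argument enters \<open>S_bound\<close> only through \<open>min T (x powr (3/2))\<close>, so the square in the exponent is at most \<open>1/4\<close>.\<close>

lemma S_bound_ge:
  assumes "2 \<le> y" "y \<le> x" "x \<le> T"
  shows "ln x powr (3/2) * ln y powr (1/2) * exp (- (ln x / ln y) / 16) \<le> S_bound x y T"
proof -
  define m where "m = min T (x powr (3/2))"
  have lx: "0 < ln x" and ly: "0 < ln y" using assms by auto
  have "x powr 1 \<le> x powr (3/2)" using assms by (intro powr_mono) auto
  then have m: "x \<le> m" "m \<le> x powr (3/2)" unfolding m_def using assms by auto
  have "ln x \<le> ln m" using m assms by simp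
  moreover have "ln m \<le> 3/2 * ln x"
    using m assms by (metis ln_powr less_le_trans ln_le_cancel_iff powr_gt_zero zero_less_numeral order_less_le_trans not_less_iff_gr_or_eq)
  ultimately have d: "0 \<le> ln m / ln x - 1" "ln m / ln x - 1 \<le> 1/2"
    using lx by (simp_all add: field_simps)
  then have "(ln m / ln x - 1)\<^sup>2 \<le> (1/2)\<^sup>2" by (intro power_mono) auto
  then have "(ln x / ln y / 4) * (ln m / ln x - 1)\<^sup>2 \<le> (ln x / ln y / 4) * (1/2)\<^sup>2"
    using lx ly by (intro mult_left_mono) auto
  then have "exp (- (ln x / ln y) / 16) \<le> exp (- (ln x / ln y / 4) * (ln m / ln x - 1)\<^sup>2)"
    by (simp add: power2_eq_square)
  also have "\<dots> \<le> y powr (1/2 - saddle_point x y) + \<dots>" by simp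
  finally show ?thesis
    unfolding S_bound_def Let_def m_def by (intro mult_left_mono) auto
qed

text \<open>With \<open>\<pi>(y) \<ge> y / (6 log y)\<close> the claim is \<open>9 log x log y \<le> y\<close> to the power \<open>1/3\<close>, and both \<open>log x\<close> and \<open>9 log y\<close> are
at most \<open>y\<close> to the power \<open>1/6\<close>.\<close>

lemma decay_condition:
  assumes "admissible_range x y" "2 \<le> ln (ln x)"
  shows "ln x / ln 2 \<le> y powr (-2/3) * real (card {p::nat. prime p \<and> real p \<le> y})"
proof -
  note a = admissible_rangeD[OF assms(1)]
  define Y where "Y = ln y"
  have Y: "0 < Y" "y = exp Y" using a by (auto simp: Y_def)
  have "64 \<le> ln x / Y" using a(5) assms(2) unfolding Y_def by linarith
  then have "64 * Y \<le> ln x" using Y by (simp add: field_simps)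
  then have "9 * Y \<le> ln x" using Y by simp
  have "ln x = exp (ln (ln x))" using a by simp
  also have "\<dots> \<le> exp (Y / 6)" unfolding exp_le_cancel_iff using a(4) by (simp add: Y_def)
  finally have LY: "ln x \<le> exp (Y / 6)" .
  have "ln x / ln 2 \<le> ln x / (2/3)"
    using a ln2_ge_two_thirds by (intro divide_left_mono) auto
  also have "\<dots> = ln x * (9 * Y) / (6 * Y)" using Y by simp
  also have "\<dots> \<le> exp (Y / 6) * exp (Y / 6) / (6 * Y)"
    using LY \<open>9 * Y \<le> ln x\<close> Y a by (intro divide_right_mono mult_mono) auto
  also have "\<dots> = y powr (-2/3) * (y / (6 * ln y))"
    using Y by (simp add: powr_def Y_def[symmetric] exp_add[symmetric] field_simps)
  also have "\<dots> \<le> y powr (-2/3) * real (card {p::nat. prime p \<and> real p \<le> y})"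
    using a by (intro mult_left_mono chebyshev_lower) auto
  finally show ?thesis .
qed

text \<open>Multiples of \<open>s\<^sup>2\<close> are counted by \<open>\<Psi>(x/s\<^sup>2, y)\<close>, which is at most \<open>(y/s\<^sup>2)\<close> to the power \<open>2/3\<close> times \<open>\<Psi>(x, y)\<close>; of
the resulting power \<open>-4/3\<close> of \<open>s\<close>, one third is spent on \<open>s > z\<close> and the rest summed harmonically.\<close>

lemma card_large_square_le:
  assumes "2 \<le> y" "1 \<le> x" "1 \<le> z"
    and H: "ln x / ln 2 \<le> y powr (-2/3) * real (card {p::nat. prime p \<and> real p \<le> y})"
  shows "real (card {n \<in> smooth_numbers x y. \<exists>s. s\<^sup>2 dvd n \<and> z < real s})
    \<le> y powr (2/3) * z powr (-1/3) * (ln x + 1) * real (Psi x y)"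
proof -
  define N where "N = nat \<lfloor>x\<rfloor>"
  define Sq where "Sq = {s \<in> {1..N}. z < real s}"
  define f where "f s = {n \<in> smooth_numbers x y. s\<^sup>2 dvd n}" for s :: nat
  have Nx: "1 \<le> N" "real N \<le> x" unfolding N_def using assms by linarith+
  have sub: "{n \<in> smooth_numbers x y. \<exists>s. s\<^sup>2 dvd n \<and> z < real s} \<subseteq> (\<Union>s\<in>Sq. f s)"
  proof
    fix n assume "n \<in> {n \<in> smooth_numbers x y. \<exists>s. s\<^sup>2 dvd n \<and> z < real s}"
    then obtain s where s: "n \<in> smooth_numbers x y" "s\<^sup>2 dvd n" "z < real s" by auto
    have n: "0 < n" "n \<le> N" using s(1) unfolding N_def by (auto simp: smooth_numbers_def le_nat_floor)
    have "s \<le> s\<^sup>2" by (simp add: power2_eq_square)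
    also have "s\<^sup>2 \<le> n" using s n by (intro dvd_imp_le) auto
    finally have "s \<in> Sq" using s n assms by (auto simp: Sq_def)
    then show "n \<in> (\<Union>s\<in>Sq. f s)" using s by (auto simp: f_def)
  qed
  have finf: "finite (f s)" for s unfolding f_def using finite_smooth_numbers by simp
  have "real (card {n \<in> smooth_numbers x y. \<exists>s. s\<^sup>2 dvd n \<and> z < real s}) \<le> real (card (\<Union>s\<in>Sq. f s))"
    using sub finf by (intro of_nat_mono card_mono) (auto simp: Sq_def)
  also have "\<dots> \<le> real (\<Sum>s\<in>Sq. card (f s))"
    by (intro of_nat_mono card_UN_le) (auto simp: Sq_def)
  also have "\<dots> = (\<Sum>s\<in>Sq. real (card (f s)))" by simp
  also have "\<dots> \<le> (\<Sum>s\<in>Sq. y powr (2/3) * z powr (-1/3) * real (Psi x y) * (1 / real s))"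
  proof (intro sum_mono)
    fix s assume "s \<in> Sq"
    then have s: "1 \<le> s" "z < real s" by (auto simp: Sq_def)
    have "card (f s) \<le> card (smooth_numbers (x / real (s\<^sup>2)) y)"
    proof (rule card_inj_on_le[of "\<lambda>n. n div s\<^sup>2"])
      show "inj_on (\<lambda>n. n div s\<^sup>2) (f s)"
        by (rule inj_onI) (auto simp: f_def elim!: dvdE)
      show "(\<lambda>n. n div s\<^sup>2) ` f s \<subseteq> smooth_numbers (x / real (s\<^sup>2)) y"
      proof clarify
        fix n assume "n \<in> f s"
        then show "n div s\<^sup>2 \<in> smooth_numbers (x / real (s\<^sup>2)) y"
          using smooth_numbers_multD(2)[of "n div s\<^sup>2" "s\<^sup>2" x y] by (simp add: f_def)
      qed
    qed (rule finite_smooth_numbers)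
    then have "real (card (f s)) \<le> real (Psi (x / (real s)\<^sup>2) y)" by (simp add: Psi_def)
    also have "\<dots> \<le> ((real s)\<^sup>2 / y) powr (-2/3) * real (Psi x y)"
      using s H assms by (intro Psi_divide_le) auto
    also have "((real s)\<^sup>2 / y) powr (-2/3) = y powr (2/3) * (real s powr (-1/3) * (1 / real s))"
    proof -
      have "((real s)\<^sup>2 / y) powr (-2/3) = (real s)\<^sup>2 powr (-2/3) * y powr (2/3)"
        using s assms by (simp add: powr_divide powr_minus field_simps)
      also have "(real s)\<^sup>2 powr (-2/3) = real s powr (2 * (-2/3))"
        using s by (simp add: powr_powr flip: powr_numeral)
      also have "\<dots> = real s powr (-1/3 + (-1))" by simp
      also have "\<dots> = real s powr (-1/3) * real s powr (-1)" by (rule powr_add)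
      also have "real s powr (-1) = 1 / real s" using s by (simp add: powr_minus field_simps)
      finally show ?thesis by (simp add: mult_ac)
    qed
    also have "y powr (2/3) * (real s powr (-1/3) * (1 / real s)) * real (Psi x y) \<le>
        y powr (2/3) * (z powr (-1/3) * (1 / real s)) * real (Psi x y)"
      using s assms by (intro mult_right_mono mult_left_mono powr_mono2') auto
    finally show "real (card (f s)) \<le> y powr (2/3) * z powr (-1/3) * real (Psi x y) * (1 / real s)"
      by (simp add: mult_ac)
  qed
  also have "\<dots> = y powr (2/3) * z powr (-1/3) * real (Psi x y) * (\<Sum>s\<in>Sq. 1 / real s)"
    by (simp add: sum_distrib_left)
  also have "\<dots> \<le> y powr (2/3) * z powr (-1/3) * real (Psi x y) * (ln x + 1)"
  proof (intro mult_left_mono)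
    have "(\<Sum>s\<in>Sq. 1 / real s) \<le> (\<Sum>s\<in>{1..N}. 1 / real s)"
      by (intro sum_mono2) (auto simp: Sq_def)
    also have "\<dots> = harm N" by (simp add: harm_def inverse_eq_divide)
    also have "harm N \<le> ln (real N) + 1"
      using euler_mascheroni_sequence_decreasing[of 1 N] Nx by (simp add: harm_expand)
    also have "ln (real N) + 1 \<le> ln x + 1" using Nx by simp
    finally show "(\<Sum>s\<in>Sq. 1 / real s) \<le> ln x + 1" .
  qed simp
  finally show ?thesis by (simp add: mult_ac)
qed

text \<open>The terms with \<open>n > x\<close> to the power \<open>3/4\<close> are small individually, the others are few.\<close>

lemma sum_smooth_powr_le:
  assumes "2 \<le> y" "1 \<le> x" "0 \<le> \<theta>"
    and H: "ln x / ln 2 \<le> y powr (-2/3) * real (card {p::nat. prime p \<and> real p \<le> y})"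
  shows "(\<Sum>n\<in>smooth_numbers (2 * x) y. real n powr (- \<theta>)) \<le>
    (x powr (-3/4 * \<theta>) * (3 + 18 * (ln x)\<^sup>2) + (x powr (1/4) / y) powr (-2/3)) * real (Psi x y)"
proof -
  let ?S = "smooth_numbers (2 * x) y" and ?T = "smooth_numbers (x powr (3/4)) y"
  have "x powr (3/4) \<le> x powr 1" using assms by (intro powr_mono) auto
  then have sub: "?T \<subseteq> ?S" using assms by (intro smooth_numbers_mono) auto
  have "(\<Sum>n\<in>?S. real n powr (- \<theta>)) = (\<Sum>n\<in>?S - ?T. real n powr (- \<theta>)) + (\<Sum>n\<in>?T. real n powr (- \<theta>))"
    using sub by (intro sum.subset_diff finite_smooth_numbers)
  also have "(\<Sum>n\<in>?S - ?T. real n powr (- \<theta>)) \<le> (\<Sum>n\<in>?S - ?T. x powr (-3/4 * \<theta>))"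
  proof (intro sum_mono)
    fix n assume "n \<in> ?S - ?T"
    then have "x powr (3/4) < real n" by (auto simp: smooth_numbers_def)
    then have "real n powr (- \<theta>) \<le> (x powr (3/4)) powr (- \<theta>)"
      using assms by (intro powr_mono2') auto
    then show "real n powr (- \<theta>) \<le> x powr (-3/4 * \<theta>)" by (simp add: powr_powr)
  qed
  also have "\<dots> \<le> x powr (-3/4 * \<theta>) * real (Psi (2 * x) y)"
  proof -
    have "card (?S - ?T) \<le> Psi (2 * x) y"
      unfolding Psi_def by (intro card_mono finite_smooth_numbers) auto
    then have "real (card (?S - ?T)) * x powr (-3/4 * \<theta>) \<le> real (Psi (2 * x) y) * x powr (-3/4 * \<theta>)"
      by (intro mult_right_mono) auto
    then show ?thesis by (simp add: mult.commute)
  qed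
  also have "\<dots> \<le> x powr (-3/4 * \<theta>) * ((3 + 18 * (ln x)\<^sup>2) * real (Psi x y))"
    using assms by (intro mult_left_mono Psi_double) auto
  also have "(\<Sum>n\<in>?T. real n powr (- \<theta>)) \<le> (\<Sum>n\<in>?T. 1)"
  proof (intro sum_mono)
    fix n assume "n \<in> ?T"
    then have "1 \<le> real n" by (simp add: smooth_numbers_def)
    then have "real n powr (- \<theta>) \<le> real n powr 0" using assms by (intro powr_mono) auto
    then show "real n powr (- \<theta>) \<le> 1" using \<open>1 \<le> real n\<close> by simp
  qed
  also have "(\<Sum>n\<in>?T. 1) = real (Psi (x / x powr (1/4)) y)"
  proof -
    have "x / x powr (1/4) = x powr 1 / x powr (1/4)" using assms by simp
    also have "\<dots> = x powr (3/4)" unfolding powr_diff[symmetric] by simp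
    finally show ?thesis by (simp add: Psi_def)
  qed
  also have "\<dots> \<le> (x powr (1/4) / y) powr (-2/3) * real (Psi x y)"
    using assms by (intro Psi_divide_le) (auto intro: ge_one_powr_ge_zero)
  finally show ?thesis by (simp add: algebra_simps)
qed

context mean_value_system
begin

text \<open>The choice of \<open>z\<close> as the 16th root of \<open>x\<close> makes the loss from square divisors \<open>2\<close> to the power \<open>u/4\<close>, against a
gain of \<open>2\<close> to the power \<open>-3u/4\<close>. What remains is numerical: every term is written as an exponential in
\<open>q = log log x\<close>, \<open>Y = log y\<close> and \<open>u\<close>, and compared with \<open>exp(-u/16)\<close> using \<open>u \<ge> 32 q\<close> and \<open>Y \<ge> 6 q\<close>.\<close>

theorem mean_smooth_large:
  fixes x y :: real
  assumes N: "N = nat \<lfloor>x\<rfloor>" and adm: "admissible_range x y" and big: "2 \<le> ln (ln x)"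
  shows "(\<integral>w. cmod (dpoly (smooth_numbers x y) (\<lambda>_. 1) w) \<partial>M)
    \<le> 46 * C * sqrt (real (Psi x y) * exp (- (ln x / ln y) / 16))"
proof -
  note a = admissible_rangeD[OF adm]
  define L Y q u where "L = ln x" and "Y = ln y" and "q = ln (ln x)" and "u = ln x / ln y"
  define P where "P = real (Psi x y)"
  have x1: "1 \<le> x" "0 < x" "0 < y" using a by auto
  have L: "L = exp q" "0 < L" using a by (auto simp: L_def q_def)
  have Y: "0 < Y" "6 * q \<le> Y" using a by (auto simp: Y_def q_def)
  have q: "2 \<le> q" using big by (simp add: q_def)
  have u: "32 * q \<le> u" "L = u * Y" using a Y by (auto simp: q_def u_def L_def Y_def)
  have u64: "64 \<le> u" using u q by linarith
  have "1 + 2 \<le> exp (2::real)" by (rule exp_ge_add_one_self)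
  also have "\<dots> \<le> L" unfolding L using q by simp
  finally have L3: "3 \<le> L" by simp
  have H: "ln x / ln 2 \<le> y powr (-2/3) * real (card {p::nat. prime p \<and> real p \<le> y})"
    by (rule decay_condition[OF adm big])
  have P0: "0 \<le> P" by (simp add: P_def)
  have ln2: "2/3 \<le> ln (2::real)" "ln (2::real) \<le> 1" "0 < ln (2::real)"
    using ln2_ge_two_thirds ln_le_minus_one[of 2] by auto

  \<comment> \<open>The bit length \<open>l\<close> of \<open>N + 1\<close> is \<open>O(log x)\<close>.\<close>
  obtain i where i: "2 ^ i \<le> N + 1" "N + 1 < 2 ^ (i + 1)"
    using ex_power_ivl1[of 2 "N + 1"] by auto
  define l where "l = i + 1"
  have "real (2 ^ i) \<le> real (N + 1)" using i by (simp only: of_nat_le_iff)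
  also have "\<dots> \<le> 2 * x" using N x1 by linarith
  finally have "ln (2 ^ i) \<le> ln (2 * x)" using x1 by simp
  then have "real i * ln 2 \<le> ln 2 + L" using x1 by (simp add: ln_realpow ln_mult L_def)
  then have "(real i - 1) * ln 2 \<le> L" by (simp add: algebra_simps)
  moreover have "(real i - 1) * (2/3) \<le> max 0 ((real i - 1) * ln 2)"
    using mult_left_mono[OF ln2(1), of "real i - 1"] by (cases "1 \<le> real i") auto
  ultimately have "(real i - 1) * (2/3) \<le> L" using L by linarith
  then have l: "real l \<le> 3 * L" "N + 1 < 2 ^ l" using i L3 by (auto simp: l_def)

  define z \<theta> where "z = x powr (1/16)" and "\<theta> = ln 2 / ln y"
  have \<theta>: "0 \<le> \<theta>" "L * \<theta> = u * ln 2" using ln2 a by (auto simp: \<theta>_def L_def u_def)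
  have z1: "1 \<le> z" unfolding z_def using x1 by (intro ge_one_powr_ge_zero) auto
  have lnxy: "ln x = u * Y" "ln y = Y" using u(2) by (simp_all add: L_def Y_def)
  have E1: "(z powr (2 * \<theta>))\<^sup>2 = exp (u * ln 2 / 4)"
  proof -
    have "(z powr (2 * \<theta>))\<^sup>2 = x powr (1/16 * (2 * \<theta>) * 2)"
      using x1 by (simp add: z_def powr_powr flip: powr_numeral)
    also have "\<dots> = exp (L * \<theta> / 4)" using x1 by (simp add: powr_def L_def)
    finally show ?thesis by (simp add: \<theta>)
  qed
  have E2: "x powr (-3/4 * \<theta>) = exp (- 3/4 * (u * ln 2))"
    using x1 by (simp add: powr_def \<theta>(2)[symmetric] L_def)
  have E3: "(x powr (1/4) / y) powr (-2/3) = exp (2/3 * Y - u * Y / 6)"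
    using x1 by (simp add: powr_def ln_div lnxy field_simps)
  have E4: "y powr (2/3) * z powr (-1/3) = exp (2/3 * Y - u * Y / 48)"
    using x1 by (simp add: powr_def z_def lnxy exp_add[symmetric] field_simps)
  have uY: "2/3 * Y \<le> u * Y / 96" "12 * u \<le> u * Y" "6 * u * q \<le> u * Y"
    using mult_right_mono[OF u64, of Y] mult_left_mono[of 12 Y u] mult_left_mono[OF Y(2), of u] Y u64 q
    by auto

  let ?W = "\<Sum>n\<in>smooth_numbers (2 * x) y. real n powr (- \<theta>)"
  have "L ^ 4 * ((z powr (2 * \<theta>))\<^sup>2 * ?W) \<le> L ^ 4 * ((z powr (2 * \<theta>))\<^sup>2 *
      ((x powr (-3/4 * \<theta>) * (3 + 18 * L\<^sup>2) + (x powr (1/4) / y) powr (-2/3)) * P))"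
    unfolding L_def P_def using a x1 \<theta> H by (intro mult_left_mono sum_smooth_powr_le) auto
  also have "\<dots> \<le> L ^ 4 * ((z powr (2 * \<theta>))\<^sup>2 *
      ((x powr (-3/4 * \<theta>) * (21 * L\<^sup>2) + (x powr (1/4) / y) powr (-2/3)) * P))"
  proof -
    have "1 \<le> L\<^sup>2" using L3 by (intro one_le_power) auto
    then show ?thesis using P0 L by (intro mult_left_mono mult_right_mono add_right_mono) auto
  qed
  also have "\<dots> = 21 * (exp (6 * q + u * ln 2 / 4 - 3/4 * (u * ln 2))) * P
      + exp (4 * q + u * ln 2 / 4 + (2/3 * Y - u * Y / 6)) * P"
    unfolding E1 E2 E3 L
    by (simp add: exp_add exp_diff exp_minus algebra_simps power2_eq_square exp_of_nat_mult[symmetric] flip: exp_of_nat_mult)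
       (simp flip: exp_add add: field_simps)
  also have "\<dots> \<le> 21 * exp (- u / 16) * P + exp (- u / 16) * P"
  proof (intro add_mono mult_right_mono mult_left_mono P0)
    have uln2: "u * (2/3) \<le> u * ln 2" "u * ln 2 \<le> u * 1" using ln2 u64 by (intro mult_left_mono; simp)+
    then show "exp (6 * q + u * ln 2 / 4 - 3/4 * (u * ln 2)) \<le> exp (- u / 16)"
        "exp (4 * q + u * ln 2 / 4 + (2/3 * Y - u * Y / 6)) \<le> exp (- u / 16)"
      unfolding exp_le_cancel_iff using uln2 u(1) uY(1,2) u64 by linarith+
  qed simp
  finally have T1: "L ^ 4 * ((z powr (2 * \<theta>))\<^sup>2 * ?W) \<le> 22 * (exp (- u / 16) * P)" by (simp add: mult_ac)

  let ?Bad = "card {n \<in> smooth_numbers x y. \<exists>s. s\<^sup>2 dvd n \<and> z < real s}"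
  have "real ?Bad \<le> y powr (2/3) * z powr (-1/3) * (L + 1) * P"
    unfolding L_def P_def using a x1 z1 H by (intro card_large_square_le) auto
  also have "\<dots> \<le> exp (2/3 * Y - u * Y / 48) * L\<^sup>2 * P"
  proof -
    have "L + 1 \<le> L * 3" using L3 by simp
    also have "\<dots> \<le> L * L" using L3 by (intro mult_left_mono) auto
    finally show ?thesis unfolding E4 using P0
      by (intro mult_right_mono mult_left_mono) (auto simp: power2_eq_square)
  qed
  also have "\<dots> = exp (2 * q + 2/3 * Y - u * Y / 48) * P"
    unfolding L power2_eq_square by (simp flip: exp_add)
  also have "\<dots> \<le> exp (- u / 16) * P"
  proof (intro mult_right_mono P0)
    have "32 * q * (q - 1) \<le> u * (q - 1)" using u q by (intro mult_right_mono) auto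
    moreover have "32 * q * 1 \<le> 32 * q * (q - 1)" using q by (intro mult_left_mono) auto
    ultimately have "32 * q + u \<le> u * q" by (simp add: algebra_simps)
    then show "exp (2 * q + 2/3 * Y - u * Y / 48) \<le> exp (- u / 16)" using uY by simp
  qed
  finally have T2: "real ?Bad \<le> exp (- u / 16) * P" .

  let ?e = "sqrt (exp (- u / 16) * P)"
  have "(\<integral>w. cmod (dpoly (smooth_numbers x y) (\<lambda>_. 1) w) \<partial>M) \<le>
      (real l)\<^sup>2 * C * sqrt ((z powr (2 * \<theta>))\<^sup>2 * ?W) + C * sqrt (real ?Bad)"
    unfolding \<theta>_def using N x1 a z1 l by (intro mean_smooth_le) auto
  also have "\<dots> \<le> (3 * L)\<^sup>2 * C * sqrt ((z powr (2 * \<theta>))\<^sup>2 * ?W) + C * ?e"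
    using l T2 C_nonneg
    by (intro add_mono mult_right_mono mult_left_mono power_mono real_sqrt_le_mono)
      (auto intro!: mult_nonneg_nonneg sum_nonneg)
  also have "(3 * L)\<^sup>2 * C * sqrt ((z powr (2 * \<theta>))\<^sup>2 * ?W) = 9 * C * sqrt (L ^ 4 * ((z powr (2 * \<theta>))\<^sup>2 * ?W))"
  proof -
    have "sqrt (L ^ 4) = L\<^sup>2" using L by (intro real_sqrt_unique) (auto simp flip: power_mult)
    then show ?thesis by (simp add: real_sqrt_mult power_mult_distrib)
  qed
  also have "\<dots> \<le> 9 * C * (sqrt 22 * ?e)"
    using T1 C_nonneg unfolding real_sqrt_mult[symmetric] by (intro mult_left_mono real_sqrt_le_mono) auto
  finally have "(\<integral>w. cmod (dpoly (smooth_numbers x y) (\<lambda>_. 1) w) \<partial>M) \<le> (9 * sqrt 22 + 1) * (C * ?e)"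
    by (simp add: algebra_simps)
  also have "\<dots> \<le> 46 * (C * ?e)"
    using C_nonneg P0 by (intro mult_right_mono) (auto intro: real_le_lsqrt)
  finally show ?thesis by (simp add: P_def u_def mult_ac)
qed

text \<open>For bounded \<open>x\<close> both \<open>u\<close> and \<open>1 / S\<close> are bounded, and the trivial estimate suffices.\<close>

theorem mean_smooth_bound:
  fixes x y T :: real
  assumes N: "N = nat \<lfloor>x\<rfloor>" and adm: "admissible_range x y" and T: "x \<le> T"
  shows "(\<integral>w. cmod (dpoly (smooth_numbers x y) (\<lambda>_. 1) w) \<partial>M)
    \<le> 46 * C * sqrt (real (Psi x y) * S_bound x y T)"
proof -
  note a = admissible_rangeD[OF adm]
  define u where "u = ln x / ln y"
  have S: "ln x powr (3/2) * ln y powr (1/2) * exp (- u / 16) \<le> S_bound x y T"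
    unfolding u_def using a T by (intro S_bound_ge) auto
  have L1: "1 \<le> ln x powr (3/2)" using a by (intro ge_one_powr_ge_zero) auto
  have P0: "0 \<le> real (Psi x y)" by simp
  show ?thesis
  proof (cases "2 \<le> ln (ln x)")
    case True
    have "1 * 1 * exp (- u / 16) \<le> ln x powr (3/2) * ln y powr (1/2) * exp (- u / 16)"
      using L1 a True by (intro mult_right_mono mult_mono ge_one_powr_ge_zero) auto
    then have "exp (- u / 16) \<le> S_bound x y T" using S by linarith
    then have "46 * C * sqrt (real (Psi x y) * exp (- u / 16)) \<le> 46 * C * sqrt (real (Psi x y) * S_bound x y T)"
      using C_nonneg by (intro mult_left_mono real_sqrt_le_mono) auto
    then show ?thesis using mean_smooth_large[OF N adm True, folded u_def] by linarith
  next
    case False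
    have y: "2/3 \<le> ln y" using a ln2_ge_two_thirds ln_mono[of 2 y] by linarith
    have "ln x = exp (ln (ln x))" using a by simp
    also have "\<dots> \<le> exp 2" unfolding exp_le_cancel_iff using False by simp
    also have "\<dots> = exp 1 * exp (1::real)" by (simp flip: exp_add)
    also have "\<dots> \<le> 3 * 3" using exp_le by (intro mult_mono) auto
    finally have "u \<le> 9 / (2/3)" unfolding u_def using y a by (intro frac_le) auto
    also have "9 / (2/3) = (27/2 :: real)" by simp
    finally have "exp (-1) \<le> exp (- u / 16)" unfolding exp_le_cancel_iff by linarith
    moreover have "1/3 \<le> exp (-1::real)" using exp_le by (simp add: exp_minus field_simps)
    ultimately have e: "1/3 \<le> exp (- u / 16)" by linarith
    have "1/2 = (1/4) powr (1/2 :: real)" by (simp add: powr_half_sqrt real_sqrt_divide)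
    also have "\<dots> \<le> ln y powr (1/2)" using y by (intro powr_mono2) auto
    finally have "1 * (1/2) * (1/3) \<le> ln x powr (3/2) * ln y powr (1/2) * exp (- u / 16)"
      using L1 e by (intro mult_mono) auto
    then have S6: "1 \<le> 6 * S_bound x y T" using S by simp
    have "real (Psi x y) * 1 \<le> real (Psi x y) * (46\<^sup>2 * S_bound x y T)"
      using S6 by (intro mult_left_mono) auto
    then have "sqrt (real (Psi x y)) \<le> sqrt (46\<^sup>2 * (real (Psi x y) * S_bound x y T))"
      by (intro real_sqrt_le_mono) (simp add: mult_ac)
    also have "\<dots> = 46 * sqrt (real (Psi x y) * S_bound x y T)" by (simp add: real_sqrt_mult)
    finally have "C * sqrt (real (Psi x y)) \<le> C * (46 * sqrt (real (Psi x y) * S_bound x y T))"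
      using C_nonneg by (intro mult_left_mono)
    then show ?thesis using mean_smooth_trivial[OF N, of y] by simp
  qed
qed

end

section \<open>The mean value inequality in t-aspect\<close>

lemma sum_inverse_squares_le:
  "(\<Sum>k\<in>{1..n}. 1 / (real k)\<^sup>2) \<le> 2"
proof -
  have "(\<Sum>k\<in>{1..n}. 1 / (real k)\<^sup>2) \<le> 2 - 1 / real n" if "0 < n" for n
    using that
  proof (induction n)
    case (Suc n)
    show ?case
    proof (cases "n = 0")
      case False
      have "1 / (real (Suc n))\<^sup>2 \<le> 1 / real n - 1 / real (Suc n)"
      proof -
        have "1 / (real (Suc n))\<^sup>2 \<le> 1 / (real n * real (Suc n))"
          using False by (intro divide_left_mono) (auto simp: power2_eq_square)
        also have "\<dots> = 1 / real n - 1 / real (Suc n)"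
          using False by (simp add: field_simps)
        finally show ?thesis .
      qed
      then show ?thesis using Suc.IH False by simp
    qed simp
  qed simp
  moreover have "2 - 1 / real n \<le> 2" by simp
  ultimately show ?thesis by (cases "n = 0") (simp, metis bot_nat_0.not_eq_extremum order_trans)
qed

lemma sum_inverse_square_differences_le:
  assumes "m \<in> {1..N}"
  shows "(\<Sum>n\<in>{1..N}. if n = m then 0 else 1 / (real m - real n)\<^sup>2) \<le> 4"
proof -
  let ?f = "\<lambda>n. 1 / (real m - real n)\<^sup>2"
  have "(\<Sum>n\<in>{1..N}. if n = m then 0 else ?f n) = (\<Sum>n\<in>{1..N} - {m}. ?f n)"
    using assms by (subst sum.remove[of _ m]) (auto intro!: sum.cong)
  also have "\<dots> = (\<Sum>n\<in>{1..<m}. ?f n) + (\<Sum>n\<in>{m<..N}. ?f n)"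
    using assms by (subst sum.union_disjoint[symmetric]) (auto intro!: sum.cong)
  also have "(\<Sum>n\<in>{1..<m}. ?f n) = (\<Sum>k\<in>{1..m - 1}. 1 / (real k)\<^sup>2)"
    by (rule sum.reindex_bij_witness[of _ "\<lambda>k. m - k" "\<lambda>n. m - n"]) auto
  also have "(\<Sum>n\<in>{m<..N}. ?f n) = (\<Sum>k\<in>{1..N - m}. 1 / (real k)\<^sup>2)"
    by (rule sum.reindex_bij_witness[of _ "\<lambda>k. m + k" "\<lambda>n. n - m"])
      (auto simp: power2_commute)
  finally show ?thesis
    using sum_inverse_squares_le[of "m - 1"] sum_inverse_squares_le[of "N - m"] by linarith
qed

text \<open>Schur's test.\<close>

lemma sum_bilinear_symmetric_le:
  fixes c :: "'a \<Rightarrow> real" and k :: "'a \<Rightarrow> 'a \<Rightarrow> real"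
  assumes "\<And>m n. 0 \<le> k m n" "\<And>m n. k m n = k n m"
    and row: "\<And>m. m \<in> A \<Longrightarrow> (\<Sum>n\<in>A. k m n) \<le> B"
  shows "(\<Sum>m\<in>A. \<Sum>n\<in>A. c m * c n * k m n) \<le> B * (\<Sum>n\<in>A. (c n)\<^sup>2)"
proof -
  have "(\<Sum>m\<in>A. \<Sum>n\<in>A. c m * c n * k m n) \<le> (\<Sum>m\<in>A. \<Sum>n\<in>A. ((c m)\<^sup>2 * k m n + (c n)\<^sup>2 * k n m) / 2)"
  proof (intro sum_mono)
    fix m n
    have "c m * c n \<le> ((c m)\<^sup>2 + (c n)\<^sup>2) / 2"
      using sum_squares_bound[of "c m" "c n"] by simp
    then have "c m * c n * k m n \<le> ((c m)\<^sup>2 + (c n)\<^sup>2) / 2 * k m n"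
      using assms(1) by (intro mult_right_mono)
    then show "c m * c n * k m n \<le> ((c m)\<^sup>2 * k m n + (c n)\<^sup>2 * k n m) / 2"
      using assms(2)[of m n] by (simp add: algebra_simps add_divide_distrib)
  qed
  also have "\<dots> = ((\<Sum>m\<in>A. \<Sum>n\<in>A. (c m)\<^sup>2 * k m n) + (\<Sum>m\<in>A. \<Sum>n\<in>A. (c n)\<^sup>2 * k n m)) / 2"
    by (simp add: sum.distrib sum_divide_distrib add_divide_distrib)
  also have "(\<Sum>m\<in>A. \<Sum>n\<in>A. (c n)\<^sup>2 * k n m) = (\<Sum>m\<in>A. \<Sum>n\<in>A. (c m)\<^sup>2 * k m n)"
    by (rule sum.swap)
  also have "((\<Sum>m\<in>A. \<Sum>n\<in>A. (c m)\<^sup>2 * k m n) + (\<Sum>m\<in>A. \<Sum>n\<in>A. (c m)\<^sup>2 * k m n)) / 2 =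
      (\<Sum>m\<in>A. \<Sum>n\<in>A. (c m)\<^sup>2 * k m n)"
    by simp
  also have "\<dots> = (\<Sum>m\<in>A. (c m)\<^sup>2 * (\<Sum>n\<in>A. k m n))"
    by (simp add: sum_distrib_left)
  also have "\<dots> \<le> (\<Sum>m\<in>A. (c m)\<^sup>2 * B)"
    using row by (intro sum_mono mult_left_mono) auto
  finally show ?thesis by (simp add: sum_distrib_left mult.commute)
qed

text \<open>A majorant of the indicator function of \<open>[T, 2T]\<close>, used on \<open>[T/2, 5T/2]\<close>. It vanishes
to second order at both ends of that interval, which makes its Fourier transform decay at least quadratically.\<close>

definition bump :: "real \<Rightarrow> real \<Rightarrow> real" where
  "bump T t = 1 + cos (pi * (t - 3 * T / 2) / T)"

lemma bump_nonneg: "0 \<le> bump T t"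
  unfolding bump_def using cos_ge_minus_one[of "pi * (t - 3 * T / 2) / T"] by linarith

lemma bump_le: "bump T t \<le> 2"
  unfolding bump_def using cos_le_one[of "pi * (t - 3 * T / 2) / T"] by linarith

lemma bump_ge_one:
  assumes "0 < T" "T \<le> t" "t \<le> 2 * T"
  shows "1 \<le> bump T t"
proof -
  have "(t - 3 * T / 2) / T \<le> 1/2" "- 1/2 \<le> (t - 3 * T / 2) / T"
    using assms by (simp_all add: field_simps)
  then have "pi * ((t - 3 * T / 2) / T) \<le> pi * (1/2)" "pi * (- 1/2) \<le> pi * ((t - 3 * T / 2) / T)"
    using pi_ge_zero by (intro mult_left_mono; simp)+
  then have "0 \<le> cos (pi * (t - 3 * T / 2) / T)"
    by (intro cos_ge_zero) (simp_all add: mult.commute)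
  then show ?thesis by (simp add: bump_def)
qed

lemma continuous_on_bump [continuous_intros]: "continuous_on A (bump T)"
  unfolding bump_def by (cases "T = 0") (auto intro!: continuous_intros)

text \<open>The second bound is two integrations by parts, whose boundary terms vanish. They are carried out at once by exhibiting the
antiderivative \<open>G\<close> of the integrand minus \<open>r\<close>, where \<open>r\<close> is what the second integration leaves.\<close>

lemma norm_integral_bump_cis_le:
  fixes T \<nu> :: real
  assumes T: "0 < T"
  shows "cmod (integral {T/2..5*T/2} (\<lambda>t. bump T t * cis (\<nu> * t))) \<le> 4 * T"
    and "\<nu> \<noteq> 0 \<Longrightarrow> cmod (integral {T/2..5*T/2} (\<lambda>t. bump T t * cis (\<nu> * t))) \<le> 20 / (T * \<nu>\<^sup>2)"
proof -
  have le: "T/2 \<le> 5*T/2" using T by simp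
  have cont: "continuous_on {T/2..5*T/2} (\<lambda>t. bump T t * cis (\<nu> * t))"
    by (intro continuous_intros)
  have "cmod (integral {T/2..5*T/2} (\<lambda>t. bump T t * cis (\<nu> * t))) \<le> 2 * (5*T/2 - T/2)"
    using bump_nonneg bump_le by (intro integral_bound le cont) (auto simp: norm_mult)
  then show "cmod (integral {T/2..5*T/2} (\<lambda>t. bump T t * cis (\<nu> * t))) \<le> 4 * T" by simp
  assume \<nu>: "\<nu> \<noteq> 0"
  define \<mu> c where "\<mu> = pi / T" and "c = 3 * T / 2"
  define M L :: complex where "M = of_real \<mu>" and "L = of_real \<nu>"
  define D where "D z = M * (z - of_real c)" for z :: complex
  define k1 k2 where "k1 = 1 / (\<i> * L)" and "k2 = M / L\<^sup>2"
  define G where "G z = ((1 + cos (D z)) * k1 - k2 * sin (D z)) * exp (\<i> * L * z)" for z :: complex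
  define r where "r t = (\<mu>\<^sup>2 / \<nu>\<^sup>2) * cos (\<mu> * (t - c)) * cis (\<nu> * t)" for t :: real
  have L0: "L \<noteq> 0" using \<nu> by (simp add: L_def)
  have D: "D (of_real t) = of_real (\<mu> * (t - c))" for t by (simp add: D_def M_def)
  have ends: "G (of_real (T/2)) = 0" "G (of_real (5*T/2)) = 0"
  proof -
    have "\<mu> * (T/2 - c) = - pi" "\<mu> * (5*T/2 - c) = pi"
      using T by (simp_all add: \<mu>_def c_def field_simps)
    then have "D (of_real (T/2)) = of_real (- pi)" "D (of_real (5*T/2)) = of_real pi"
      unfolding D by simp_all
    then show "G (of_real (T/2)) = 0" "G (of_real (5*T/2)) = 0"
      unfolding G_def by (simp_all only: cos_of_real sin_of_real) simp_all
  qed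
  have "((\<lambda>t. bump T t * cis (\<nu> * t) - r t) has_integral (G (of_real (5*T/2)) - G (of_real (T/2)))) {T/2..5*T/2}"
  proof (rule fundamental_theorem_of_calculus[OF le])
    fix t :: real
    let ?z = "complex_of_real t"
    have "(D has_field_derivative M) (at z)" for z
      unfolding D_def by (auto intro!: derivative_eq_intros)
    then have "(G has_field_derivative
        ((- sin (D ?z) * M) * k1 - k2 * (cos (D ?z) * M)) * exp (\<i> * L * ?z)
        + ((1 + cos (D ?z)) * k1 - k2 * sin (D ?z)) * (exp (\<i> * L * ?z) * (\<i> * L)))
        (at ?z)"
      unfolding G_def by (auto intro!: derivative_eq_intros)
    also have "((- sin (D ?z) * M) * k1 - k2 * (cos (D ?z) * M)) * exp (\<i> * L * ?z)
        + ((1 + cos (D ?z)) * k1 - k2 * sin (D ?z)) * (exp (\<i> * L * ?z) * (\<i> * L))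
        = (1 + cos (D ?z) - (M\<^sup>2 / L\<^sup>2) * cos (D ?z)) * exp (\<i> * L * ?z)"
    proof -
      have eqs: "k1 * (\<i> * L) = 1" "k2 * (\<i> * L) = - (M * k1)" "M\<^sup>2 / L\<^sup>2 = k2 * M"
        using L0 by (simp_all add: k1_def k2_def field_simps power2_eq_square)
      have "((- S * M) * k1 - k2 * (C * M)) * E + ((1 + C) * k1 - k2 * S) * (E * (\<i> * L)) =
          (1 + C - k2 * M * C) * E" for S C E
      proof -
        have "((- S * M) * k1 - k2 * (C * M)) * E + ((1 + C) * k1 - k2 * S) * (E * (\<i> * L)) =
            (- S * M * k1 - k2 * C * M + (1 + C) * (k1 * (\<i> * L)) - (k2 * (\<i> * L)) * S) * E"
          by (simp add: algebra_simps)
        then show ?thesis unfolding eqs(1,2) by (simp add: algebra_simps)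
      qed
      then show ?thesis unfolding eqs(3) .
    qed
    also have "\<dots> = bump T t * cis (\<nu> * t) - r t"
    proof -
      have "bump T t = 1 + cos (\<mu> * (t - c))" by (simp add: bump_def \<mu>_def c_def)
      then show ?thesis unfolding D cos_of_real r_def
        by (simp add: cis_conv_exp M_def L_def algebra_simps)
    qed
    finally have "(G has_field_derivative (bump T t * cis (\<nu> * t) - r t)) (at ?z)" .
    then show "((\<lambda>t. G (of_real t)) has_vector_derivative (bump T t * cis (\<nu> * t) - r t)) (at t within {T/2..5*T/2})"
      by (rule has_vector_derivative_real_field)
  qed
  then have I0: "integral {T/2..5*T/2} (\<lambda>t. bump T t * cis (\<nu> * t) - r t) = 0"
    unfolding ends by (simp add: integral_unique)
  have contr: "continuous_on {T/2..5*T/2} r" unfolding r_def by (intro continuous_intros)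
  have "integral {T/2..5*T/2} (\<lambda>t. bump T t * cis (\<nu> * t)) = integral {T/2..5*T/2} r"
    using I0 cont contr by (subst (asm) integral_diff) (auto intro!: integrable_continuous_interval)
  also have "cmod \<dots> \<le> (\<mu>\<^sup>2 / \<nu>\<^sup>2) * (5*T/2 - T/2)"
    by (intro integral_bound le contr) (auto simp: r_def norm_mult norm_divide norm_power intro!: divide_right_mono mult_left_le)
  also have "\<dots> = 2 * pi\<^sup>2 / (T * \<nu>\<^sup>2)"
    using T \<nu> by (simp add: \<mu>_def field_simps power2_eq_square)
  also have "\<dots> \<le> 20 / (T * \<nu>\<^sup>2)"
  proof (intro divide_right_mono)
    have "pi \<le> 3.15" using pi_less_4 pi_approx by simp
    then have "pi\<^sup>2 \<le> 3.15\<^sup>2" by (intro power_mono) auto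
    then show "2 * pi\<^sup>2 \<le> 20" by (simp add: power2_eq_square)
  qed (use T in auto)
  finally show "cmod (integral {T/2..5*T/2} (\<lambda>t. bump T t * cis (\<nu> * t))) \<le> 20 / (T * \<nu>\<^sup>2)" .
qed

lemma nat_powr_i_times:
  assumes "0 < n"
  shows "of_nat n powr (\<i> * of_real t) = cis (ln (real n) * t)"
proof -
  have "Ln (complex_of_nat n) = of_real (ln (real n))"
    using assms by (metis Ln_of_real of_nat_0_less_iff of_real_of_nat_eq)
  then show ?thesis using assms by (simp add: powr_def cis_conv_exp mult_ac)
qed

lemma abs_diff_ln_ge:
  assumes "0 < m" "0 < n" "m \<le> N" "n \<le> N"
  shows "\<bar>real m - real n\<bar> / real N \<le> \<bar>ln (real m) - ln (real n)\<bar>"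
proof -
  have *: "(real b - real a) / real N \<le> ln (real b) - ln (real a)"
    if "0 < a" "a \<le> b" "b \<le> N" for a b
  proof -
    have "(real b - real a) / real N \<le> (real b - real a) / real b"
      using that by (intro divide_left_mono) auto
    also have "\<dots> = 1 - real a / real b" using that by (simp add: field_simps)
    also have "\<dots> \<le> - ln (real a / real b)" using ln_le_minus_one[of "real a / real b"] that by simp
    also have "\<dots> = ln (real b) - ln (real a)" using that by (simp add: ln_div)
    finally show ?thesis .
  qed
  show ?thesis
  proof (cases "m \<le> n")
    case True
    then show ?thesis using *[of m n] assms by (simp add: abs_minus_commute)
  next
    case False
    then show ?thesis using *[of n m] assms by simp
  qed
qed

text \<open>After expanding the square, the off-diagonal term \<open>(m, n)\<close> is a Fourier coefficient at
\<open>log m - log n\<close>, a difference of size at least \<open>|m - n| / N\<close>. For \<open>N \<le> T\<close> it is thus \<open>O(T / (m - n)\<^sup>2)\<close>, which is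
summable.\<close>

theorem mean_value_powr_i:
  fixes a :: "nat \<Rightarrow> complex"
  assumes T: "0 < T" and N: "real N \<le> T"
  shows "integral {T..2*T} (\<lambda>t. (cmod (\<Sum>n\<in>{1..N}. a n * of_nat n powr (\<i> * of_real t)))\<^sup>2)
    \<le> 84 * T * (\<Sum>n\<in>{1..N}. (cmod (a n))\<^sup>2)"
proof -
  define F where "F t = (\<Sum>n\<in>{1..N}. a n * cis (ln (real n) * t))" for t
  have F: "(\<Sum>n\<in>{1..N}. a n * of_nat n powr (\<i> * of_real t)) = F t" for t
    unfolding F_def by (intro sum.cong) (simp_all add: nat_powr_i_times)
  have contF: "continuous_on A F" for A unfolding F_def by (intro continuous_intros)
  define I where "I \<nu> = integral {T/2..5*T/2} (\<lambda>t. bump T t * cis (\<nu> * t))" for \<nu>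
  have sq: "complex_of_real (bump T t * (cmod (F t))\<^sup>2) =
      (\<Sum>m\<in>{1..N}. \<Sum>n\<in>{1..N}. (a m * cnj (a n)) * (bump T t * cis ((ln (real m) - ln (real n)) * t)))" for t
  proof -
    have "complex_of_real ((cmod (F t))\<^sup>2) = F t * cnj (F t)" by (rule complex_norm_square)
    also have "\<dots> = (\<Sum>m\<in>{1..N}. \<Sum>n\<in>{1..N}. (a m * cis (ln (real m) * t)) * (cnj (a n) * cis (- (ln (real n) * t))))"
      unfolding F_def by (simp add: sum_product cis_cnj)
    also have "\<dots> = (\<Sum>m\<in>{1..N}. \<Sum>n\<in>{1..N}. (a m * cnj (a n)) * cis ((ln (real m) - ln (real n)) * t))"
    proof (intro sum.cong refl)
      fix m n
      have "cis ((ln (real m) - ln (real n)) * t) = cis (ln (real m) * t) * cis (- (ln (real n) * t))"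
        by (simp add: cis_mult left_diff_distrib)
      then show "(a m * cis (ln (real m) * t)) * (cnj (a n) * cis (- (ln (real n) * t))) =
          (a m * cnj (a n)) * cis ((ln (real m) - ln (real n)) * t)"
        by simp
    qed
    finally show ?thesis by (simp add: sum_distrib_left mult_ac)
  qed
  have int: "(\<lambda>t. bump T t * cis (\<nu> * t)) integrable_on {T/2..5*T/2}" for \<nu>
    by (intro integrable_continuous_interval continuous_intros)
  have "integral {T/2..5*T/2} (\<lambda>t. complex_of_real (bump T t * (cmod (F t))\<^sup>2)) =
      (\<Sum>m\<in>{1..N}. \<Sum>n\<in>{1..N}. (a m * cnj (a n)) * I (ln (real m) - ln (real n)))"
    unfolding sq I_def
    by (simp add: integral_sum integrable_sum integrable_on_mult_right int del: of_real_mult)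
  also have "cmod \<dots> \<le> (\<Sum>m\<in>{1..N}. \<Sum>n\<in>{1..N}. cmod (a m) * cmod (a n) *
      (if n = m then 4 * T else 20 * T * (1 / (real m - real n)\<^sup>2)))"
  proof (rule order_trans[OF norm_sum], intro sum_mono, rule order_trans[OF norm_sum], intro sum_mono)
    fix m n assume mn: "m \<in> {1..N}" "n \<in> {1..N}"
    have "cmod (I (ln (real m) - ln (real n))) \<le> (if n = m then 4 * T else 20 * T * (1 / (real m - real n)\<^sup>2))"
    proof (cases "n = m")
      case True
      then show ?thesis unfolding I_def using norm_integral_bump_cis_le(1)[OF T, of 0] by simp
    next
      case False
      let ?\<nu> = "ln (real m) - ln (real n)"
      have "?\<nu> \<noteq> 0" using mn False by simp
      then have "cmod (I ?\<nu>) \<le> 20 / (T * ?\<nu>\<^sup>2)"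
        unfolding I_def by (rule norm_integral_bump_cis_le(2)[OF T])
      also have "\<dots> \<le> 20 / (T * (\<bar>real m - real n\<bar> / T)\<^sup>2)"
      proof (intro divide_left_mono mult_left_mono)
        have "\<bar>real m - real n\<bar> / T \<le> \<bar>real m - real n\<bar> / real N"
          using mn N T by (intro divide_left_mono) auto
        also have "\<dots> \<le> \<bar>?\<nu>\<bar>" using mn by (intro abs_diff_ln_ge) auto
        finally have "(\<bar>real m - real n\<bar> / T)\<^sup>2 \<le> \<bar>?\<nu>\<bar>\<^sup>2"
          using T by (intro power_mono) auto
        then show "(\<bar>real m - real n\<bar> / T)\<^sup>2 \<le> ?\<nu>\<^sup>2" by simp
      qed (use T False \<open>?\<nu> \<noteq> 0\<close> in auto)
      also have "\<dots> = 20 * T * (1 / (real m - real n)\<^sup>2)"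
        using T by (simp add: power_divide power2_eq_square)
      finally show ?thesis using False by simp
    qed
    then show "cmod ((a m * cnj (a n)) * I (ln (real m) - ln (real n))) \<le> cmod (a m) * cmod (a n) *
      (if n = m then 4 * T else 20 * T * (1 / (real m - real n)\<^sup>2))"
      by (simp add: norm_mult mult_left_mono)
  qed
  also have "\<dots> \<le> 84 * T * (\<Sum>n\<in>{1..N}. (cmod (a n))\<^sup>2)"
  proof (rule sum_bilinear_symmetric_le)
    fix m assume m: "m \<in> {1..N}"
    have "(\<Sum>n\<in>{1..N}. if n = m then 4 * T else 20 * T * (1 / (real m - real n)\<^sup>2)) =
        (\<Sum>n\<in>{1..N}. if n = m then 4 * T else 0) +
        (\<Sum>n\<in>{1..N}. 20 * T * (if n = m then 0 else 1 / (real m - real n)\<^sup>2))"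
      unfolding sum.distrib[symmetric] by (intro sum.cong) auto
    also have "\<dots> = 4 * T + 20 * T * (\<Sum>n\<in>{1..N}. if n = m then 0 else 1 / (real m - real n)\<^sup>2)"
      using m by (simp add: sum_distrib_left)
    also have "\<dots> \<le> 4 * T + 20 * T * 4"
      using T m by (intro add_left_mono mult_left_mono sum_inverse_square_differences_le) auto
    finally show "(\<Sum>n\<in>{1..N}. if n = m then 4 * T else 20 * T * (1 / (real m - real n)\<^sup>2)) \<le> 84 * T" by simp
  qed (use T in \<open>auto simp: power2_commute\<close>)
  finally have bound: "cmod (integral {T/2..5*T/2} (\<lambda>t. complex_of_real (bump T t * (cmod (F t))\<^sup>2)))
      \<le> 84 * T * (\<Sum>n\<in>{1..N}. (cmod (a n))\<^sup>2)" .
  have intw: "(\<lambda>t. bump T t * (cmod (F t))\<^sup>2) integrable_on {A..B}" for A B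
    by (intro integrable_continuous_interval continuous_intros contF)
  have "integral {T..2*T} (\<lambda>t. (cmod (F t))\<^sup>2) \<le> integral {T..2*T} (\<lambda>t. bump T t * (cmod (F t))\<^sup>2)"
  proof (intro integral_le intw)
    show "(\<lambda>t. (cmod (F t))\<^sup>2) integrable_on {T..2*T}"
      by (intro integrable_continuous_interval continuous_intros contF)
    fix t assume "t \<in> {T..2*T}"
    then have "1 * (cmod (F t))\<^sup>2 \<le> bump T t * (cmod (F t))\<^sup>2"
      using bump_ge_one[OF T, of t] by (intro mult_right_mono) auto
    then show "(cmod (F t))\<^sup>2 \<le> bump T t * (cmod (F t))\<^sup>2" by simp
  qed
  also have "\<dots> \<le> integral {T/2..5*T/2} (\<lambda>t. bump T t * (cmod (F t))\<^sup>2)"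
    using T bump_nonneg by (intro integral_subset_le intw) auto
  also have "\<dots> \<le> cmod (integral {T/2..5*T/2} (\<lambda>t. complex_of_real (bump T t * (cmod (F t))\<^sup>2)))"
  proof -
    have "integral {T/2..5*T/2} (\<lambda>t. complex_of_real (bump T t * (cmod (F t))\<^sup>2)) =
        of_real (integral {T/2..5*T/2} (\<lambda>t. bump T t * (cmod (F t))\<^sup>2))"
      using integral_linear[OF intw bounded_linear_of_real, of "T/2" "5*T/2"] by (simp only: o_def)
    then show ?thesis by (simp only: norm_of_real abs_ge_self)
  qed
  finally show ?thesis using bound unfolding F by linarith
qed

section \<open>The additive large sieve\<close>

definition e1 :: "real \<Rightarrow> complex" where "e1 t = cis (2 * pi * t)"

lemma e1_add: "e1 (s + t) = e1 s * e1 t"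
  unfolding e1_def cis_mult by (simp add: distrib_left)

lemma e1_of_nat [simp]: "e1 (of_nat n) = 1"
  unfolding e1_def by (rule cis_multiple_2pi) simp

lemma cnj_e1: "cnj (e1 t) = e1 (- t)" by (simp add: e1_def cis_cnj)

lemma e1_eq_1_imp: "e1 t = 1 \<Longrightarrow> t \<in> \<int>"
proof -
  assume "e1 t = 1"
  then have "cos (2 * pi * t) = 1" by (simp add: e1_def complex_eq_iff)
  then obtain n :: int where "2 * pi * t = of_int n * (2 * pi)"
    unfolding cos_one_2pi_int by (auto simp: mult_ac)
  then have "t = of_int n" by simp
  then show "t \<in> \<int>" by simp
qed

lemma e1_power: "e1 t ^ n = e1 (real n * t)"
proof (induction n)
  case (Suc n)
  have "real (Suc n) * t = t + real n * t" by (simp add: algebra_simps)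
  then show ?case using Suc by (simp only: e1_add power_Suc)
qed (simp add: e1_def)

lemma e1_mod:
  assumes "0 < q"
  shows "e1 (real (m mod q) / real q) = e1 (real m / real q)"
proof -
  have "real m = real (m div q) * real q + real (m mod q)"
    by (metis div_mult_mod_eq of_nat_add of_nat_mult)
  then have "real m / real q = real (m div q) + real (m mod q) / real q"
    using assms by (simp add: add_divide_distrib)
  then show ?thesis by (simp add: e1_add)
qed

lemma continuous_on_e1 [continuous_intros]:
  "continuous_on A f \<Longrightarrow> continuous_on A (\<lambda>t. e1 (f t))"
  unfolding e1_def by (intro continuous_intros)

lemma has_vector_derivative_e1:
  "((\<lambda>t. e1 (c * t)) has_vector_derivative (2 * pi * c * \<i>) * e1 (c * t)) (at t within A)"
proof -
  have "((\<lambda>z. exp (\<i> * (2 * pi * c) * z)) has_field_derivative exp (\<i> * (2 * pi * c) * of_real t) * (\<i> * (2 * pi * c))) (at (of_real t))"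
    by (auto intro!: derivative_eq_intros)
  then have "((\<lambda>t. exp (\<i> * (2 * pi * c) * of_real t)) has_vector_derivative
      exp (\<i> * (2 * pi * c) * of_real t) * (\<i> * (2 * pi * c))) (at t within A)"
    by (rule has_vector_derivative_real_field)
  then show ?thesis by (simp add: e1_def cis_conv_exp mult_ac)
qed

lemma integral_e1_eq_0:
  assumes "k \<noteq> 0"
  shows "integral {0..2} (\<lambda>t. e1 (of_int k * t)) = 0"
proof -
  let ?c = "2 * pi * real_of_int k * \<i>"
  have c: "?c \<noteq> 0" using assms by simp
  have "((\<lambda>t. ?c * e1 (of_int k * t)) has_integral (e1 (of_int k * 2) - e1 (of_int k * 0))) {0..2}"
    by (intro fundamental_theorem_of_calculus has_vector_derivative_e1) simp
  moreover have "e1 (of_int k * 2) = 1" unfolding e1_def by (rule cis_multiple_2pi) simp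
  moreover have "e1 (of_int k * 0) = 1" by (simp add: e1_def)
  ultimately have "((\<lambda>t. ?c * e1 (of_int k * t)) has_integral 0) {0..2}" by simp
  then have "integral {0..2} (\<lambda>t. ?c * e1 (of_int k * t)) = 0" by (rule integral_unique)
  then show ?thesis using c by (simp only: integral_mult_right mult_eq_0_iff) simp
qed

lemma parseval_e1:
  fixes a :: "nat \<Rightarrow> complex"
  shows "integral {0..2} (\<lambda>t. (cmod (\<Sum>n\<in>{1..N}. a n * e1 (real n * t)))\<^sup>2) = 2 * (\<Sum>n\<in>{1..N}. (cmod (a n))\<^sup>2)"
proof -
  let ?F = "\<lambda>t. \<Sum>n\<in>{1..N}. a n * e1 (real n * t)"
  have sq: "complex_of_real ((cmod (?F t))\<^sup>2) =
      (\<Sum>m\<in>{1..N}. \<Sum>n\<in>{1..N}. (a m * cnj (a n)) * e1 (of_int (int m - int n) * t))" for t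
  proof -
    have "complex_of_real ((cmod (?F t))\<^sup>2) = ?F t * cnj (?F t)" by (rule complex_norm_square)
    also have "\<dots> = (\<Sum>m\<in>{1..N}. \<Sum>n\<in>{1..N}. (a m * e1 (real m * t)) * (cnj (a n) * e1 (- (real n * t))))"
      by (simp add: sum_product cnj_e1)
    also have "\<dots> = (\<Sum>m\<in>{1..N}. \<Sum>n\<in>{1..N}. (a m * cnj (a n)) * e1 (of_int (int m - int n) * t))"
    proof (intro sum.cong refl)
      fix m n
      have "e1 (of_int (int m - int n) * t) = e1 (real m * t) * e1 (- (real n * t))"
        by (simp add: left_diff_distrib flip: e1_add)
      then show "(a m * e1 (real m * t)) * (cnj (a n) * e1 (- (real n * t))) =
          (a m * cnj (a n)) * e1 (of_int (int m - int n) * t)" by simp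
    qed
    finally show ?thesis .
  qed
  have int: "(\<lambda>t. e1 (c * t)) integrable_on {0..2}" for c
    by (intro integrable_continuous_interval continuous_intros)
  have "integral {0..2} (\<lambda>t. complex_of_real ((cmod (?F t))\<^sup>2)) =
      (\<Sum>m\<in>{1..N}. \<Sum>n\<in>{1..N}. (a m * cnj (a n)) * integral {0..2} (\<lambda>t. e1 (of_int (int m - int n) * t)))"
    unfolding sq by (simp add: integral_sum integrable_sum integrable_on_mult_right int)
  also have "\<dots> = (\<Sum>m\<in>{1..N}. \<Sum>n\<in>{1..N}. if n = m then 2 * (a m * cnj (a m)) else 0)"
  proof (intro sum.cong refl)
    fix m n
    show "(a m * cnj (a n)) * integral {0..2} (\<lambda>t. e1 (of_int (int m - int n) * t)) =
        (if n = m then 2 * (a m * cnj (a m)) else 0)"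
    proof (cases "n = m")
      case True
      then show ?thesis by (simp add: e1_def scaleR_conv_of_real)
    next
      case False
      then show ?thesis using integral_e1_eq_0[of "int m - int n"] by simp
    qed
  qed
  also have "\<dots> = of_real (2 * (\<Sum>n\<in>{1..N}. (cmod (a n))\<^sup>2))"
    by (simp add: sum_distrib_left complex_norm_square del: of_real_power)
  finally have "integral {0..2} (\<lambda>t. complex_of_real ((cmod (?F t))\<^sup>2)) = of_real (2 * (\<Sum>n\<in>{1..N}. (cmod (a n))\<^sup>2))" .
  moreover have "integral {0..2} (\<lambda>t. complex_of_real ((cmod (?F t))\<^sup>2)) = of_real (integral {0..2} (\<lambda>t. (cmod (?F t))\<^sup>2))"
  proof -
    have "(\<lambda>t. (cmod (?F t))\<^sup>2) integrable_on {0..2}"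
      by (intro integrable_continuous_interval continuous_intros)
    from integral_linear[OF this bounded_linear_of_real] show ?thesis by (simp only: o_def)
  qed
  ultimately show ?thesis by (simp only: of_real_eq_iff)
qed

text \<open>Gallagher's form of the Sobolev inequality: integrate the derivative of \<open>(\<alpha> + \<delta> - t) |F(t)|\<^sup>2\<close> over the
interval, and split \<open>2 |F| |G|\<close> by the arithmetic-geometric mean inequality.\<close>

lemma pointwise_le_local_integral:
  fixes F G :: "real \<Rightarrow> complex" and \<alpha> \<delta> K :: real
  assumes deriv: "\<And>t. (F has_vector_derivative G t) (at t)"
    and cont: "continuous_on UNIV F" "continuous_on UNIV G"
    and pos: "0 < \<delta>" "0 < K"
  shows "(cmod (F \<alpha>))\<^sup>2 \<le> integral {\<alpha>..\<alpha> + \<delta>} (\<lambda>t. (cmod (F t))\<^sup>2 / \<delta> + (K * (cmod (F t))\<^sup>2 + (cmod (G t))\<^sup>2 / K))"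
proof -
  let ?\<phi> = "\<lambda>t. (cmod (F t))\<^sup>2"
  let ?\<psi> = "\<lambda>t. 2 * (F t \<bullet> G t)"
  have contF: "continuous_on A F" "continuous_on A G" for A
    using cont continuous_on_subset by blast+
  have d: "(?\<phi> has_vector_derivative ?\<psi> t) (at t within A)" for t A
  proof -
    have "((\<lambda>t. F t \<bullet> F t) has_vector_derivative (F t \<bullet> G t + G t \<bullet> F t)) (at t within A)"
      using has_vector_derivative_at_within[OF deriv] by (intro bounded_bilinear.has_vector_derivative[OF bounded_bilinear_inner])
    then show ?thesis by (simp add: power2_norm_eq_inner inner_commute)
  qed
  have "((\<lambda>t. - ?\<phi> t + (\<alpha> + \<delta> - t) * ?\<psi> t) has_integral
      ((\<alpha> + \<delta> - (\<alpha> + \<delta>)) * ?\<phi> (\<alpha> + \<delta>) - (\<alpha> + \<delta> - \<alpha>) * ?\<phi> \<alpha>)) {\<alpha>..\<alpha> + \<delta>}"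
  proof (rule fundamental_theorem_of_calculus)
    fix t
    show "((\<lambda>t. (\<alpha> + \<delta> - t) * ?\<phi> t) has_vector_derivative (- ?\<phi> t + (\<alpha> + \<delta> - t) * ?\<psi> t)) (at t within {\<alpha>..\<alpha> + \<delta>})"
    proof -
      have "((\<lambda>t. \<alpha> + \<delta> - t) has_vector_derivative -1) (at t within {\<alpha>..\<alpha> + \<delta>})"
        unfolding has_real_derivative_iff_has_vector_derivative[symmetric]
        by (auto intro!: derivative_eq_intros)
      from has_vector_derivative_mult[OF this d[of t]] show ?thesis by (simp add: add.commute)
    qed
  qed (use pos in simp)
  then have "integral {\<alpha>..\<alpha> + \<delta>} (\<lambda>t. - ?\<phi> t + (\<alpha> + \<delta> - t) * ?\<psi> t) = - (\<delta> * ?\<phi> \<alpha>)"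
    by (simp add: integral_unique)
  then have "\<delta> * ?\<phi> \<alpha> = integral {\<alpha>..\<alpha> + \<delta>} (\<lambda>t. - (- ?\<phi> t + (\<alpha> + \<delta> - t) * ?\<psi> t))"
    by (simp only: integral_neg)
  also have "\<dots> \<le> integral {\<alpha>..\<alpha> + \<delta>} (\<lambda>t. \<delta> * (?\<phi> t / \<delta> + (K * ?\<phi> t + (cmod (G t))\<^sup>2 / K)))"
  proof (intro integral_le integrable_continuous_interval continuous_intros contF)
    fix t assume t: "t \<in> {\<alpha>..\<alpha> + \<delta>}"
    have "\<bar>?\<psi> t\<bar> \<le> 2 * (cmod (F t) * cmod (G t))"
      using Cauchy_Schwarz_ineq2[of "F t" "G t"] by (simp add: abs_mult)
    also have "\<dots> \<le> K * ?\<phi> t + (cmod (G t))\<^sup>2 / K"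
    proof -
      have "0 \<le> (K * cmod (F t) - cmod (G t))\<^sup>2 / K" using pos by simp
      also have "\<dots> = K * ?\<phi> t + (cmod (G t))\<^sup>2 / K - 2 * (cmod (F t) * cmod (G t))"
        using pos by (simp add: power2_eq_square field_simps)
      finally show ?thesis by simp
    qed
    finally have \<psi>: "\<bar>?\<psi> t\<bar> \<le> K * ?\<phi> t + (cmod (G t))\<^sup>2 / K" .
    have "- ((\<alpha> + \<delta> - t) * ?\<psi> t) \<le> \<bar>(\<alpha> + \<delta> - t) * ?\<psi> t\<bar>" by (rule abs_ge_minus_self)
    also have "\<dots> = (\<alpha> + \<delta> - t) * \<bar>?\<psi> t\<bar>" using t by (simp add: abs_mult)
    also have "\<dots> \<le> \<delta> * (K * ?\<phi> t + (cmod (G t))\<^sup>2 / K)"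
      using t \<psi> pos by (intro mult_mono) auto
    finally show "- (- ?\<phi> t + (\<alpha> + \<delta> - t) * ?\<psi> t) \<le> \<delta> * (?\<phi> t / \<delta> + (K * ?\<phi> t + (cmod (G t))\<^sup>2 / K))"
      using pos by (simp add: distrib_left)
  qed (use pos in auto)
  also have "\<dots> = \<delta> * integral {\<alpha>..\<alpha> + \<delta>} (\<lambda>t. ?\<phi> t / \<delta> + (K * ?\<phi> t + (cmod (G t))\<^sup>2 / K))"
    by (rule integral_mult_right)
  finally show ?thesis using pos by (simp only: mult_le_cancel_left_pos)
qed

text \<open>The open intervals are disjoint and lie in \<open>[0, 2]\<close>, which covers two periods in the application
below and so avoids working modulo 1.\<close>

lemma sum_integrals_separated_le:
  fixes f :: "real \<Rightarrow> real"
  assumes R: "finite R" "R \<subseteq> {0..<1}" and \<delta>: "0 < \<delta>" "\<delta> \<le> 1"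
    and sep: "\<And>r s. r \<in> R \<Longrightarrow> s \<in> R \<Longrightarrow> r < s \<Longrightarrow> \<delta> \<le> s - r"
    and f: "continuous_on UNIV f" "\<And>t. 0 \<le> f t"
  shows "(\<Sum>r\<in>R. integral {r..r + \<delta>} f) \<le> integral {0..2} f"
proof -
  let ?g = "\<lambda>r t. if t \<in> {r<..<r + \<delta>} then f t else 0"
  have cont: "continuous_on A f" for A using f(1) continuous_on_subset by blast
  have sub: "{r<..<r + \<delta>} \<subseteq> {0..2}" if "r \<in> R" for r
    using that R \<delta> by fastforce
  have int: "?g r integrable_on {0..2}" if "r \<in> R" for r
  proof -
    have "f integrable_on {r<..<r + \<delta>}"
      using integrable_continuous_interval[OF cont, of r "r + \<delta>"] by (simp add: integrable_on_open_interval_real)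
    then show ?thesis unfolding integrable_restrict_Int using sub[OF that] by (simp only: Int_absorb2)
  qed
  have "(\<Sum>r\<in>R. integral {r..r + \<delta>} f) = (\<Sum>r\<in>R. integral {0..2} (?g r))"
  proof (intro sum.cong refl)
    fix r assume "r \<in> R"
    then have "integral {0..2} (?g r) = integral {r<..<r + \<delta>} f"
      unfolding integral_restrict_Int using sub by (simp only: Int_absorb2)
    then show "integral {r..r + \<delta>} f = integral {0..2} (?g r)"
      by (simp add: integral_open_interval_real)
  qed
  also have "\<dots> = integral {0..2} (\<lambda>t. \<Sum>r\<in>R. ?g r t)"
    using R int by (intro integral_sum[symmetric]) auto
  also have "\<dots> \<le> integral {0..2} f"
  proof (intro integral_le integrable_sum int R integrable_continuous_interval cont)
    fix t :: real
    show "(\<Sum>r\<in>R. ?g r t) \<le> f t"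
    proof (cases "\<exists>r\<in>R. t \<in> {r<..<r + \<delta>}")
      case True
      then obtain r where r: "r \<in> R" "r < t" "t < r + \<delta>" by auto
      have "?g s t = 0" if "s \<in> R - {r}" for s
        using that r sep[of r s] sep[of s r] by (cases "r < s") (auto simp: not_less)
      then have "(\<Sum>s\<in>R. ?g s t) = ?g r t"
        using R r by (subst sum.remove[of _ r]) auto
      then show ?thesis using r by simp
    next
      case False
      then have "(\<Sum>r\<in>R. ?g r t) = 0" by (intro sum.neutral) auto
      then show ?thesis using f by simp
    qed
  qed
  finally show ?thesis .
qed

text \<open>The local inequality at each point, with interval length \<open>1/D\<close>, reduces the sum to mean squares of
the polynomial and its derivative over full periods, evaluated by Parseval.\<close>

theorem additive_large_sieve:
  fixes a :: "nat \<Rightarrow> complex"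
  assumes R: "finite R" "R \<subseteq> {0..<1}" and D: "1 \<le> D" "real N \<le> D" and N: "1 \<le> N"
    and sep: "\<And>r s. r \<in> R \<Longrightarrow> s \<in> R \<Longrightarrow> r < s \<Longrightarrow> 1 / D \<le> s - r"
  shows "(\<Sum>r\<in>R. (cmod (\<Sum>n\<in>{1..N}. a n * e1 (real n * r)))\<^sup>2) \<le> 84 * D * (\<Sum>n\<in>{1..N}. (cmod (a n))\<^sup>2)"
proof -
  let ?F = "\<lambda>t. \<Sum>n\<in>{1..N}. a n * e1 (real n * t)"
  let ?G = "\<lambda>t. \<Sum>n\<in>{1..N}. (a n * (2 * pi * real n * \<i>)) * e1 (real n * t)"
  let ?\<Phi> = "\<lambda>t. (cmod (?F t))\<^sup>2 / (1 / D) + (real N * (cmod (?F t))\<^sup>2 + (cmod (?G t))\<^sup>2 / real N)"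
  let ?A = "\<Sum>n\<in>{1..N}. (cmod (a n))\<^sup>2"
  have d: "(?F has_vector_derivative ?G t) (at t)" for t
  proof (rule has_vector_derivative_sum)
    fix n
    show "((\<lambda>t. a n * e1 (real n * t)) has_vector_derivative (a n * (2 * pi * real n * \<i>)) * e1 (real n * t)) (at t)"
      using has_vector_derivative_mult_right[OF has_vector_derivative_e1[of "real n" t UNIV], of "a n"]
      by (simp add: mult_ac)
  qed
  have "(\<Sum>r\<in>R. (cmod (?F r))\<^sup>2) \<le> (\<Sum>r\<in>R. integral {r..r + 1 / D} ?\<Phi>)"
    using D N by (intro sum_mono pointwise_le_local_integral d) (auto simp del: sum.cl_ivl_Suc intro!: continuous_intros)
  also have "\<dots> \<le> integral {0..2} ?\<Phi>"
    using D N sep by (intro sum_integrals_separated_le R) (auto intro!: continuous_intros)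
  also have "\<dots> = (D + real N) * integral {0..2} (\<lambda>t. (cmod (?F t))\<^sup>2) + integral {0..2} (\<lambda>t. (cmod (?G t))\<^sup>2) / real N"
  proof -
    have eq: "?\<Phi> = (\<lambda>t. (D + real N) * (cmod (?F t))\<^sup>2 + (1 / real N) * (cmod (?G t))\<^sup>2)"
      by (auto simp: algebra_simps)
    show ?thesis unfolding eq using N
      by (subst integral_add) (auto intro!: integrable_continuous_interval continuous_intros simp: integral_mult_right)
  qed
  also have "integral {0..2} (\<lambda>t. (cmod (?F t))\<^sup>2) = 2 * ?A" by (rule parseval_e1)
  also have "integral {0..2} (\<lambda>t. (cmod (?G t))\<^sup>2) = 2 * (\<Sum>n\<in>{1..N}. (cmod (a n * (2 * pi * real n * \<i>)))\<^sup>2)"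
    by (rule parseval_e1)
  also have "(\<Sum>n\<in>{1..N}. (cmod (a n * (2 * pi * real n * \<i>)))\<^sup>2) \<le> (\<Sum>n\<in>{1..N}. 40 * (real N)\<^sup>2 * (cmod (a n))\<^sup>2)"
  proof (intro sum_mono)
    fix n assume n: "n \<in> {1..N}"
    have "pi \<le> 3.15" using pi_approx by simp
    then have "(2 * pi)\<^sup>2 \<le> (2 * 3.15)\<^sup>2" by (intro power_mono) auto
    then have "(2 * pi)\<^sup>2 \<le> 40" by (simp add: power2_eq_square)
    moreover have "(real n)\<^sup>2 \<le> (real N)\<^sup>2" using n by (intro power_mono) auto
    ultimately have "(2 * pi)\<^sup>2 * (real n)\<^sup>2 * (cmod (a n))\<^sup>2 \<le> 40 * (real N)\<^sup>2 * (cmod (a n))\<^sup>2"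
      by (intro mult_mono) auto
    then show "(cmod (a n * (2 * pi * real n * \<i>)))\<^sup>2 \<le> 40 * (real N)\<^sup>2 * (cmod (a n))\<^sup>2"
      by (simp add: norm_mult power_mult_distrib mult_ac)
  qed
  also have "\<dots> = 40 * (real N)\<^sup>2 * ?A" by (simp add: sum_distrib_left)
  finally have "(\<Sum>r\<in>R. (cmod (?F r))\<^sup>2) \<le> (D + real N) * (2 * ?A) + 2 * (40 * (real N)\<^sup>2 * ?A) / real N"
    using N by (simp add: divide_right_mono)
  also have "\<dots> = (2 * D + 82 * real N) * ?A" using N by (simp add: field_simps power2_eq_square)
  also have "\<dots> \<le> (84 * D) * ?A" using D by (intro mult_right_mono sum_nonneg) auto
  finally show ?thesis .
qed

section \<open>Gauss sums and the large sieve for characters\<close>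

lemma dirichlet_characterD:
  assumes "dirichlet_character q chi"
  shows "0 < q" "chi 1 = 1" "chi (m * n) = chi m * chi n" "chi n = 0 \<longleftrightarrow> \<not> coprime n q"
proof -
  note * = assms[unfolded dirichlet_character_def]
  show "0 < q" by (rule conjunct1[OF *])
  show "chi 1 = 1" by (rule conjunct1[OF conjunct2[OF *]])
  show "chi (m * n) = chi m * chi n"
    by (rule conjunct1[OF conjunct2[OF conjunct2[OF *]], rule_format])
  show "chi n = 0 \<longleftrightarrow> \<not> coprime n q"
    by (rule conjunct2[OF conjunct2[OF conjunct2[OF conjunct2[OF *]]], rule_format])
qed

lemma primitive_character_imp_character:
  "primitive_character q chi \<Longrightarrow> dirichlet_character q chi"
  unfolding primitive_character_def by (rule conjunct1)

lemma dirichlet_character_cong: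
  assumes "dirichlet_character q chi" "[m = n] (mod q)"
  shows "chi m = chi n"
proof -
  have "chi m = chi (m mod q)" by (rule dirichlet_character_mod[OF assms(1), symmetric])
  also have "m mod q = n mod q" using assms(2) by (simp only: cong_def)
  also have "chi (n mod q) = chi n" by (rule dirichlet_character_mod[OF assms(1)])
  finally show ?thesis .
qed

lemma norm_dirichlet_character:
  assumes "dirichlet_character q chi" "coprime n q"
  shows "cmod (chi n) = 1"
proof -
  note chi = dirichlet_characterD[OF assms(1)]
  have pow: "chi (n ^ k) = chi n ^ k" for k by (induction k) (use chi(2,3) in auto)
  have "[n ^ totient q = 1] (mod q)" using assms(2) by (rule euler_theorem)
  then have "chi (n ^ totient q) = chi 1" by (rule dirichlet_character_cong[OF assms(1)])
  then have "chi n ^ totient q = 1" by (simp only: pow chi(2))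
  then have "cmod (chi n ^ totient q) = 1" by (simp only: norm_one)
  then have "cmod (chi n) ^ totient q = 1" by (simp only: norm_power)
  moreover have "0 < totient q" using chi(1) by simp
  ultimately show ?thesis using power_eq_imp_eq_base[of "cmod (chi n)" "totient q" 1] by simp
qed

lemma norm_dirichlet_character_le:
  assumes "dirichlet_character q chi"
  shows "cmod (chi n) \<le> 1"
proof (cases "coprime n q")
  case True
  then show ?thesis using norm_dirichlet_character[OF assms] by (simp only: order_refl)
next
  case False
  then have "chi n = 0" using dirichlet_characterD(4)[OF assms] by (simp only: not_False_eq_True)
  then show ?thesis by (simp only: norm_zero zero_le_one)
qed

lemma sum_residues_mult:
  fixes F :: "nat \<Rightarrow> 'b :: comm_monoid_add"
  assumes "coprime c q" "0 < q"
  shows "(\<Sum>a<q. F (c * a mod q)) = (\<Sum>a<q. F a)"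
proof -
  have inj: "inj_on (\<lambda>a. c * a mod q) {..<q}"
  proof (rule inj_onI)
    fix a b assume ab: "a \<in> {..<q}" "b \<in> {..<q}" "c * a mod q = c * b mod q"
    then have "[c * a = c * b] (mod q)" by (simp add: cong_def)
    then have "[a = b] (mod q)" by (rule iffD1[OF cong_mult_lcancel_nat[OF assms(1)]])
    then show "a = b" using ab by (simp add: cong_def)
  qed
  have "(\<lambda>a. c * a mod q) ` {..<q} = {..<q}"
    using inj assms(2) by (intro endo_inj_surj) auto
  then have "bij_betw (\<lambda>a. c * a mod q) {..<q} {..<q}" using inj by (simp add: bij_betw_def)
  from sum.reindex_bij_betw[OF this, of F] show ?thesis .
qed

text \<open>Bessel's inequality for the pairwise orthogonal family \<open>\<Xi>\<close>, each member of which has as squared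
norm the number of residues coprime to \<open>q\<close>, hence at most \<open>q\<close>. With \<open>V\<close> the left-hand side and \<open>w\<close> the combination of the characters with coefficients
\<open>v\<close>, the sum \<open>V\<close> is the scalar product of \<open>w\<close> and \<open>c\<close>, while the squared norm of \<open>w\<close> is at most \<open>q V\<close>.\<close>

lemma character_bessel:
  assumes fin: "finite \<Xi>" and \<Xi>: "\<And>chi. chi \<in> \<Xi> \<Longrightarrow> dirichlet_character q chi"
  shows "(\<Sum>chi\<in>\<Xi>. (cmod (\<Sum>a<q. cnj (chi a) * c a))\<^sup>2) \<le> real q * (\<Sum>a | a < q \<and> coprime a q. (cmod (c a))\<^sup>2)"
proof -
  let ?A = "{a. a < q \<and> coprime a q}"
  define v where "v chi = (\<Sum>a<q. cnj (chi a) * c a)" for chi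
  define w where "w a = (\<Sum>chi\<in>\<Xi>. v chi * chi a)" for a
  define V where "V = (\<Sum>chi\<in>\<Xi>. (cmod (v chi))\<^sup>2)"
  have V0: "0 \<le> V" unfolding V_def by (intro sum_nonneg) auto
  have orth: "(\<Sum>a<q. chi a * cnj (\<psi> a)) = (if \<psi> = chi then of_nat (card ?A) else 0)"
    if "chi \<in> \<Xi>" "\<psi> \<in> \<Xi>" for chi \<psi>
  proof -
    note chi = dirichlet_characterD[OF \<Xi>[OF that(1)]] and \<psi> = dirichlet_characterD[OF \<Xi>[OF that(2)]]
    show ?thesis
    proof (cases "\<psi> = chi")
      case True
      have "(\<Sum>a<q. chi a * cnj (chi a)) = (\<Sum>a<q. if coprime a q then 1 else 0)"
      proof (intro sum.cong refl)
        fix a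
        show "chi a * cnj (chi a) = (if coprime a q then 1 else 0)"
          using norm_dirichlet_character[OF \<Xi>[OF that(1)], of a] chi(4)[of a]
          by (auto simp flip: complex_norm_square)
      qed
      also have "\<dots> = of_nat (card ?A)"
        by (simp add: sum.If_cases Int_def)
      finally show ?thesis using True by simp
    next
      case False
      then obtain b where b: "chi b \<noteq> \<psi> b" by fastforce
      have bq: "coprime b q" using b chi(4)[of b] \<psi>(4)[of b] by metis
      let ?s = "\<Sum>a<q. chi a * cnj (\<psi> a)"
      have "?s = (\<Sum>a<q. chi (b * a mod q) * cnj (\<psi> (b * a mod q)))"
        using sum_residues_mult[OF bq chi(1), of "\<lambda>a. chi a * cnj (\<psi> a)"] by simp
      also have "\<dots> = (chi b * cnj (\<psi> b)) * ?s"
        unfolding dirichlet_character_mod[OF \<Xi>[OF that(1)]] dirichlet_character_mod[OF \<Xi>[OF that(2)]]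
          chi(3) \<psi>(3) by (simp add: sum_distrib_left mult_ac)
      finally have "?s = (chi b * cnj (\<psi> b)) * ?s" .
      moreover have "chi b * cnj (\<psi> b) \<noteq> 1"
      proof
        assume *: "chi b * cnj (\<psi> b) = 1"
        have "cnj (\<psi> b) * \<psi> b = 1"
          using norm_dirichlet_character[OF \<Xi>[OF that(2)] bq] complex_norm_square[of "\<psi> b"]
          by (simp add: mult.commute)
        then have "chi b = \<psi> b" using * by (metis mult.assoc mult.right_neutral mult_1)
        then show False using b by simp
      qed
      ultimately have "?s = 0" by (metis mult_cancel_right1)
      then show ?thesis using False by auto
    qed
  qed
  have cA: "(\<Sum>a<q. cnj (chi a) * c a) = (\<Sum>a\<in>?A. cnj (chi a) * c a)" if "chi \<in> \<Xi>" for chi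
    using dirichlet_characterD(4)[OF \<Xi>[OF that]] by (intro sum.mono_neutral_right) auto
  have "complex_of_real V = (\<Sum>chi\<in>\<Xi>. v chi * cnj (v chi))"
    by (simp add: V_def complex_norm_square del: of_real_power)
  also have "\<dots> = (\<Sum>chi\<in>\<Xi>. \<Sum>a\<in>?A. (v chi * chi a) * cnj (c a))"
  proof (intro sum.cong refl)
    fix chi assume "chi \<in> \<Xi>"
    then have "cnj (v chi) = (\<Sum>a\<in>?A. chi a * cnj (c a))" unfolding v_def cA[OF \<open>chi \<in> \<Xi>\<close>] by simp
    then show "v chi * cnj (v chi) = (\<Sum>a\<in>?A. (v chi * chi a) * cnj (c a))"
      by (simp add: sum_distrib_left mult_ac)
  qed
  also have "\<dots> = (\<Sum>a\<in>?A. w a * cnj (c a))"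
    unfolding w_def by (subst sum.swap) (simp add: sum_distrib_right)
  finally have "V = cmod (\<Sum>a\<in>?A. w a * cnj (c a))" using V0 by (metis abs_of_nonneg norm_of_real)
  also have "\<dots> \<le> (\<Sum>a\<in>?A. cmod (w a) * cmod (c a))"
    by (rule order_trans[OF norm_sum]) (simp add: norm_mult)
  finally have "V\<^sup>2 \<le> (\<Sum>a\<in>?A. cmod (w a) * cmod (c a))\<^sup>2" using V0 by (intro power_mono)
  also have "\<dots> \<le> (\<Sum>a\<in>?A. (cmod (w a))\<^sup>2) * (\<Sum>a\<in>?A. (cmod (c a))\<^sup>2)"
    by (rule Cauchy_Schwarz_ineq_sum)
  also have "(\<Sum>a\<in>?A. (cmod (w a))\<^sup>2) \<le> (\<Sum>a<q. (cmod (w a))\<^sup>2)"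
    by (intro sum_mono2) auto
  also have "(\<Sum>a<q. (cmod (w a))\<^sup>2) = real (card ?A) * V"
  proof -
    have "complex_of_real (\<Sum>a<q. (cmod (w a))\<^sup>2) = (\<Sum>a<q. w a * cnj (w a))"
      by (simp add: complex_norm_square del: of_real_power)
    also have "\<dots> = (\<Sum>a<q. \<Sum>chi\<in>\<Xi>. \<Sum>\<psi>\<in>\<Xi>. (v chi * cnj (v \<psi>)) * (chi a * cnj (\<psi> a)))"
      unfolding w_def by (simp add: sum_product mult_ac)
    also have "\<dots> = (\<Sum>chi\<in>\<Xi>. \<Sum>\<psi>\<in>\<Xi>. \<Sum>a<q. (v chi * cnj (v \<psi>)) * (chi a * cnj (\<psi> a)))"
      by (subst sum.swap, intro sum.cong refl, subst sum.swap, rule refl)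
    also have "\<dots> = (\<Sum>chi\<in>\<Xi>. \<Sum>\<psi>\<in>\<Xi>. if \<psi> = chi then (v chi * cnj (v chi)) * of_nat (card ?A) else 0)"
      by (intro sum.cong refl) (simp add: orth flip: sum_distrib_left)
    also have "\<dots> = (\<Sum>chi\<in>\<Xi>. (v chi * cnj (v chi)) * of_nat (card ?A))"
      using fin by simp
    also have "\<dots> = complex_of_real (real (card ?A) * V)"
      by (simp add: V_def complex_norm_square sum_distrib_right mult_ac del: of_real_power)
    finally show ?thesis by (simp only: of_real_eq_iff)
  qed
  also have "real (card ?A) * V * (\<Sum>a\<in>?A. (cmod (c a))\<^sup>2) \<le> real q * V * (\<Sum>a\<in>?A. (cmod (c a))\<^sup>2)"
  proof (intro mult_right_mono V0 sum_nonneg)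
    have "card ?A \<le> card {..<q}" by (intro card_mono) auto
    then show "real (card ?A) \<le> real q" by simp
  qed auto
  finally have *: "V * V \<le> V * (real q * (\<Sum>a\<in>?A. (cmod (c a))\<^sup>2))"
    by (simp add: power2_eq_square mult_ac mult_right_mono sum_nonneg)
  show ?thesis
  proof (cases "V = 0")
    case True
    have "0 \<le> real q * (\<Sum>a\<in>?A. (cmod (c a))\<^sup>2)" by (intro mult_nonneg_nonneg sum_nonneg) auto
    then show ?thesis using True unfolding V_def v_def by linarith
  next
    case False
    then have "V \<le> real q * (\<Sum>a\<in>?A. (cmod (c a))\<^sup>2)" using * V0 by (simp add: mult_le_cancel_left)
    then show ?thesis unfolding V_def v_def .
  qed
qed

definition gauss_sum :: "nat \<Rightarrow> (nat \<Rightarrow> complex) \<Rightarrow> nat \<Rightarrow> complex" where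
  "gauss_sum q chi n = (\<Sum>a<q. cnj (chi a) * e1 (real (a * n) / real q))"

text \<open>Multiplication by \<open>c\<close> permutes the residues.\<close>

lemma gauss_sum_shift:
  assumes "dirichlet_character q chi" "coprime c q"
  shows "gauss_sum q chi n = cnj (chi c) * gauss_sum q chi (c * n)"
proof -
  note chi = dirichlet_characterD[OF assms(1)]
  have "gauss_sum q chi n = (\<Sum>a<q. cnj (chi (c * a mod q)) * e1 (real ((c * a mod q) * n) / real q))"
    unfolding gauss_sum_def
    by (rule sum_residues_mult[OF assms(2) chi(1), of "\<lambda>a. cnj (chi a) * e1 (real (a * n) / real q)", symmetric])
  also have "\<dots> = (\<Sum>a<q. cnj (chi c) * (cnj (chi a) * e1 (real (a * (c * n)) / real q)))"
  proof (intro sum.cong refl)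
    fix a
    have "e1 (real ((c * a mod q) * n) / real q) = e1 (real ((c * a mod q) * n mod q) / real q)"
      by (rule e1_mod[OF chi(1), symmetric])
    also have "(c * a mod q) * n mod q = a * (c * n) mod q"
      unfolding mod_mult_left_eq by (simp add: mult_ac)
    also have "e1 (real (a * (c * n) mod q) / real q) = e1 (real (a * (c * n)) / real q)"
      by (rule e1_mod[OF chi(1)])
    finally show "cnj (chi (c * a mod q)) * e1 (real ((c * a mod q) * n) / real q) =
        cnj (chi c) * (cnj (chi a) * e1 (real (a * (c * n)) / real q))"
      by (simp add: dirichlet_character_mod[OF assms(1)] chi(3))
  qed
  finally show ?thesis by (simp add: gauss_sum_def sum_distrib_left)
qed

lemma gauss_sum_cong:
  assumes "0 < q" "[m = n] (mod q)"
  shows "gauss_sum q chi m = gauss_sum q chi n"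
  unfolding gauss_sum_def
proof (intro sum.cong refl)
  fix a
  have "a * m mod q = a * n mod q"
    using cong_scalar_left[OF assms(2), of a] by (simp only: cong_def)
  then have "e1 (real (a * m) / real q) = e1 (real (a * n) / real q)"
    using e1_mod[OF assms(1), of "a * m"] e1_mod[OF assms(1), of "a * n"] by simp
  then show "cnj (chi a) * e1 (real (a * m) / real q) = cnj (chi a) * e1 (real (a * n) / real q)" by simp
qed

text \<open>Add to \<open>n\<close> the multiple of \<open>d\<close> by all primes of \<open>q\<close> that do not divide \<open>n\<close>: then no prime of \<open>q\<close>
divides both summands, and each divides one of them.\<close>

lemma exists_coprime_lift:
  fixes n d q :: nat
  assumes "coprime n d" "0 < q"
  shows "\<exists>m. coprime m q \<and> [m = n] (mod d)"
proof -
  define t where "t = \<Prod>{p \<in> prime_factors q. \<not> p dvd n}"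
  have "coprime (n + d * t) q"
  proof (rule ccontr)
    assume "\<not> coprime (n + d * t) q"
    then have "gcd (n + d * t) q \<noteq> 1" unfolding coprime_iff_gcd_eq_1 .
    then obtain p where p': "prime p" "p dvd gcd (n + d * t) q"
      using prime_factor_nat by blast
    note p = p'(1) dvd_trans[OF p'(2) gcd_dvd1] dvd_trans[OF p'(2) gcd_dvd2]
    show False
    proof (cases "p dvd n")
      case True
      then have "p dvd d * t" using p by (metis dvd_add_right_iff)
      moreover have "\<not> p dvd d"
        using coprime_common_divisor_nat[OF assms(1) True] p(1) by auto
      moreover have "\<not> p dvd t"
        using p True unfolding t_def
        by (auto simp: prime_dvd_prod_iff in_prime_factors_iff dest: primes_dvd_imp_eq)
      ultimately show False using p by (simp add: prime_dvd_mult_iff)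
    next
      case False
      then have "p dvd t" unfolding t_def using p assms(2)
        by (intro dvd_prodI) (auto simp: in_prime_factors_iff)
      then show False using False p by (metis dvd_add_left_iff dvd_mult)
    qed
  qed
  moreover have "[n + d * t = n] (mod d)" by (simp add: cong_def)
  ultimately show ?thesis by blast
qed

text \<open>The character modulo \<open>d\<close> takes at \<open>n\<close> the value of \<open>chi\<close> at any lift of \<open>n\<close> to a residue coprime to \<open>q\<close>; triviality
on \<open>c = 1\<close> modulo \<open>d\<close> makes it independent of the lift.\<close>

lemma induced_character:
  assumes chi: "dirichlet_character q chi" and d: "d dvd q"
    and triv: "\<And>c. coprime c q \<Longrightarrow> [c = 1] (mod d) \<Longrightarrow> chi c = 1"
  shows "\<exists>\<psi>. dirichlet_character d \<psi> \<and> (\<forall>n. coprime n q \<longrightarrow> chi n = \<psi> n)"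
proof -
  note ch = dirichlet_characterD[OF chi]
  have d0: "0 < d" using d ch(1) by (auto intro: Nat.gr0I)
  have same: "chi m = chi n" if mn: "coprime m q" "coprime n q" "[m = n] (mod d)" for m n
  proof -
    obtain k where k: "[n * k = 1] (mod q)"
      using cong_solve_coprime_nat[OF mn(2)] by auto
    have cop: "coprime (m * k) q"
      using k mn(1) by (metis cong_imp_coprime cong_sym coprime_1_left coprime_mult_left_iff)
    have "[m * k = n * k] (mod d)" using mn(3) by (rule cong_scalar_right)
    also have "[n * k = 1] (mod d)" using k d by (rule cong_dvd_modulus_nat)
    finally have "chi (m * k) = 1" by (intro triv cop)
    moreover have "chi (n * k) = 1" using dirichlet_character_cong[OF chi k] ch(2) by simp
    ultimately have "chi m * chi k = chi n * chi k" "chi k \<noteq> 0" by (auto simp: ch(3))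
    then show ?thesis by simp
  qed
  define lift where "lift n = (SOME m. coprime m q \<and> [m = n] (mod d))" for n
  have lift: "coprime (lift n) q" "[lift n = n] (mod d)" if "coprime n d" for n
    using someI_ex[OF exists_coprime_lift[OF that ch(1)]] by (auto simp: lift_def)
  define \<psi> where "\<psi> n = (if coprime n d then chi (lift n) else 0)" for n
  have \<psi>: "\<psi> n = chi m" if "coprime m q" "[m = n] (mod d)" for m n
  proof -
    have "coprime m d" by (rule coprime_divisors[OF dvd_refl d that(1)])
    then have n: "coprime n d" using that(2) cong_imp_coprime by blast
    have "chi (lift n) = chi m"
      using lift(1)[OF n] that(1) cong_trans[OF lift(2)[OF n] cong_sym[OF that(2)]] by (rule same)
    then show ?thesis using n by (simp add: \<psi>_def)
  qed
  have "dirichlet_character d \<psi>"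
    unfolding dirichlet_character_def
  proof (intro conjI allI)
    show "\<psi> 1 = 1" using \<psi>[of 1 1] ch(2) by simp
    show "\<psi> (m * n) = \<psi> m * \<psi> n" for m n
    proof (cases "coprime m d \<and> coprime n d")
      case True
      then have "\<psi> (m * n) = chi (lift m * lift n)"
        using True lift[of m] lift[of n] by (intro \<psi> cong_mult) simp_all
      then show ?thesis using True by (simp add: ch(3) \<psi>_def)
    next
      case False
      then show ?thesis by (auto simp: \<psi>_def)
    qed
    show "\<psi> (n + d) = \<psi> n" for n
    proof (cases "coprime n d")
      case True
      have "[lift n = n + d] (mod d)" using lift[OF True] by (simp add: cong_def)
      then have "\<psi> (n + d) = chi (lift n)" using lift[OF True] by (intro \<psi>)
      then show ?thesis using True by (simp add: \<psi>_def)
    next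
      case False
      have "coprime (n + d) d \<longleftrightarrow> coprime n d" by (simp only: coprime_iff_gcd_eq_1 gcd_add1)
      then show ?thesis using False by (simp add: \<psi>_def)
    qed
    show "\<psi> n = 0 \<longleftrightarrow> \<not> coprime n d" for n
      using lift[of n] ch(4)[of "lift n"] by (auto simp: \<psi>_def)
  qed (rule d0)
  moreover have "\<forall>n. coprime n q \<longrightarrow> chi n = \<psi> n" using \<psi> by simp
  ultimately show ?thesis by blast
qed

text \<open>Let \<open>d = q / gcd n q\<close>. By primitivity some \<open>c = 1\<close> modulo \<open>d\<close> has \<open>chi c \<noteq> 1\<close>, and replacing the summation
variable \<open>a\<close> by \<open>c a\<close> multiplies the sum by a number different from 1 without changing it.\<close>

lemma gauss_sum_not_coprime:
  assumes "primitive_character q chi" "\<not> coprime n q"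
  shows "gauss_sum q chi n = 0"
proof -
  have chi: "dirichlet_character q chi" by (rule primitive_character_imp_character[OF assms(1)])
  note ch = dirichlet_characterD[OF chi]
  define g where "g = gcd n q"
  define d where "d = q div g"
  have g: "g dvd q" "g dvd n" "0 < g" using ch(1) by (auto simp: g_def)
  have q: "q = d * g" using g by (simp add: d_def)
  have "g \<noteq> 1" using assms(2) unfolding g_def coprime_iff_gcd_eq_1 .
  then have "1 < g" using g(3) by linarith
  moreover have "0 < d" using q ch(1) by (cases "d = 0") simp_all
  ultimately have "d * 1 < d * g" by (intro mult_strict_left_mono)
  then have dq: "d < q" "d dvd q" using q by simp_all
  \<comment> \<open>Otherwise \<open>chi\<close> would be induced by a character modulo the proper divisor \<open>d\<close>.\<close>
  have "\<exists>c. coprime c q \<and> [c = 1] (mod d) \<and> chi c \<noteq> 1"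
  proof (rule ccontr)
    assume "\<nexists>c. coprime c q \<and> [c = 1] (mod d) \<and> chi c \<noteq> 1"
    then have "chi c = 1" if "coprime c q" "[c = 1] (mod d)" for c using that by blast
    from induced_character[OF chi dq(2) this] obtain \<psi> where
      "dirichlet_character d \<psi> \<and> (\<forall>n. coprime n q \<longrightarrow> chi n = \<psi> n)" by (rule exE)
    then have "\<exists>d \<psi>. d dvd q \<and> d < q \<and> dirichlet_character d \<psi> \<and> (\<forall>n. coprime n q \<longrightarrow> chi n = \<psi> n)"
      using dq by (intro exI conjI; (assumption | elim conjE))
    then show False using conjunct2[OF assms(1)[unfolded primitive_character_def]] by (rule notE[rotated])
  qed
  then obtain c where c: "coprime c q" "[c = 1] (mod d)" "chi c \<noteq> 1" by blast
  have "[c * n = n] (mod q)"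
  proof -
    obtain n' where n': "n = g * n'" using g by auto
    have "c * g mod (d * g) = 1 * g mod (d * g)"
      using c(2) unfolding cong_def by (simp only: mult_mod_left[symmetric])
    then have "[c * g = 1 * g] (mod (d * g))" unfolding cong_def .
    then have "[c * g * n' = 1 * g * n'] (mod q)" unfolding q by (rule cong_scalar_right)
    then show ?thesis by (simp add: n' mult_ac)
  qed
  then have "gauss_sum q chi n = cnj (chi c) * gauss_sum q chi n"
    using gauss_sum_shift[OF chi c(1), of n] gauss_sum_cong[OF ch(1)] by metis
  moreover have "cnj (chi c) \<noteq> 1" using c(3) by (metis complex_cnj_cnj complex_cnj_one)
  ultimately show ?thesis by (metis mult_cancel_right1)
qed

lemma gauss_sum_eq:
  assumes "primitive_character q chi"
  shows "gauss_sum q chi n = chi n * gauss_sum q chi 1"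
proof (cases "coprime n q")
  case True
  have chi: "dirichlet_character q chi" by (rule primitive_character_imp_character[OF assms(1)])
  have "chi n * cnj (chi n) = 1"
    using norm_dirichlet_character[OF chi True] complex_norm_square[of "chi n"] by simp
  then show ?thesis using gauss_sum_shift[OF chi True, of 1] by (simp add: mult.assoc[symmetric])
next
  case False
  then show ?thesis
    using gauss_sum_not_coprime[OF assms False]
      dirichlet_characterD(4)[OF primitive_character_imp_character[OF assms], of n] by simp
qed

lemma parseval_mod:
  fixes c :: "nat \<Rightarrow> complex"
  assumes "0 < q"
  shows "(\<Sum>n<q. (cmod (\<Sum>a<q. c a * e1 (real (a * n) / real q)))\<^sup>2) = real q * (\<Sum>a<q. (cmod (c a))\<^sup>2)"
proof -
  let ?F = "\<lambda>n. \<Sum>a<q. c a * e1 (real (a * n) / real q)"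
  let ?z = "\<lambda>a b. e1 ((real a - real b) / real q)"
  have "complex_of_real (\<Sum>n<q. (cmod (?F n))\<^sup>2) = (\<Sum>n<q. ?F n * cnj (?F n))"
    by (simp add: complex_norm_square del: of_real_power)
  also have "\<dots> = (\<Sum>n<q. \<Sum>a<q. \<Sum>b<q. (c a * cnj (c b)) * ?z a b ^ n)"
  proof (intro sum.cong refl)
    fix n
    have "?F n * cnj (?F n) = (\<Sum>a<q. \<Sum>b<q. (c a * e1 (real (a * n) / real q)) * (cnj (c b) * e1 (- (real (b * n) / real q))))"
      by (simp add: sum_product cnj_e1)
    also have "\<dots> = (\<Sum>a<q. \<Sum>b<q. (c a * cnj (c b)) * ?z a b ^ n)"
    proof (intro sum.cong refl)
      fix a b
      have "?z a b ^ n = e1 (real (a * n) / real q + - (real (b * n) / real q))"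
        unfolding e1_power by (rule arg_cong[of _ _ e1]) (simp add: algebra_simps diff_divide_distrib)
      also have "\<dots> = e1 (real (a * n) / real q) * e1 (- (real (b * n) / real q))" by (rule e1_add)
      finally show "(c a * e1 (real (a * n) / real q)) * (cnj (c b) * e1 (- (real (b * n) / real q))) =
          (c a * cnj (c b)) * ?z a b ^ n" by simp
    qed
    finally show "?F n * cnj (?F n) = (\<Sum>a<q. \<Sum>b<q. (c a * cnj (c b)) * ?z a b ^ n)" .
  qed
  also have "\<dots> = (\<Sum>a<q. \<Sum>n<q. \<Sum>b<q. (c a * cnj (c b)) * ?z a b ^ n)"
    by (rule sum.swap)
  also have "\<dots> = (\<Sum>a<q. \<Sum>b<q. \<Sum>n<q. (c a * cnj (c b)) * ?z a b ^ n)"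
    by (rule sum.cong[OF refl], rule sum.swap)
  also have "\<dots> = (\<Sum>a<q. \<Sum>b<q. if b = a then (c a * cnj (c a)) * of_nat q else 0)"
  proof (intro sum.cong refl)
    fix a b assume ab: "a \<in> {..<q}" "b \<in> {..<q}"
    show "(\<Sum>n<q. (c a * cnj (c b)) * ?z a b ^ n) = (if b = a then (c a * cnj (c a)) * of_nat q else 0)"
    proof (cases "b = a")
      case True
      then show ?thesis by (simp add: e1_def)
    next
      case False
      have "?z a b \<noteq> 1"
      proof
        assume "?z a b = 1"
        then obtain k :: int where "(real a - real b) / real q = of_int k"
          using e1_eq_1_imp by (auto elim: Ints_cases)
        then have "real_of_int (int a - int b) = real_of_int (k * int q)"
          using assms by (simp add: field_simps)
        then have "int a - int b = k * int q" by (simp only: of_int_eq_iff)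
        then have "int q dvd int a - int b" by simp
        then have "int a mod int q = int b mod int q" by (simp add: mod_eq_dvd_iff)
        then show False using ab False by simp
      qed
      moreover have "?z a b ^ q = 1"
      proof -
        have "?z a b ^ q = e1 (real a + - real b)" unfolding e1_power using assms by simp
        also have "\<dots> = e1 (real a) * cnj (e1 (real b))" unfolding e1_add cnj_e1 ..
        finally show ?thesis by simp
      qed
      ultimately have "(\<Sum>n<q. ?z a b ^ n) = 0" by (simp add: geometric_sum)
      then show ?thesis using False by (simp flip: sum_distrib_left)
    qed
  qed
  also have "\<dots> = complex_of_real (real q * (\<Sum>a<q. (cmod (c a))\<^sup>2))"
    by (simp add: complex_norm_square sum_distrib_left mult_ac del: of_real_power)
  finally show ?thesis by (simp only: of_real_eq_iff)
qed

text \<open>Compare Parseval's formula for the discrete Fourier transform of \<open>chi\<close> with \<open>gauss_sum_eq\<close>.\<close>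

lemma norm_gauss_sum:
  assumes "primitive_character q chi"
  shows "(cmod (gauss_sum q chi 1))\<^sup>2 = real q"
proof -
  have chi: "dirichlet_character q chi" by (rule primitive_character_imp_character[OF assms(1)])
  note ch = dirichlet_characterD[OF chi]
  let ?A = "\<Sum>n<q. (cmod (chi n))\<^sup>2"
  have "(cmod (chi (1 mod q)))\<^sup>2 \<le> ?A"
    using ch(1) by (intro member_le_sum) auto
  then have A: "1 \<le> ?A" using dirichlet_character_mod[OF chi, of 1] ch(2) by simp
  have "real q * ?A = (\<Sum>n<q. (cmod (gauss_sum q chi n))\<^sup>2)"
    using parseval_mod[OF ch(1), of "\<lambda>a. cnj (chi a)"] by (simp add: gauss_sum_def)
  also have "\<dots> = (\<Sum>n<q. (cmod (chi n))\<^sup>2 * (cmod (gauss_sum q chi 1))\<^sup>2)"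
    by (intro sum.cong refl, subst gauss_sum_eq[OF assms]) (simp add: norm_mult power_mult_distrib)
  also have "\<dots> = (cmod (gauss_sum q chi 1))\<^sup>2 * ?A"
    by (simp add: sum_distrib_left mult.commute)
  finally show ?thesis using A by auto
qed

lemma finite_primitive_characters: "finite {chi. primitive_character q chi}"
  by (rule finite_subset[OF _ finite_dirichlet_characters[of q]]) (auto dest: primitive_character_imp_character)

text \<open>Gauss sums turn \<open>\<Sum> a\<^sub>n chi(n)\<close> into a combination of the values of the trigonometric polynomial at the
fractions \<open>b/q\<close>, to which Bessel's inequality applies. The factor \<open>q\<close> from Bessel cancels against the squared modulus of the Gauss sum.\<close>

lemma sum_primitive_characters_le:
  fixes a :: "nat \<Rightarrow> complex"
  assumes "0 < q"
  shows "(\<Sum>chi | primitive_character q chi. (cmod (\<Sum>n\<in>{1..N}. a n * chi n))\<^sup>2) \<le>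
    (\<Sum>b | b < q \<and> coprime b q. (cmod (\<Sum>n\<in>{1..N}. a n * e1 (real n * (real b / real q))))\<^sup>2)"
proof -
  let ?S = "\<lambda>b. \<Sum>n\<in>{1..N}. a n * e1 (real n * (real b / real q))"
  have "real q * (\<Sum>chi | primitive_character q chi. (cmod (\<Sum>n\<in>{1..N}. a n * chi n))\<^sup>2) =
      (\<Sum>chi | primitive_character q chi. (cmod (\<Sum>b<q. cnj (chi b) * ?S b))\<^sup>2)"
  proof (subst sum_distrib_left, rule sum.cong[OF refl])
    fix chi assume "chi \<in> {chi. primitive_character q chi}"
    then have chi: "primitive_character q chi" by simp
    have "(\<Sum>b<q. cnj (chi b) * ?S b) = (\<Sum>b<q. \<Sum>n\<in>{1..N}. a n * (cnj (chi b) * e1 (real (b * n) / real q)))"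
      by (simp add: sum_distrib_left mult_ac)
    also have "\<dots> = (\<Sum>n\<in>{1..N}. a n * gauss_sum q chi n)"
      by (subst sum.swap) (simp add: gauss_sum_def sum_distrib_left)
    also have "\<dots> = gauss_sum q chi 1 * (\<Sum>n\<in>{1..N}. a n * chi n)"
      by (subst gauss_sum_eq[OF chi]) (simp add: sum_distrib_left mult_ac)
    finally show "real q * (cmod (\<Sum>n\<in>{1..N}. a n * chi n))\<^sup>2 = (cmod (\<Sum>b<q. cnj (chi b) * ?S b))\<^sup>2"
      using norm_gauss_sum[OF chi] by (simp add: norm_mult power_mult_distrib)
  qed
  also have "\<dots> \<le> real q * (\<Sum>b | b < q \<and> coprime b q. (cmod (?S b))\<^sup>2)"
    by (intro character_bessel finite_primitive_characters)
      (auto dest: primitive_character_imp_character)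
  finally show ?thesis using assms by simp
qed

text \<open>Distinct reduced fractions with denominators at most \<open>Q\<close> differ by at least \<open>1/Q\<^sup>2\<close>.\<close>

theorem multiplicative_large_sieve:
  fixes a :: "nat \<Rightarrow> complex"
  assumes Q: "1 \<le> Q" and N: "1 \<le> N" "real N \<le> Q\<^sup>2"
  shows "(\<Sum>q | 0 < q \<and> real q \<le> Q. \<Sum>chi | primitive_character q chi. (cmod (\<Sum>n\<in>{1..N}. a n * chi n))\<^sup>2)
    \<le> 84 * Q\<^sup>2 * (\<Sum>n\<in>{1..N}. (cmod (a n))\<^sup>2)"
proof -
  let ?T = "\<lambda>r. (cmod (\<Sum>n\<in>{1..N}. a n * e1 (real n * r)))\<^sup>2"
  define I where "I = {q. 0 < q \<and> real q \<le> Q}"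
  define P where "P = Sigma I (\<lambda>q. {b. b < q \<and> coprime b q})"
  define r where "r = (\<lambda>(q, b). real b / real q :: real)"
  have finI: "finite I" unfolding I_def by (rule finite_subset[of _ "{..nat \<lfloor>Q\<rfloor>}"]) (auto simp: le_nat_floor)
  have finP: "finite P" unfolding P_def using finI by (intro finite_SigmaI) auto
  have sep: "1 / Q\<^sup>2 \<le> \<bar>r u - r v\<bar>" if "u \<in> P" "v \<in> P" "u \<noteq> v" for u v
  proof -
    obtain q b q' b' where uv: "u = (q, b)" "v = (q', b')" by (cases u, cases v) auto
    have P: "0 < q" "real q \<le> Q" "b < q" "coprime b q" "0 < q'" "real q' \<le> Q" "b' < q'" "coprime b' q'"
      using that uv by (auto simp: P_def I_def)
    have "b * q' \<noteq> b' * q"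
    proof
      assume eq: "b * q' = b' * q"
      have "q dvd b * q'" "q' dvd b' * q" using eq by (metis dvd_triv_right)+
      then have "q dvd q'" "q' dvd q" using P by (metis coprime_commute coprime_dvd_mult_right_iff)+
      then have "q = q'" by (rule dvd_antisym)
      then show False using eq P uv that(3) by simp
    qed
    then have "1 \<le> \<bar>int (b * q') - int (b' * q)\<bar>" by linarith
    then have "1 \<le> \<bar>real (b * q') - real (b' * q)\<bar>" by linarith
    then have "1 / Q\<^sup>2 \<le> \<bar>real (b * q') - real (b' * q)\<bar> / (real q * real q')"
      using P by (intro frac_le) (auto simp: power2_eq_square intro!: mult_mono)
    also have "\<dots> = \<bar>r u - r v\<bar>"
    proof -
      have "r u - r v = (real (b * q') - real (b' * q)) / (real q * real q')"
        using P by (simp add: uv r_def field_simps)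
      then show ?thesis using P by (simp add: abs_divide)
    qed
    finally show ?thesis .
  qed
  have Q2: "1 \<le> Q\<^sup>2" using Q by (intro one_le_power)
  have inj: "inj_on r P"
  proof (rule inj_onI, rule ccontr)
    fix u v assume uv: "u \<in> P" "v \<in> P" "r u = r v" "u \<noteq> v"
    then have "1 / Q\<^sup>2 \<le> 0" using sep[of u v] by simp
    then show False using Q2 by (simp add: divide_le_0_iff)
  qed
  have "(\<Sum>q | 0 < q \<and> real q \<le> Q. \<Sum>chi | primitive_character q chi. (cmod (\<Sum>n\<in>{1..N}. a n * chi n))\<^sup>2)
      \<le> (\<Sum>q\<in>I. \<Sum>b | b < q \<and> coprime b q. ?T (real b / real q))"
    unfolding I_def by (intro sum_mono sum_primitive_characters_le) auto
  also have "\<dots> = (\<Sum>u\<in>P. ?T (r u))"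
    unfolding P_def r_def using finI by (subst sum.Sigma) (auto intro!: sum.cong)
  also have "\<dots> = (\<Sum>t\<in>r ` P. ?T t)" by (simp add: sum.reindex[OF inj])
  also have "\<dots> \<le> 84 * Q\<^sup>2 * (\<Sum>n\<in>{1..N}. (cmod (a n))\<^sup>2)"
  proof (rule additive_large_sieve)
    show "r ` P \<subseteq> {0..<1}" by (auto simp: r_def P_def I_def)
    fix s t assume "s \<in> r ` P" "t \<in> r ` P" "s < t"
    then show "1 / Q\<^sup>2 \<le> t - s" using sep by force
  qed (use finP Q2 N in auto)
  finally show ?thesis .
qed

section \<open>Moments of zeta sums and character sums over smooth numbers\<close>

lemma norm_completely_multiplicative_le:
  assumes h: "completely_multiplicative h" "\<forall>p. prime p \<longrightarrow> cmod (h p) \<le> 1" and "0 < n"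
  shows "cmod (h n) \<le> 1"
  using \<open>0 < n\<close>
proof (induction n rule: less_induct)
  case (less n)
  show ?case
  proof (cases "n = 1")
    case True
    then show ?thesis using h by (simp add: completely_multiplicative_def)
  next
    case False
    then obtain p where p: "prime p" "p dvd n" using prime_factor_nat by blast
    then obtain m where m: "n = p * m" by blast
    have pos: "0 < m" "0 < p" using less.prems m by auto
    then have "m < n" using m prime_gt_1_nat[OF p(1)] by simp
    then have "cmod (h p) * cmod (h m) \<le> 1 * 1"
      using less.IH[of m] pos h(2) p by (intro mult_mono) auto
    then show ?thesis using h(1) pos by (simp add: m completely_multiplicative_def norm_mult)
  qed
qed

lemma integral_restrict_lborel:
  fixes g :: "real \<Rightarrow> real"
  assumes "continuous_on {a..b} g"
  shows "(\<integral>t. g t \<partial>restrict_space lborel {a..b}) = integral {a..b} g"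
proof -
  have "set_integrable lborel {a..b} g"
    unfolding set_integrable_def by (intro borel_integrable_compact assms) simp
  then have "(LINT t:{a..b}|lborel. g t) = integral {a..b} g"
    by (rule set_borel_integral_eq_integral(2))
  then show ?thesis by (simp add: integral_restrict_space set_lebesgue_integral_def)
qed

lemma sum_twisted_squares_le:
  fixes a :: "nat \<Rightarrow> real" and h :: "nat \<Rightarrow> complex"
  assumes "\<And>n. 0 < n \<Longrightarrow> cmod (h n) \<le> 1"
  shows "(\<Sum>n\<in>{1..N}. (cmod (of_real (a n) * h n))\<^sup>2) \<le> (\<Sum>n\<in>{1..N}. (a n)\<^sup>2)"
proof (intro sum_mono)
  fix n assume "n \<in> {1..N}"
  then have "\<bar>a n\<bar> * cmod (h n) \<le> \<bar>a n\<bar>" using assms[of n] by (simp add: mult_left_le)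
  then have "(\<bar>a n\<bar> * cmod (h n))\<^sup>2 \<le> \<bar>a n\<bar>\<^sup>2" by (intro power_mono) auto
  then show "(cmod (of_real (a n) * h n))\<^sup>2 \<le> (a n)\<^sup>2" by (simp add: norm_mult)
qed

lemma smooth_zeta_sum_mean:
  assumes h: "completely_multiplicative h" "\<forall>p. prime p \<longrightarrow> cmod (h p) \<le> 1"
    and adm: "admissible_range x y" and T: "x \<le> T"
  shows "1 / T * integral {T..2 * T} (\<lambda>t. cmod (\<Sum>n\<in>smooth_numbers x y. h n * of_nat n powr (\<i> * of_real t)))
    \<le> 3864 * sqrt (real (Psi x y) * S_bound x y T)"
proof -
  note a = admissible_rangeD[OF adm]
  define M where "M = restrict_space lborel {T..2 * T}"
  define X where "X t n = h n * of_nat n powr (\<i> * of_real t)" for t :: real and n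
  define N where "N = nat \<lfloor>x\<rfloor>"
  have T0: "0 < T" using a T by linarith
  have N: "1 \<le> N" "real N \<le> T" unfolding N_def using a T by linarith+
  have hle: "cmod (h n) \<le> 1" if "0 < n" for n
    using norm_completely_multiplicative_le[OF h that] .
  have X: "X t n = h n * cis (ln (real n) * t)" if "0 < n" for t n
    unfolding X_def by (simp only: nat_powr_i_times[OF that])
  have contX: "continuous_on A (\<lambda>t. X t n)" for A n
  proof (cases "0 < n")
    case True
    then show ?thesis by (simp add: X) (intro continuous_intros)
  qed (simp add: X_def)
  interpret mean_value_system M X N "84 * T"
  proof (intro mean_value_system.intro finite_measureI mean_value_system_axioms.intro)
    show "emeasure M (space M) \<noteq> \<infinity>"
      using T0 by (simp add: M_def space_restrict_space emeasure_restrict_space)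
    show "(\<lambda>t. X t n) \<in> borel_measurable M" for n
      unfolding M_def by (rule measurable_restrict_space1) (simp add: borel_measurable_continuous_onI contX)
    show "cmod (X t n) \<le> 1" if "0 < n" for t n
      using hle[OF that] by (simp add: X[OF that] norm_mult)
    show "X t 1 = 1" for t
    proof -
      have "h 1 = 1" using h(1) by (simp add: completely_multiplicative_def)
      then show ?thesis by (simp add: X_def)
    qed
    show "X t (m * n) = X t m * X t n" if "0 < m" "0 < n" for t m n
    proof -
      have "h (m * n) = h m * h n" using h(1) that by (simp add: completely_multiplicative_def)
      moreover have "cis (ln (real (m * n)) * t) = cis (ln (real m) * t) * cis (ln (real n) * t)"
        using that by (simp add: cis_mult ln_mult distrib_right)
      ultimately show ?thesis using that by (simp add: X)
    qed
    show "1 \<le> N" by (rule N)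
    fix b :: "nat \<Rightarrow> real"
    have "(\<integral>t. (cmod (\<Sum>n\<in>{1..N}. of_real (b n) * X t n))\<^sup>2 \<partial>M) =
        integral {T..2*T} (\<lambda>t. (cmod (\<Sum>n\<in>{1..N}. of_real (b n) * X t n))\<^sup>2)"
      unfolding M_def by (intro integral_restrict_lborel continuous_intros contX)
    also have "\<dots> = integral {T..2*T} (\<lambda>t. (cmod (\<Sum>n\<in>{1..N}. (of_real (b n) * h n) * of_nat n powr (\<i> * of_real t)))\<^sup>2)"
      by (simp add: X_def mult.assoc)
    also have "\<dots> \<le> 84 * T * (\<Sum>n\<in>{1..N}. (cmod (of_real (b n) * h n))\<^sup>2)"
      by (rule mean_value_powr_i[OF T0 N(2)])
    also have "\<dots> \<le> 84 * T * (\<Sum>n\<in>{1..N}. (b n)\<^sup>2)"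
      using T0 hle by (intro mult_left_mono sum_twisted_squares_le) auto
    finally show "(\<integral>t. (cmod (\<Sum>n\<in>{1..N}. of_real (b n) * X t n))\<^sup>2 \<partial>M) \<le> 84 * T * (\<Sum>n\<in>{1..N}. (b n)\<^sup>2)" .
  qed
  have "integral {T..2 * T} (\<lambda>t. cmod (\<Sum>n\<in>smooth_numbers x y. X t n)) =
      (\<integral>t. cmod (dpoly (smooth_numbers x y) (\<lambda>_. 1) t) \<partial>M)"
    unfolding dpoly_def of_real_1 mult_1 M_def
    by (intro integral_restrict_lborel[symmetric] continuous_intros contX)
  also have "\<dots> \<le> 46 * (84 * T) * sqrt (real (Psi x y) * S_bound x y T)"
    by (rule mean_smooth_bound[OF N_def adm T])
  finally show ?thesis using T0 by (simp add: X_def field_simps)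
qed

lemma smooth_character_sum_mean:
  assumes h: "completely_multiplicative h" "\<forall>p. prime p \<longrightarrow> cmod (h p) \<le> 1"
    and adm: "admissible_range x y" and Q: "1 \<le> Q" "x \<le> Q\<^sup>2"
  shows "1 / Q\<^sup>2 * (\<Sum>q | 0 < q \<and> real q \<le> Q. \<Sum>chi | primitive_character q chi.
      cmod (\<Sum>n\<in>smooth_numbers x y. h n * chi n)) \<le> 3864 * sqrt (real (Psi x y) * S_bound x y (Q\<^sup>2))"
proof -
  note a = admissible_rangeD[OF adm]
  define I where "I = {q. 0 < q \<and> real q \<le> Q}"
  define F where "F = Sigma I (\<lambda>q. {chi. primitive_character q chi})"
  define X where "X w n = h n * snd w n" for w :: "nat \<times> (nat \<Rightarrow> complex)" and n
  define N where "N = nat \<lfloor>x\<rfloor>"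
  have N: "1 \<le> N" "real N \<le> Q\<^sup>2" unfolding N_def using a Q by linarith+
  have hle: "cmod (h n) \<le> 1" if "0 < n" for n
    using norm_completely_multiplicative_le[OF h that] .
  have finI: "finite I" unfolding I_def by (rule finite_subset[of _ "{..nat \<lfloor>Q\<rfloor>}"]) (auto simp: le_nat_floor)
  have finF: "finite F" unfolding F_def using finI finite_primitive_characters by (intro finite_SigmaI)
  have sumF: "(\<Sum>w\<in>F. G w) = (\<Sum>q | 0 < q \<and> real q \<le> Q. \<Sum>chi | primitive_character q chi. G (q, chi))" for G :: "_ \<Rightarrow> real"
    unfolding F_def I_def[symmetric] using finI finite_primitive_characters by (subst sum.Sigma) auto
  have chr: "dirichlet_character (fst w) (snd w)" if "w \<in> F" for w
    using that by (auto simp: F_def intro: primitive_character_imp_character)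
  interpret mean_value_system "count_space F" X N "84 * Q\<^sup>2"
  proof (intro mean_value_system.intro finite_measure_count_space finF mean_value_system_axioms.intro)
    show "(\<lambda>w. X w n) \<in> borel_measurable (count_space F)" for n by simp
    fix w assume "w \<in> space (count_space F)"
    then have w: "w \<in> F" by simp
    note chi = dirichlet_characterD[OF chr[OF w]]
    show "cmod (X w n) \<le> 1" if "0 < n" for n
      using hle[OF that] norm_dirichlet_character_le[OF chr[OF w], of n]
      by (simp add: X_def norm_mult mult_le_one)
    show "X w 1 = 1" unfolding X_def chi(2) using h by (simp add: completely_multiplicative_def)
    show "X w (m * n) = X w m * X w n" if "0 < m" "0 < n" for m n
    proof -
      have "h (m * n) = h m * h n" using h(1) that by (simp add: completely_multiplicative_def)
      then show ?thesis unfolding X_def chi(3) by simp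
    qed
  next
    show "1 \<le> N" by (rule N)
  next
    fix b :: "nat \<Rightarrow> real"
    have "(\<integral>w. (cmod (\<Sum>n\<in>{1..N}. of_real (b n) * X w n))\<^sup>2 \<partial>count_space F) =
        (\<Sum>q | 0 < q \<and> real q \<le> Q. \<Sum>chi | primitive_character q chi. (cmod (\<Sum>n\<in>{1..N}. (of_real (b n) * h n) * chi n))\<^sup>2)"
      unfolding lebesgue_integral_count_space_finite[OF finF] sumF by (simp add: X_def mult.assoc)
    also have "\<dots> \<le> 84 * Q\<^sup>2 * (\<Sum>n\<in>{1..N}. (cmod (of_real (b n) * h n))\<^sup>2)"
      by (rule multiplicative_large_sieve[OF Q(1) N])
    also have "\<dots> \<le> 84 * Q\<^sup>2 * (\<Sum>n\<in>{1..N}. (b n)\<^sup>2)"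
      using hle by (intro mult_left_mono sum_twisted_squares_le) auto
    finally show "(\<integral>w. (cmod (\<Sum>n\<in>{1..N}. of_real (b n) * X w n))\<^sup>2 \<partial>count_space F) \<le> 84 * Q\<^sup>2 * (\<Sum>n\<in>{1..N}. (b n)\<^sup>2)" .
  qed
  have "(\<Sum>q | 0 < q \<and> real q \<le> Q. \<Sum>chi | primitive_character q chi. cmod (\<Sum>n\<in>smooth_numbers x y. h n * chi n)) =
      (\<integral>w. cmod (dpoly (smooth_numbers x y) (\<lambda>_. 1) w) \<partial>count_space F)"
    unfolding lebesgue_integral_count_space_finite[OF finF] sumF by (simp add: dpoly_def X_def)
  also have "\<dots> \<le> 46 * (84 * Q\<^sup>2) * sqrt (real (Psi x y) * S_bound x y (Q\<^sup>2))"
    by (rule mean_smooth_bound[OF N_def adm Q(2)])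
  finally show ?thesis using Q(1) by (simp add: field_simps)
qed

theorem theorem3:
  shows "(\<exists>C>0. \<forall>x y T. admissible_range x y \<longrightarrow> T \<ge> x \<longrightarrow>
            1 / T * integral {T..2 * T}
              (\<lambda>t. cmod (\<Sum>n\<in>smooth_numbers x y. of_nat n powr (\<i> * of_real t)))
            \<le> C * sqrt (real (Psi x y) * S_bound x y T))
       \<and> (\<exists>C>0. \<forall>x y Q. admissible_range x y \<longrightarrow> Q \<ge> 1 \<longrightarrow> x \<le> Q\<^sup>2 \<longrightarrow>
            1 / Q\<^sup>2 * (\<Sum>q | 0 < q \<and> real q \<le> Q. \<Sum>chi | primitive_character q chi.
              cmod (\<Sum>n\<in>smooth_numbers x y. chi n))
            \<le> C * sqrt (real (Psi x y) * S_bound x y (Q\<^sup>2)))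
       \<and> (\<exists>C>0. \<forall>h x y T. completely_multiplicative h \<longrightarrow> (\<forall>p. prime p \<longrightarrow> cmod (h p) \<le> 1) \<longrightarrow>
            admissible_range x y \<longrightarrow> T \<ge> x \<longrightarrow>
            1 / T * integral {T..2 * T}
              (\<lambda>t. cmod (\<Sum>n\<in>smooth_numbers x y. h n * of_nat n powr (\<i> * of_real t)))
            \<le> C * sqrt (real (Psi x y) * S_bound x y T))
       \<and> (\<exists>C>0. \<forall>h x y Q. completely_multiplicative h \<longrightarrow> (\<forall>p. prime p \<longrightarrow> cmod (h p) \<le> 1) \<longrightarrow>
            admissible_range x y \<longrightarrow> Q \<ge> 1 \<longrightarrow> x \<le> Q\<^sup>2 \<longrightarrow>
            1 / Q\<^sup>2 * (\<Sum>q | 0 < q \<and> real q \<le> Q. \<Sum>chi | primitive_character q chi.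
              cmod (\<Sum>n\<in>smooth_numbers x y. h n * chi n))
            \<le> C * sqrt (real (Psi x y) * S_bound x y (Q\<^sup>2)))"
proof -
  have one: "completely_multiplicative (\<lambda>_. 1)" "\<forall>p::nat. prime p \<longrightarrow> cmod 1 \<le> 1"
    by (simp_all add: completely_multiplicative_def)
  show ?thesis
  proof (intro conjI exI[of _ "3864 :: real"] allI impI)
    fix x y T :: real assume "admissible_range x y" "x \<le> T"
    from smooth_zeta_sum_mean[OF one this]
    show "1 / T * integral {T..2 * T} (\<lambda>t. cmod (\<Sum>n\<in>smooth_numbers x y. of_nat n powr (\<i> * of_real t)))
        \<le> 3864 * sqrt (real (Psi x y) * S_bound x y T)" by (simp only: mult_1)
  next
    fix x y Q :: real assume "admissible_range x y" "1 \<le> Q" "x \<le> Q\<^sup>2"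
    from smooth_character_sum_mean[OF one this]
    show "1 / Q\<^sup>2 * (\<Sum>q | 0 < q \<and> real q \<le> Q. \<Sum>chi | primitive_character q chi.
        cmod (\<Sum>n\<in>smooth_numbers x y. chi n)) \<le> 3864 * sqrt (real (Psi x y) * S_bound x y (Q\<^sup>2))"
      by (simp only: mult_1)
  qed (use smooth_zeta_sum_mean smooth_character_sum_mean in simp_all)
qed

end
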